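(* Linear investment policies are the only $\mathbf{D}$-policies such that the variance of the logarithm of wealth, $\mathrm{Var}(u_t)$, is asymptotically constant as $t\to\infty$.
   Context: The mispricing $x_t$ of an asset follows the Ornstein-Uhlenbeck process $dx_t=-\alpha x_t\,dt+\sigma\,dz_t$, where $z_t$ is a standard Wiener process, $\alpha>0$ and $\sigma>0$. An investment policy is a leverage function $f(x)$ of the mispricing; under the policy $f$ the logarithm of the investor's wealth $u_t$ evolves according to $du_t=f(x_t)\,dx_t$ (in the Itô sense). A $\mathbf{D}$-policy is a policy $f\in C^1(-\infty,+\infty)$ with $|f'(x)|\le K$ for all $x$, where $K$ is a fixed constant. A linear policy is one that is linear as a function of the mispricing $x$. *)

theory Defs
  imports "HOL-Probability.Probability"
begin

text \<open>Processes and filtrations are indexed by \<^typ>\<open>real\<close>, but only times \<open>t \<ge> 0\<close> matter: a filtration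
  \<open>(F t)\<close> for \<open>t \<ge> 0\<close> can be continued by \<open>F 0\<close> to negative times.\<close>

definition filtered_prob_space :: "'a measure \<Rightarrow> (real \<Rightarrow> 'a measure) \<Rightarrow> bool" where
  "filtered_prob_space M F \<longleftrightarrow>
     prob_space M \<and> filtration (space M) F \<and> (\<forall>t. subalgebra M (F t))"

definition adapted_process ::
    "(real \<Rightarrow> 'a measure) \<Rightarrow> (real \<Rightarrow> 'a \<Rightarrow> real) \<Rightarrow> bool" where
  "adapted_process F X \<longleftrightarrow> (\<forall>t\<ge>0. X t \<in> borel_measurable (F t))"

definition continuous_paths :: "'a measure \<Rightarrow> (real \<Rightarrow> 'a \<Rightarrow> real) \<Rightarrow> bool" where
  "continuous_paths M X \<longleftrightarrow> (\<forall>\<omega>\<in>space M. continuous_on {0..} (\<lambda>t. X t \<omega>))"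

definition wiener_process ::
    "'a measure \<Rightarrow> (real \<Rightarrow> 'a measure) \<Rightarrow> (real \<Rightarrow> 'a \<Rightarrow> real) \<Rightarrow> bool" where
  "wiener_process M F z \<longleftrightarrow>
     adapted_process F z \<and> continuous_paths M z \<and> (AE \<omega> in M. z 0 \<omega> = 0) \<and>
     (\<forall>s t. 0 \<le> s \<longrightarrow> s < t \<longrightarrow>
        distributed M lborel (\<lambda>\<omega>. z t \<omega> - z s \<omega>) (normal_density 0 (sqrt (t - s))) \<and>
        prob_space.indep_set M (sets (F s))
          (sets (vimage_algebra (space M) (\<lambda>\<omega>. z t \<omega> - z s \<omega>) borel)))"

text \<open>The elementary integrand given by \<open>n\<close>, \<open>\<tau>\<close>, \<open>\<xi>\<close> takes the value \<open>\<xi> i\<close> on the interval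
  from \<open>\<tau> i\<close> (included) to \<open>\<tau> (Suc i)\<close> (excluded), for \<open>i < n\<close>.\<close>

definition elementary_integrand ::
    "'a measure \<Rightarrow> (real \<Rightarrow> 'a measure) \<Rightarrow> real \<Rightarrow> nat \<Rightarrow> (nat \<Rightarrow> real) \<Rightarrow> (nat \<Rightarrow> 'a \<Rightarrow> real) \<Rightarrow> bool" where
  "elementary_integrand M F T n \<tau> \<xi> \<longleftrightarrow>
     \<tau> 0 = 0 \<and> \<tau> n = T \<and> (\<forall>i<n. \<tau> i \<le> \<tau> (Suc i)) \<and>
     (\<forall>i<n. \<xi> i \<in> borel_measurable (F (\<tau> i)) \<and> integrable M (\<lambda>\<omega>. (\<xi> i \<omega>)\<^sup>2))"

definition elementary_process ::
    "nat \<Rightarrow> (nat \<Rightarrow> real) \<Rightarrow> (nat \<Rightarrow> 'a \<Rightarrow> real) \<Rightarrow> real \<Rightarrow> 'a \<Rightarrow> real" where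
  "elementary_process n \<tau> \<xi> s \<omega> = (\<Sum>i<n. \<xi> i \<omega> * indicator {\<tau> i..<\<tau> (Suc i)} s)"

definition elementary_integral ::
    "(real \<Rightarrow> 'a \<Rightarrow> real) \<Rightarrow> nat \<Rightarrow> (nat \<Rightarrow> real) \<Rightarrow> (nat \<Rightarrow> 'a \<Rightarrow> real) \<Rightarrow> 'a \<Rightarrow> real" where
  "elementary_integral z n \<tau> \<xi> \<omega> = (\<Sum>i<n. \<xi> i \<omega> * (z (\<tau> (Suc i)) \<omega> - z (\<tau> i) \<omega>))"

text \<open>\<open>Y\<close> is (a version of) the integral of \<open>H\<close> against \<open>dz\<close> over the interval from \<open>0\<close> to \<open>T\<close>: the limit in
  mean square of integrals of elementary integrands that approximate \<open>H\<close> in mean square.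
  It is a relation because \<open>Y\<close> is determined only almost surely.\<close>

definition has_ito_integral ::
    "'a measure \<Rightarrow> (real \<Rightarrow> 'a measure) \<Rightarrow> (real \<Rightarrow> 'a \<Rightarrow> real) \<Rightarrow> real \<Rightarrow>
     (real \<Rightarrow> 'a \<Rightarrow> real) \<Rightarrow> ('a \<Rightarrow> real) \<Rightarrow> bool" where
  "has_ito_integral M F z T H Y \<longleftrightarrow>
     adapted_process F H \<and>
     (\<lambda>(s, \<omega>). H s \<omega>) \<in> borel_measurable (restrict_space lborel {0..T} \<Otimes>\<^sub>M M) \<and>
     Y \<in> borel_measurable M \<and>
     (\<exists>n \<tau> \<xi>.
        (\<forall>k. elementary_integrand M F T (n k) (\<tau> k) (\<xi> k)) \<and>
        (\<lambda>k. \<integral>\<^sup>+\<omega>. (\<integral>\<^sup>+s\<in>{0..T}. ennreal ((H s \<omega> - elementary_process (n k) (\<tau> k) (\<xi> k) s \<omega>)\<^sup>2) \<partial>lborel) \<partial>M)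
          \<longlonglongrightarrow> 0 \<and>
        (\<lambda>k. \<integral>\<^sup>+\<omega>. ennreal ((Y \<omega> - elementary_integral z (n k) (\<tau> k) (\<xi> k) \<omega>)\<^sup>2) \<partial>M)
          \<longlonglongrightarrow> 0)"

text \<open>\<open>dX = b dt + h dz\<close>, that is, \<open>X t - X 0\<close> is the sum of the two integrals over the interval from \<open>0\<close> to \<open>t\<close>.\<close>

definition ito_process ::
    "'a measure \<Rightarrow> (real \<Rightarrow> 'a measure) \<Rightarrow> (real \<Rightarrow> 'a \<Rightarrow> real) \<Rightarrow>
     (real \<Rightarrow> 'a \<Rightarrow> real) \<Rightarrow> (real \<Rightarrow> 'a \<Rightarrow> real) \<Rightarrow> (real \<Rightarrow> 'a \<Rightarrow> real) \<Rightarrow> bool" where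
  "ito_process M F z b h X \<longleftrightarrow>
     X 0 \<in> borel_measurable (F 0) \<and>
     (\<forall>t\<ge>0. X t \<in> borel_measurable M \<and>
        (AE \<omega> in M. set_integrable lborel {0..t} (\<lambda>s. b s \<omega>)) \<and>
        (\<exists>I. has_ito_integral M F z t h I \<and>
             (AE \<omega> in M. X t \<omega> = X 0 \<omega> + (LINT s:{0..t}|lborel. b s \<omega>) + I \<omega>)))"

definition ou_process ::
    "'a measure \<Rightarrow> (real \<Rightarrow> 'a measure) \<Rightarrow> (real \<Rightarrow> 'a \<Rightarrow> real) \<Rightarrow> real \<Rightarrow> real \<Rightarrow>
     (real \<Rightarrow> 'a \<Rightarrow> real) \<Rightarrow> bool" where
  "ou_process M F z \<alpha> \<sigma> x \<longleftrightarrow>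
     adapted_process F x \<and> continuous_paths M x \<and>
     ito_process M F z (\<lambda>t \<omega>. - \<alpha> * x t \<omega>) (\<lambda>t \<omega>. \<sigma>) x"

text \<open>\<open>du = f(x) dx\<close> for the process with \<open>dx = - \<alpha> x dt + \<sigma> dz\<close>. As usual for the Ito integral against an
  Ito process, \<open>f(x) dx\<close> stands for \<open>f(x) (- \<alpha> x) dt + f(x) \<sigma> dz\<close>.\<close>

definition log_wealth_process ::
    "'a measure \<Rightarrow> (real \<Rightarrow> 'a measure) \<Rightarrow> (real \<Rightarrow> 'a \<Rightarrow> real) \<Rightarrow> real \<Rightarrow> real \<Rightarrow>
     (real \<Rightarrow> 'a \<Rightarrow> real) \<Rightarrow> (real \<Rightarrow> real) \<Rightarrow> (real \<Rightarrow> 'a \<Rightarrow> real) \<Rightarrow> bool" where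
  "log_wealth_process M F z \<alpha> \<sigma> x f u \<longleftrightarrow>
     ito_process M F z (\<lambda>t \<omega>. f (x t \<omega>) * (- \<alpha> * x t \<omega>)) (\<lambda>t \<omega>. f (x t \<omega>) * \<sigma>) u"

definition D_policy :: "real \<Rightarrow> (real \<Rightarrow> real) \<Rightarrow> bool" where
  "D_policy K f \<longleftrightarrow> f C1_differentiable_on UNIV \<and> (\<forall>x. \<bar>deriv f x\<bar> \<le> K)"

text \<open>Linear as a function of the mispricing, with a constant term allowed. A nonzero constant policy
  is a \<open>D\<close>-policy with \<open>u t - u 0 = b * (x t - x 0)\<close>, whose variance converges, so it has to count as linear.\<close>

definition linear_policy :: "(real \<Rightarrow> real) \<Rightarrow> bool" where
  "linear_policy f \<longleftrightarrow> (\<exists>a b. \<forall>x. f x = a * x + b)"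

definition asymptotically_constant :: "(real \<Rightarrow> real) \<Rightarrow> bool" where
  "asymptotically_constant v \<longleftrightarrow> (\<exists>c. (v \<longlongrightarrow> c) at_top)"

end

theory Submission
  imports Defs
begin

text \<open>Let \<open>V\<close> solve the Poisson equation \<open>\<sigma>\<^sup>2/2 V'' - \<alpha> y V' = - \<alpha> y f + c\<close> of the Ornstein-Uhlenbeck
  generator and put \<open>r = f - V'\<close>. Ito's formula for \<open>V\<close> gives
  \<open>u t - u 0 = V (x t) - V (x 0) - c t + \<integral> r (x s) \<sigma> dz\<close>. Since \<open>V\<close> grows quadratically and the
  fourth moments of \<open>x t\<close> are bounded, only the stochastic integral can make the variance grow, and by
  the Ito isometry its second moment is \<open>\<sigma>\<^sup>2 \<integral> E (r (x s))\<^sup>2 ds\<close>. If \<open>r\<close> is nonzero somewhere, this grows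
  linearly, because \<open>x s\<close> charges every interval uniformly in large \<open>s\<close>. If \<open>r\<close> vanishes, \<open>f'\<close> is constant.
  For linear \<open>f\<close>, \<open>V\<close> is a quadratic polynomial with \<open>V' = f\<close>, and
  \<open>x t = exp (- \<alpha> t) x 0 + N\<close> with \<open>N\<close> normal and independent of the past at time \<open>0\<close> makes the variance explicit.

  Stochastic integrals of functions of \<open>x\<close> are limits of Riemann sums over dyadic meshes: there the
  mean-square errors decay geometrically, so the convergence is almost sure and Ito's formula can be
  proved path by path.\<close>

section \<open>Ito formula along a path\<close>

text \<open>Applied to a primitive of \<open>f\<close>, Ito's formula would leave the time integral
  of -\<sigma>^2/2 f'(x s), whose variance involves correlations between different times. The
  Poisson equation trades this integral for a martingale, so that the isometry reduces everything to
  expectations at single times; the remaining drift c t is deterministic and invisible to the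
  variance. The solution has to be chosen with care, since any multiple of the inverse Gaussian
  density may be added to V'. Centring f' at its stationary mean and integrating from minus infinity
  selects the solution with bounded V'', and fourth moments of \<open>x\<close> then suffice.

  The stochastic integral of r(x) is not taken from an Ito integral. It appears as the almost sure
  limit of the Riemann sums for \<open>f\<close> minus those for V', and its moments are recovered
  from the isometry for the sums by Fatou's lemma.

  The law of \<open>x 0\<close> is arbitrary up to its fourth moment. Hence lower bounds at late
  times rest on the Gaussian innovation, which is independent of \<open>x 0\<close>, and not on a
  density of \<open>x 0\<close>.\<close>

definition mesh :: "real \<Rightarrow> real \<Rightarrow> nat \<Rightarrow> nat \<Rightarrow> real" where
  "mesh a b n i = a + (b - a) * real i / 2 ^ n"

lemma mesh_0 [simp]: "mesh a b n 0 = a"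
  by (simp add: mesh_def)

lemma mesh_last [simp]: "mesh a b n (2 ^ n) = b"
  by (simp add: mesh_def)

lemma mesh_diff: "mesh a b n (Suc i) - mesh a b n i = (b - a) / 2 ^ n"
  by (simp add: mesh_def field_simps)

lemma mesh_mono: "a \<le> b \<Longrightarrow> i \<le> j \<Longrightarrow> mesh a b n i \<le> mesh a b n j"
  by (simp add: mesh_def divide_right_mono mult_left_mono)

lemma mesh_ge: "a \<le> b \<Longrightarrow> a \<le> mesh a b n i"
  using mesh_mono[of a b 0 i n] by simp

lemma mesh_le: "a \<le> b \<Longrightarrow> i \<le> 2 ^ n \<Longrightarrow> mesh a b n i \<le> b"
  using mesh_mono[of a b i "2^n" n] by simp

lemma mesh_strict_mono: "a < b \<Longrightarrow> i < j \<Longrightarrow> mesh a b n i < mesh a b n j"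
  by (simp add: mesh_def divide_strict_right_mono)

lemma mesh_subinterval: "a \<le> b \<Longrightarrow> i < 2 ^ n \<Longrightarrow> {mesh a b n i..mesh a b n (Suc i)} \<subseteq> {a..b}"
  using mesh_ge[of a b n i] mesh_le[of a b "Suc i" n] by auto

lemma mesh_width_tendsto_0: "(\<lambda>n. c / 2 ^ n) \<longlonglongrightarrow> (0::real)"
proof -
  have "(\<lambda>n. c * (1/2) ^ n) \<longlonglongrightarrow> c * 0"
    by (intro tendsto_intros) auto
  then show ?thesis by (simp add: power_divide)
qed

lemma sum_integral_mesh:
  fixes k :: "real \<Rightarrow> real"
  assumes "a \<le> b" "continuous_on {a..b} k" "m \<le> 2 ^ n"
  shows "(\<Sum>i<m. integral {mesh a b n i..mesh a b n (Suc i)} k) = integral {a..mesh a b n m} k"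
  using assms(3)
proof (induction m)
  case (Suc m)
  have "k integrable_on {a..mesh a b n (Suc m)}"
    using assms(1,2) Suc.prems mesh_le[of a b "Suc m" n]
    by (intro integrable_continuous_real continuous_on_subset[OF assms(2)]) auto
  then have "integral {a..mesh a b n m} k + integral {mesh a b n m..mesh a b n (Suc m)} k
      = integral {a..mesh a b n (Suc m)} k"
    using assms(1) by (intro Henstock_Kurzweil_Integration.integral_combine) (auto intro: mesh_ge mesh_mono)
  with Suc show ?case by simp
qed simp

lemma eventually_fine_mesh:
  fixes X :: "real \<Rightarrow> real"
  assumes "a \<le> b" "continuous_on {a..b} X" "e > 0"
  shows "\<forall>\<^sub>F n in sequentially. \<forall>i<2^n. \<forall>s\<in>{mesh a b n i..mesh a b n (Suc i)}.
           \<forall>t\<in>{mesh a b n i..mesh a b n (Suc i)}. \<bar>X s - X t\<bar> < e"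
proof -
  have "uniformly_continuous_on {a..b} X"
    using assms by (intro compact_uniformly_continuous) auto
  then obtain d where d: "d > 0"
    "\<And>s t. s \<in> {a..b} \<Longrightarrow> t \<in> {a..b} \<Longrightarrow> dist s t < d \<Longrightarrow> dist (X s) (X t) < e"
    unfolding uniformly_continuous_on_def using assms(3) by metis
  have "\<forall>\<^sub>F n in sequentially. (b - a) / 2 ^ n < d"
    using order_tendstoD(2)[OF mesh_width_tendsto_0 d(1)] .
  then show ?thesis
  proof (eventually_elim, intro allI impI ballI)
    fix n i s t
    assume h: "(b - a) / 2 ^ n < d" "i < 2 ^ n"
      "s \<in> {mesh a b n i..mesh a b n (Suc i)}" "t \<in> {mesh a b n i..mesh a b n (Suc i)}"
    have "\<bar>s - t\<bar> \<le> (b - a) / 2 ^ n"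
      using h mesh_diff[of a b n i] by auto
    then show "\<bar>X s - X t\<bar> < e"
      using d(2)[of s t] h mesh_subinterval[OF assms(1) h(2)] by (auto simp: dist_real_def)
  qed
qed

text \<open>The factor \<open>k\<close> is integrated exactly over each cell, so only the
  oscillation of \<open>g\<close> on a cell causes an error. Arbitrary tags are allowed because
  summation by parts samples right end points, while Ito sums sample left ones.\<close>

lemma tagged_sum_tendsto_integral:
  fixes g k :: "real \<Rightarrow> real"
  assumes ab: "a \<le> b" and g: "continuous_on {a..b} g" and k: "continuous_on {a..b} k"
    and tag: "\<And>n i. i < 2 ^ n \<Longrightarrow> tag n i \<in> {mesh a b n i..mesh a b n (Suc i)}"
  shows "(\<lambda>n. \<Sum>i<2^n. g (tag n i) * integral {mesh a b n i..mesh a b n (Suc i)} k)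
           \<longlonglongrightarrow> integral {a..b} (\<lambda>s. g s * k s)"
proof -
  have "bounded (k ` {a..b})"
    using k by (intro compact_imp_bounded compact_continuous_image) auto
  then obtain B where B: "B > 0" "\<And>s. s \<in> {a..b} \<Longrightarrow> \<bar>k s\<bar> \<le> B"
    by (auto simp: bounded_pos)
  show ?thesis
  proof (rule LIMSEQ_I)
    fix r :: real assume "r > 0"
    \<comment> \<open>The summand 1 keeps the denominator positive when a = b and makes the final
      estimate strict.\<close>
    define e where "e = r / (B * (b - a) + 1)"
    have den: "B * (b - a) + 1 > 0" using B ab by (simp add: add_nonneg_pos)
    then have e: "e > 0" using \<open>r > 0\<close> by (simp add: e_def)
    have "\<forall>\<^sub>F n in sequentially. norm ((\<Sum>i<2^n. g (tag n i) * integral {mesh a b n i..mesh a b n (Suc i)} k)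
        - integral {a..b} (\<lambda>s. g s * k s)) < r"
      using eventually_fine_mesh[OF ab g e]
    proof eventually_elim
      case (elim n)
      let ?I = "\<lambda>i. {mesh a b n i..mesh a b n (Suc i)}"
      have sub: "?I i \<subseteq> {a..b}" if "i < 2 ^ n" for i using mesh_subinterval[OF ab that] .
      have int: "(\<lambda>s. g s * k s) integrable_on ?I i" "k integrable_on ?I i" if "i < 2 ^ n" for i
        using continuous_on_subset[OF g sub[OF that]] continuous_on_subset[OF k sub[OF that]]
        by (auto intro!: integrable_continuous_real continuous_intros)
      have one: "\<bar>g (tag n i) * integral (?I i) k - integral (?I i) (\<lambda>s. g s * k s)\<bar> \<le> e * B * ((b - a) / 2 ^ n)"
        if i: "i < 2 ^ n" for i
      proof -
        have "g (tag n i) * integral (?I i) k - integral (?I i) (\<lambda>s. g s * k s)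
            = integral (?I i) (\<lambda>s. (g (tag n i) - g s) * k s)"
          unfolding left_diff_distrib
          using int(1)[OF i] integrable_cmul[OF int(2)[OF i], of "g (tag n i)"]
          by (subst Henstock_Kurzweil_Integration.integral_diff) auto
        moreover have "norm (integral (?I i) (\<lambda>s. (g (tag n i) - g s) * k s))
            \<le> e * B * (mesh a b n (Suc i) - mesh a b n i)"
        proof (rule integral_bound)
          show "mesh a b n i \<le> mesh a b n (Suc i)" using ab by (intro mesh_mono) auto
          show "continuous_on (?I i) (\<lambda>s. (g (tag n i) - g s) * k s)"
            using continuous_on_subset[OF g sub[OF i]] continuous_on_subset[OF k sub[OF i]]
            by (intro continuous_intros)
          fix s assume s: "s \<in> ?I i"
          have "\<bar>g (tag n i) - g s\<bar> \<le> e" "\<bar>k s\<bar> \<le> B"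
            using elim i tag[OF i] s B(2)[of s] sub[OF i] by (auto simp: less_imp_le)
          then show "norm ((g (tag n i) - g s) * k s) \<le> e * B"
            using e B by (auto simp: abs_mult intro!: mult_mono)
        qed
        ultimately show ?thesis by (simp add: mesh_diff)
      qed
      have "integral {a..b} (\<lambda>s. g s * k s) = (\<Sum>i<2^n. integral (?I i) (\<lambda>s. g s * k s))"
        using sum_integral_mesh[OF ab continuous_on_mult[OF g k], of "2^n" n] by simp
      then have "norm ((\<Sum>i<2^n. g (tag n i) * integral (?I i) k) - integral {a..b} (\<lambda>s. g s * k s))
          = \<bar>\<Sum>i<2^n. (g (tag n i) * integral (?I i) k - integral (?I i) (\<lambda>s. g s * k s))\<bar>"
        by (simp add: sum_subtractf)
      also have "\<dots> \<le> (\<Sum>i<(2::nat)^n. e * B * ((b - a) / 2 ^ n))"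
        by (rule order_trans[OF sum_abs]) (intro sum_mono one, auto)
      also have "\<dots> = e * (B * (b - a))" by simp
      also have "\<dots> < e * (B * (b - a) + 1)" using e by simp
      also have "\<dots> = r" using den by (simp add: e_def)
      finally show ?case .
    qed
    then show "\<exists>no. \<forall>n\<ge>no. norm ((\<Sum>i<2^n. g (tag n i) * integral {mesh a b n i..mesh a b n (Suc i)} k)
        - integral {a..b} (\<lambda>s. g s * k s)) < r"
      by (simp add: eventually_sequentially)
  qed
qed

lemma riemann_sum_tendsto_integral:
  fixes g :: "real \<Rightarrow> real"
  assumes "a \<le> b" "continuous_on {a..b} g"
  shows "(\<lambda>n. \<Sum>i<2^n. g (mesh a b n i) * ((b - a) / 2 ^ n)) \<longlonglongrightarrow> integral {a..b} g"
proof -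
  have eq: "integral {mesh a b n i..mesh a b n (Suc i)} (\<lambda>_. 1::real) = (b - a) / 2 ^ n" for n i
    using mesh_mono[of a b i "Suc i" n] assms(1) by (simp add: mesh_diff)
  show ?thesis
    using tagged_sum_tendsto_integral[of a b g "\<lambda>_. 1" "mesh a b"] assms mesh_mono[of a b]
    unfolding eq by simp
qed

text \<open>This lets an estimate end in a fixed multiple of \<open>e\<close>; dividing by C + 1
  also covers C = 0.\<close>

lemma tendsto_0_if_eventually_le:
  fixes f :: "nat \<Rightarrow> real"
  assumes "C \<ge> 0" "\<And>e. e > 0 \<Longrightarrow> \<forall>\<^sub>F n in sequentially. \<bar>f n\<bar> \<le> C * e"
  shows "f \<longlonglongrightarrow> 0"
proof (rule tendstoI)
  fix r :: real assume r: "r > 0"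
  have "\<forall>\<^sub>F n in sequentially. \<bar>f n\<bar> \<le> C * (r / (C + 1))"
    using r assms by (intro assms(2)) simp
  moreover have "C * (r / (C + 1)) < r"
    using r assms(1) by (simp add: field_simps)
  ultimately show "\<forall>\<^sub>F n in sequentially. dist (f n) 0 < r"
    by (auto elim!: eventually_mono)
qed

text \<open>Lagrange's remainder contains \<open>V2\<close> at an intermediate point, and moving it
  to \<open>p\<close> costs at most \<open>e\<close>. The bound serves twice: on small cells, where
  continuity makes \<open>e\<close> small, and from the origin with \<open>e\<close> a global bound,
  where it yields quadratic growth.\<close>

lemma abs_diff_Taylor_2_le:
  fixes V V1 V2 :: "real \<Rightarrow> real"
  assumes V: "\<And>y. (V has_real_derivative V1 y) (at y)" "\<And>y. (V1 has_real_derivative V2 y) (at y)"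
    and e: "\<And>y. y \<in> closed_segment p q \<Longrightarrow> \<bar>V2 y - V2 p\<bar> \<le> e"
  shows "\<bar>V q - V p - V1 p * (q - p) - V2 p / 2 * (q - p)\<^sup>2\<bar> \<le> e / 2 * (q - p)\<^sup>2"
proof (cases "p = q")
  case False
  define D where "D = (\<lambda>m::nat. if m = 0 then V else if m = 1 then V1 else V2)"
  have "\<exists>t. (if q < p then q < t \<and> t < p else p < t \<and> t < q) \<and>
      V q = (\<Sum>m<2. D m p / fact m * (q - p) ^ m) + D 2 t / fact 2 * (q - p) ^ 2"
    using V False by (intro Taylor[where a = "min p q" and b = "max p q"]) (auto simp: D_def less_2_cases_iff)
  then obtain t where t: "if q < p then q < t \<and> t < p else p < t \<and> t < q"
      "V q = V p + V1 p * (q - p) + V2 t / 2 * (q - p)\<^sup>2"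
    by (auto simp: D_def numeral_2_eq_2)
  from t(1) have seg: "t \<in> closed_segment p q"
    by (auto simp: closed_segment_eq_real_ivl split: if_splits)
  have "V q - V p - V1 p * (q - p) - V2 p / 2 * (q - p)\<^sup>2 = (V2 t - V2 p) / 2 * (q - p)\<^sup>2"
    using t(2) by (simp add: field_simps)
  then show ?thesis
    using e[OF seg] by (simp only: ) (simp add: abs_mult mult_right_mono)
qed auto

text \<open>The equation is required only between neighbouring dyadic times. For a fixed pair of
  times it holds almost surely, so a single null set serves all these countably many pairs.\<close>

locale ou_path =
  fixes a b \<alpha> \<sigma> :: real and X Z :: "real \<Rightarrow> real"
  assumes ab: "a \<le> b" and \<alpha>: "\<alpha> > 0" and X: "continuous_on {a..b} X"
    and increment: "\<And>n i. i < 2 ^ n \<Longrightarrow> X (mesh a b n (Suc i)) - X (mesh a b n i)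
      = integral {mesh a b n i..mesh a b n (Suc i)} (\<lambda>s. - \<alpha> * X s) + \<sigma> * (Z (mesh a b n (Suc i)) - Z (mesh a b n i))"
begin

abbreviation "dX n i \<equiv> X (mesh a b n (Suc i)) - X (mesh a b n i)"
abbreviation "dZ n i \<equiv> Z (mesh a b n (Suc i)) - Z (mesh a b n i)"
abbreviation "drift n i \<equiv> integral {mesh a b n i..mesh a b n (Suc i)} (\<lambda>s. - \<alpha> * X s)"

lemma tag_left: "mesh a b n i \<in> {mesh a b n i..mesh a b n (Suc i)}"
  and tag_right: "mesh a b n (Suc i) \<in> {mesh a b n i..mesh a b n (Suc i)}"
  using mesh_mono[OF ab, of i "Suc i" n] by auto

text \<open>Summation by parts for the product of the exponential and \<open>X\<close>. The
  exponential has bounded variation, so no quadratic variation appears, and the integrals coming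
  from its increments and from the drift cancel in the limit.\<close>

lemma exp_sum_tendsto:
  "(\<lambda>n. \<Sum>i<2^n. exp (\<alpha> * mesh a b n i) * \<sigma> * dZ n i) \<longlonglongrightarrow> exp (\<alpha> * b) * X b - exp (\<alpha> * a) * X a"
proof -
  let ?E = "\<lambda>n i. integral {mesh a b n i..mesh a b n (Suc i)} (\<lambda>s. \<alpha> * exp (\<alpha> * s))"
  have E: "?E n i = exp (\<alpha> * mesh a b n (Suc i)) - exp (\<alpha> * mesh a b n i)" for n i
    by (intro integral_unique fundamental_theorem_of_calculus)
      (auto intro!: mesh_mono ab derivative_eq_intros simp flip: has_real_derivative_iff_has_vector_derivative)
  have 1: "(\<lambda>n. \<Sum>i<2^n. X (mesh a b n (Suc i)) * ?E n i) \<longlonglongrightarrow> integral {a..b} (\<lambda>s. X s * (\<alpha> * exp (\<alpha> * s)))"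
    by (rule tagged_sum_tendsto_integral[OF ab X _ tag_right]) (intro continuous_intros)
  have 2: "(\<lambda>n. \<Sum>i<2^n. exp (\<alpha> * mesh a b n i) * drift n i) \<longlonglongrightarrow> integral {a..b} (\<lambda>s. exp (\<alpha> * s) * (- \<alpha> * X s))"
    using X by (intro tagged_sum_tendsto_integral[OF ab _ _ tag_left]) (auto intro!: continuous_intros)
  have eq: "(\<Sum>i<2^n. exp (\<alpha> * mesh a b n i) * \<sigma> * dZ n i) = exp (\<alpha> * b) * X b - exp (\<alpha> * a) * X a
      - (\<Sum>i<2^n. X (mesh a b n (Suc i)) * ?E n i) - (\<Sum>i<2^n. exp (\<alpha> * mesh a b n i) * drift n i)" for n
  proof -
    have "exp (\<alpha> * b) * X b - exp (\<alpha> * a) * X a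
        = (\<Sum>i<2^n. exp (\<alpha> * mesh a b n (Suc i)) * X (mesh a b n (Suc i)) - exp (\<alpha> * mesh a b n i) * X (mesh a b n i))"
      by (subst sum_lessThan_telescope[of "\<lambda>i. exp (\<alpha> * mesh a b n i) * X (mesh a b n i)"]) simp
    also have "\<dots> = (\<Sum>i<2^n. X (mesh a b n (Suc i)) * ?E n i + exp (\<alpha> * mesh a b n i) * drift n i
        + exp (\<alpha> * mesh a b n i) * \<sigma> * dZ n i)"
    proof (intro sum.cong refl)
      fix i assume "i \<in> {..<(2::nat)^n}"
      then have "exp (\<alpha> * mesh a b n i) * dX n i
          = exp (\<alpha> * mesh a b n i) * drift n i + exp (\<alpha> * mesh a b n i) * \<sigma> * dZ n i"
        by (subst increment) (auto simp: algebra_simps)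
      then show "exp (\<alpha> * mesh a b n (Suc i)) * X (mesh a b n (Suc i)) - exp (\<alpha> * mesh a b n i) * X (mesh a b n i)
          = X (mesh a b n (Suc i)) * ?E n i + exp (\<alpha> * mesh a b n i) * drift n i + exp (\<alpha> * mesh a b n i) * \<sigma> * dZ n i"
        unfolding E by (simp add: algebra_simps)
    qed
    finally show ?thesis unfolding sum.distrib by linarith
  qed
  have "integral {a..b} (\<lambda>s. exp (\<alpha> * s) * (- \<alpha> * X s)) = - integral {a..b} (\<lambda>s. X s * (\<alpha> * exp (\<alpha> * s)))"
    by (simp only: Henstock_Kurzweil_Integration.integral_neg[symmetric]) (simp add: mult_ac)
  then show ?thesis
    unfolding eq using tendsto_diff[OF tendsto_diff[OF tendsto_const 1] 2] by simp
qed

text \<open>The two squares differ by a product with the drift of the cell. The drifts are of order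
  2^-n and there are 2^n of them, so the uniform smallness of the other factor decides.\<close>

lemma quadratic_diff_tendsto_0:
  assumes C: "\<And>n i. i < 2 ^ n \<Longrightarrow> \<bar>c n i\<bar> \<le> C"
  shows "(\<lambda>n. \<Sum>i<2^n. c n i * ((dX n i)\<^sup>2 - (\<sigma> * dZ n i)\<^sup>2)) \<longlonglongrightarrow> 0"
proof -
  have "bounded (X ` {a..b})"
    using X by (intro compact_imp_bounded compact_continuous_image) auto
  then obtain B where B: "B > 0" "\<And>s. s \<in> {a..b} \<Longrightarrow> \<bar>X s\<bar> \<le> B"
    by (auto simp: bounded_pos)
  have C0: "C \<ge> 0" using C[of 0 0] by auto
  show ?thesis
  proof (rule tendsto_0_if_eventually_le[where C = "C * (\<alpha> * B * (b - a)) * 3"])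
    show "0 \<le> C * (\<alpha> * B * (b - a)) * 3" using C0 B \<alpha> ab by simp
    fix e :: real assume e: "e > 0"
    have "\<forall>\<^sub>F n in sequentially. \<alpha> * B * (b - a) / 2 ^ n < e"
      using order_tendstoD(2)[OF mesh_width_tendsto_0 e] .
    with eventually_fine_mesh[OF ab X e]
    show "\<forall>\<^sub>F n in sequentially. \<bar>\<Sum>i<2^n. c n i * ((dX n i)\<^sup>2 - (\<sigma> * dZ n i)\<^sup>2)\<bar> \<le> C * (\<alpha> * B * (b - a)) * 3 * e"
    proof eventually_elim
      case (elim n)
      have one: "\<bar>c n i * ((dX n i)\<^sup>2 - (\<sigma> * dZ n i)\<^sup>2)\<bar> \<le> C * (\<alpha> * B * (b - a) / 2 ^ n * (3 * e))"
        if i: "i < 2 ^ n" for i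
      proof -
        have sub: "{mesh a b n i..mesh a b n (Suc i)} \<subseteq> {a..b}" using mesh_subinterval[OF ab i] .
        have "norm (drift n i) \<le> \<alpha> * B * (mesh a b n (Suc i) - mesh a b n i)"
          using sub B \<alpha> by (intro integral_bound mesh_mono ab)
            (auto simp: abs_mult subset_iff intro!: continuous_intros continuous_on_subset[OF X])
        then have D: "\<bar>drift n i\<bar> \<le> \<alpha> * B * (b - a) / 2 ^ n" by (simp add: mesh_diff)
        have x: "\<bar>dX n i\<bar> < e" using elim i tag_left tag_right by auto
        \<comment> \<open>Here the drift is the difference of \<open>dX\<close> and
          \<open>\<sigma> * dZ\<close>. The second factor is at most 2 e + e, whence the constant
          3.\<close>
        have "(dX n i)\<^sup>2 - (\<sigma> * dZ n i)\<^sup>2 = drift n i * (2 * dX n i - drift n i)"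
          unfolding power2_eq_square using increment[OF i] by (simp only: ) (simp add: algebra_simps)
        then have "\<bar>(dX n i)\<^sup>2 - (\<sigma> * dZ n i)\<^sup>2\<bar> \<le> \<alpha> * B * (b - a) / 2 ^ n * (3 * e)"
          using D x elim(2) B \<alpha> ab e by (simp only: abs_mult) (intro mult_mono; auto)
        then show ?thesis
          using C[OF i] C0 by (simp only: abs_mult) (intro mult_mono; auto)
      qed
      have "\<bar>\<Sum>i<2^n. c n i * ((dX n i)\<^sup>2 - (\<sigma> * dZ n i)\<^sup>2)\<bar> \<le> (\<Sum>i<(2::nat)^n. C * (\<alpha> * B * (b - a) / 2 ^ n * (3 * e)))"
        by (rule order_trans[OF sum_abs]) (intro sum_mono one, auto)
      then show ?case by simp
    qed
  qed
qed

text \<open>Ito's formula along a single path: the quadratic variation of \<open>Z\<close>, plain and weighted,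
  enters only through the two hypotheses.\<close>

lemma Ito_sum_tendsto:
  fixes V V1 V2 :: "real \<Rightarrow> real"
  assumes V: "\<And>y. (V has_real_derivative V1 y) (at y)" "\<And>y. (V1 has_real_derivative V2 y) (at y)"
    and V2: "continuous_on UNIV V2"
    and q1: "(\<lambda>n. \<Sum>i<2^n. (dZ n i)\<^sup>2 - (b - a) / 2 ^ n) \<longlonglongrightarrow> 0"
    and q2: "(\<lambda>n. \<Sum>i<2^n. V2 (X (mesh a b n i)) * ((dZ n i)\<^sup>2 - (b - a) / 2 ^ n)) \<longlonglongrightarrow> 0"
  shows "(\<lambda>n. \<Sum>i<2^n. V1 (X (mesh a b n i)) * \<sigma> * dZ n i) \<longlonglongrightarrow>
    V (X b) - V (X a) - integral {a..b} (\<lambda>s. - \<alpha> * X s * V1 (X s) + \<sigma>\<^sup>2 / 2 * V2 (X s))"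
proof -
  have V1c: "continuous_on UNIV V1"
    using V(2) by (intro DERIV_continuous_on) (auto intro: DERIV_subset)
  have V1X: "continuous_on {a..b} (\<lambda>s. V1 (X s))" and V2X: "continuous_on {a..b} (\<lambda>s. V2 (X s))"
    using continuous_on_compose2[OF V1c X] continuous_on_compose2[OF V2 X] by auto
  have "bounded ((\<lambda>s. V2 (X s)) ` {a..b})"
    using V2X by (intro compact_imp_bounded compact_continuous_image) auto
  then obtain C where C: "C > 0" "\<And>s. s \<in> {a..b} \<Longrightarrow> \<bar>V2 (X s)\<bar> \<le> C"
    by (auto simp: bounded_pos)
  let ?x = "\<lambda>n i. X (mesh a b n i)"
  let ?R = "\<lambda>n i. V (?x n (Suc i)) - V (?x n i) - V1 (?x n i) * dX n i - V2 (?x n i) / 2 * (dX n i)\<^sup>2"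
  have E1: "(\<lambda>n. \<Sum>i<2^n. 1 * ((dX n i)\<^sup>2 - (\<sigma> * dZ n i)\<^sup>2)) \<longlonglongrightarrow> 0"
    by (rule quadratic_diff_tendsto_0[of _ 1]) auto
  have E2: "(\<lambda>n. \<Sum>i<2^n. V2 (?x n i) * ((dX n i)\<^sup>2 - (\<sigma> * dZ n i)\<^sup>2)) \<longlonglongrightarrow> 0"
    by (rule quadratic_diff_tendsto_0[of _ C]) (auto intro!: C mesh_ge mesh_le ab)
  \<comment> \<open>The unweighted quadratic variation is needed only to keep the sum of squared
    increments bounded in the Taylor remainder.\<close>
  have QX: "(\<lambda>n. \<Sum>i<2^n. (dX n i)\<^sup>2) \<longlonglongrightarrow> \<sigma>\<^sup>2 * (b - a)"
  proof -
    have "(\<Sum>i<2^n. (\<sigma> * dZ n i)\<^sup>2) = \<sigma>\<^sup>2 * (\<Sum>i<2^n. (dZ n i)\<^sup>2)" for n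
      by (simp only: power_mult_distrib sum_distrib_left)
    then have "(\<Sum>i<2^n. (dX n i)\<^sup>2) = (\<Sum>i<2^n. 1 * ((dX n i)\<^sup>2 - (\<sigma> * dZ n i)\<^sup>2))
        + \<sigma>\<^sup>2 * (\<Sum>i<2^n. (dZ n i)\<^sup>2 - (b - a) / 2 ^ n) + \<sigma>\<^sup>2 * (b - a)" for n
      by (simp add: sum_subtractf) (simp add: algebra_simps)
    then show ?thesis
      using tendsto_add[OF tendsto_add[OF E1 tendsto_mult_left[OF q1, of "\<sigma>\<^sup>2"]] tendsto_const, of "\<sigma>\<^sup>2 * (b - a)"]
      by simp
  qed
  have R: "(\<lambda>n. \<Sum>i<2^n. ?R n i) \<longlonglongrightarrow> 0"
  proof (rule tendsto_0_if_eventually_le[where C = "(\<sigma>\<^sup>2 * (b - a) + 1) / 2"])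
    show "0 \<le> (\<sigma>\<^sup>2 * (b - a) + 1) / 2" using ab by simp
    fix e :: real assume e: "e > 0"
    have "\<forall>\<^sub>F n in sequentially. (\<Sum>i<2^n. (dX n i)\<^sup>2) < \<sigma>\<^sup>2 * (b - a) + 1"
      using order_tendstoD(2)[OF QX] by simp
    with eventually_fine_mesh[OF ab V2X e]
    show "\<forall>\<^sub>F n in sequentially. \<bar>\<Sum>i<2^n. ?R n i\<bar> \<le> (\<sigma>\<^sup>2 * (b - a) + 1) / 2 * e"
    proof eventually_elim
      case (elim n)
      have one: "\<bar>?R n i\<bar> \<le> e / 2 * (dX n i)\<^sup>2" if i: "i < 2 ^ n" for i
      proof (rule abs_diff_Taylor_2_le[OF V])
        fix y assume y: "y \<in> closed_segment (?x n i) (?x n (Suc i))"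
        have Xi: "continuous_on {mesh a b n i..mesh a b n (Suc i)} X"
          using continuous_on_subset[OF X mesh_subinterval[OF ab i]] .
        \<comment> \<open>Every point between the two end values is a value of the path on the cell,
          so uniform continuity of \<open>V2\<close> along the path controls the Taylor
          remainder.\<close>
        have "\<exists>s\<in>{mesh a b n i..mesh a b n (Suc i)}. X s = y"
        proof (cases "?x n i \<le> ?x n (Suc i)")
          case True
          then show ?thesis
            using IVT'[of X "mesh a b n i" y "mesh a b n (Suc i)"] y Xi mesh_mono[OF ab, of i "Suc i" n]
            by (auto simp: closed_segment_eq_real_ivl)
        next
          case False
          then show ?thesis
            using IVT2'[of X "mesh a b n (Suc i)" y "mesh a b n i"] y Xi mesh_mono[OF ab, of i "Suc i" n]
            by (auto simp: closed_segment_eq_real_ivl)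
        qed
        then show "\<bar>V2 y - V2 (?x n i)\<bar> \<le> e"
          using elim(1) i tag_left[of n i] by (auto intro: less_imp_le)
      qed
      have "\<bar>\<Sum>i<2^n. ?R n i\<bar> \<le> (\<Sum>i<2^n. e / 2 * (dX n i)\<^sup>2)"
        by (rule order_trans[OF sum_abs]) (intro sum_mono one, auto)
      also have "\<dots> = e / 2 * (\<Sum>i<2^n. (dX n i)\<^sup>2)" by (simp add: sum_distrib_left)
      also have "\<dots> \<le> e / 2 * (\<sigma>\<^sup>2 * (b - a) + 1)" using elim(2) e by (intro mult_left_mono) auto
      finally show ?case by (simp add: field_simps)
    qed
  qed
  have S1: "(\<lambda>n. \<Sum>i<2^n. V1 (?x n i) * drift n i) \<longlonglongrightarrow> integral {a..b} (\<lambda>s. V1 (X s) * (- \<alpha> * X s))"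
    using X by (intro tagged_sum_tendsto_integral[OF ab V1X _ tag_left]) (auto intro!: continuous_intros)
  have S2: "(\<lambda>n. \<Sum>i<2^n. V2 (?x n i) * ((b - a) / 2 ^ n)) \<longlonglongrightarrow> integral {a..b} (\<lambda>s. V2 (X s))"
    by (rule riemann_sum_tendsto_integral[OF ab V2X])
  \<comment> \<open>An exact identity at every level \<open>n\<close>: Taylor's expansion, with the
    squared increment of \<open>X\<close> replaced first by that of \<open>\<sigma> * Z\<close> and
    then by the cell length. Each sum on the right has a known limit.\<close>
  have eq: "(\<Sum>i<2^n. V1 (?x n i) * \<sigma> * dZ n i) = V (X b) - V (X a) - (\<Sum>i<2^n. V1 (?x n i) * drift n i)
      - (\<Sum>i<2^n. ?R n i) - 1/2 * (\<Sum>i<2^n. V2 (?x n i) * ((dX n i)\<^sup>2 - (\<sigma> * dZ n i)\<^sup>2))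
      - \<sigma>\<^sup>2/2 * (\<Sum>i<2^n. V2 (?x n i) * ((dZ n i)\<^sup>2 - (b - a) / 2 ^ n))
      - \<sigma>\<^sup>2/2 * (\<Sum>i<2^n. V2 (?x n i) * ((b - a) / 2 ^ n))" for n
  proof -
    have "V (X b) - V (X a) = (\<Sum>i<2^n. V (?x n (Suc i)) - V (?x n i))"
      by (subst sum_lessThan_telescope[of "\<lambda>i. V (?x n i)"]) simp
    also have "\<dots> = (\<Sum>i<2^n. V1 (?x n i) * \<sigma> * dZ n i + V1 (?x n i) * drift n i + ?R n i
      + 1/2 * (V2 (?x n i) * ((dX n i)\<^sup>2 - (\<sigma> * dZ n i)\<^sup>2))
      + \<sigma>\<^sup>2/2 * (V2 (?x n i) * ((dZ n i)\<^sup>2 - (b - a) / 2 ^ n))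
      + \<sigma>\<^sup>2/2 * (V2 (?x n i) * ((b - a) / 2 ^ n)))"
    proof (intro sum.cong refl)
      fix i assume "i \<in> {..<(2::nat)^n}"
      then have "V1 (?x n i) * dX n i = V1 (?x n i) * \<sigma> * dZ n i + V1 (?x n i) * drift n i"
        by (subst increment) (auto simp: algebra_simps)
      then show "V (?x n (Suc i)) - V (?x n i) = V1 (?x n i) * \<sigma> * dZ n i + V1 (?x n i) * drift n i + ?R n i
      + 1/2 * (V2 (?x n i) * ((dX n i)\<^sup>2 - (\<sigma> * dZ n i)\<^sup>2))
      + \<sigma>\<^sup>2/2 * (V2 (?x n i) * ((dZ n i)\<^sup>2 - (b - a) / 2 ^ n))
      + \<sigma>\<^sup>2/2 * (V2 (?x n i) * ((b - a) / 2 ^ n))"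
        unfolding power_mult_distrib[of \<sigma>] by (simp add: right_diff_distrib)
    qed
    finally show ?thesis unfolding sum.distrib sum_distrib_left by linarith
  qed
  have split: "integral {a..b} (\<lambda>s. - \<alpha> * X s * V1 (X s) + \<sigma>\<^sup>2 / 2 * V2 (X s))
      = integral {a..b} (\<lambda>s. V1 (X s) * (- \<alpha> * X s)) + \<sigma>\<^sup>2/2 * integral {a..b} (\<lambda>s. V2 (X s))"
    using V1X V2X X
    by (subst Henstock_Kurzweil_Integration.integral_add)
      (auto intro!: integrable_continuous_real continuous_intros simp: mult_ac)
  show ?thesis
    unfolding eq split diff_diff_eq[symmetric]
    using tendsto_diff[OF tendsto_diff[OF tendsto_diff[OF tendsto_diff[OF tendsto_diff[OF tendsto_const S1] R]
        tendsto_mult_left[OF E2]] tendsto_mult_left[OF q2]] tendsto_mult_left[OF S2],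
        of "V (X b) - V (X a)" "1/2" "\<sigma>\<^sup>2/2" "\<sigma>\<^sup>2/2"]
    by (simp only: mult_zero_right diff_zero)
qed

end

section \<open>Increments of the Wiener process\<close>

lemma integrable_mult_if_square_integrable:
  fixes X Y :: "'a \<Rightarrow> real"
  assumes [measurable]: "X \<in> borel_measurable M" "Y \<in> borel_measurable M"
    and "integrable M (\<lambda>\<omega>. (X \<omega>)\<^sup>2)" "integrable M (\<lambda>\<omega>. (Y \<omega>)\<^sup>2)"
  shows "integrable M (\<lambda>\<omega>. X \<omega> * Y \<omega>)"
proof (rule Bochner_Integration.integrable_bound[of _ "\<lambda>\<omega>. (X \<omega>)\<^sup>2 + (Y \<omega>)\<^sup>2"])
  have "\<bar>p * q\<bar> \<le> p\<^sup>2 + q\<^sup>2" for p q :: real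
  proof -
    have "\<bar>p * q\<bar> \<le> 2 * \<bar>p\<bar> * \<bar>q\<bar>" by (simp add: abs_mult)
    also have "\<dots> \<le> p\<^sup>2 + q\<^sup>2" using sum_squares_bound[of "\<bar>p\<bar>" "\<bar>q\<bar>"] by simp
    finally show ?thesis .
  qed
  then show "AE \<omega> in M. norm (X \<omega> * Y \<omega>) \<le> norm ((X \<omega>)\<^sup>2 + (Y \<omega>)\<^sup>2)"
    by (simp add: abs_of_nonneg)
qed (use assms in auto)

lemma integrable_square_add:
  fixes X Y :: "'a \<Rightarrow> real"
  assumes "X \<in> borel_measurable M" "Y \<in> borel_measurable M"
    and "integrable M (\<lambda>\<omega>. (X \<omega>)\<^sup>2)" "integrable M (\<lambda>\<omega>. (Y \<omega>)\<^sup>2)"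
  shows "integrable M (\<lambda>\<omega>. (X \<omega> + Y \<omega>)\<^sup>2)"
  unfolding power2_sum
  using assms integrable_mult_if_square_integrable[OF assms] by (simp add: mult.assoc)

lemma integrable_square_sum:
  fixes X :: "'i \<Rightarrow> 'a \<Rightarrow> real"
  assumes "\<And>i. i \<in> I \<Longrightarrow> X i \<in> borel_measurable M" "\<And>i. i \<in> I \<Longrightarrow> integrable M (\<lambda>\<omega>. (X i \<omega>)\<^sup>2)"
  shows "integrable M (\<lambda>\<omega>. (\<Sum>i\<in>I. X i \<omega>)\<^sup>2)"
  using assms
proof (induction I rule: infinite_finite_induct)
  case (insert i I)
  then show ?case
    by (simp add: integrable_square_add)
qed auto

lemma square_add_le: "(p + q)\<^sup>2 \<le> 2 * p\<^sup>2 + 2 * (q::real)\<^sup>2"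
  using sum_squares_bound[of p q] by (simp add: power2_sum)

lemma (in prob_space) char_normal:
  assumes v: "v > 0" and distr: "distributed M lborel X (normal_density 0 (sqrt v))"
  shows "expectation (\<lambda>\<omega>. exp (\<i> * complex_of_real (\<theta> * X \<omega>))) = complex_of_real (exp (- (\<theta>\<^sup>2 * v) / 2))"
proof -
  have [measurable]: "X \<in> borel_measurable M" using distributed_measurable[OF distr] by simp
  have "distributed M lborel (\<lambda>\<omega>. (X \<omega> - 0) / sqrt v) std_normal_density"
    using normal_standard_normal_convert[of "sqrt v" X 0] distr v by simp
  then have "distributed M lborel (\<lambda>\<omega>. X \<omega> / sqrt v) std_normal_density" by simp
  then have "distr M borel (\<lambda>\<omega>. X \<omega> / sqrt v) = std_normal_distribution"
    by (metis distributed_distr_eq_density distr_cong sets_lborel)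
  then have "char (distr M borel (\<lambda>\<omega>. X \<omega> / sqrt v)) (\<theta> * sqrt v) = complex_of_real (exp (- ((\<theta> * sqrt v)\<^sup>2) / 2))"
    by (simp add: char_std_normal_distribution)
  then show ?thesis
    unfolding char_def using v by (subst (asm) integral_distr) (auto simp: power_mult_distrib)
qed

text \<open>Both the increments of \<open>z\<close> and the innovations of \<open>x\<close> are of this kind.\<close>

locale normal_indep = prob_space +
  fixes G :: "'a measure" and X :: "'a \<Rightarrow> real" and v :: real
  assumes v: "v > 0" and subalg: "subalgebra M G"
    and distr: "distributed M lborel X (normal_density 0 (sqrt v))"
    and indep: "indep_set (sets G) (sets (vimage_algebra (space M) X borel))"
begin

lemma measurable_X [measurable]: "X \<in> borel_measurable M"
  using distributed_measurable[OF distr] by simp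

lemma measurable_G: "\<xi> \<in> measurable G N \<Longrightarrow> \<xi> \<in> measurable M N"
  using subalg measurable_from_subalg by blast

text \<open>The value spaces stay general because the lemma is used for real powers and for complex
  exponentials.\<close>

lemma indep_var_X:
  fixes \<xi> :: "'a \<Rightarrow> 'b" and g :: "real \<Rightarrow> 'b"
  assumes \<xi>: "\<xi> \<in> measurable G N" and g: "g \<in> measurable borel N'"
  shows "indep_var N \<xi> N' (\<lambda>\<omega>. g (X \<omega>))"
proof -
  have gX: "(\<lambda>\<omega>. g (X \<omega>)) \<in> measurable (vimage_algebra (space M) X borel) N'"
    using g by (intro measurable_compose[OF measurable_vimage_algebra1 g]) auto
  have sig: "sigma_sets (space M) {Y -` A \<inter> space M |A. A \<in> sets K} \<subseteq> sets H"
    if "Y \<in> measurable H K" "space H = space M" for Y H K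
    unfolding that(2)[symmetric] using measurable_sets[OF that(1)] by (intro sets.sigma_sets_subset) auto
  show ?thesis
    unfolding indep_var_eq
  proof (intro conjI)
    show "indep_set (sigma_sets (space M) {\<xi> -` A \<inter> space M |A. A \<in> sets N})
        (sigma_sets (space M) {(\<lambda>\<omega>. g (X \<omega>)) -` A \<inter> space M |A. A \<in> sets N'})"
      using indep sig[OF \<xi>] sig[OF gX] subalg unfolding indep_sets2_eq subalgebra_def by simp blast
  qed (use measurable_G[OF \<xi>] measurable_compose[OF measurable_X g] in auto)
qed

lemma integrable_X_power: "integrable M (\<lambda>\<omega>. X \<omega> ^ k)"
  using distributed_integrable[OF distr, of "\<lambda>x. x ^ k"] integrable_normal_moment[of "sqrt v" 0 k] v by simp

lemma expectation_X_even: "expectation (\<lambda>\<omega>. X \<omega> ^ (2 * k)) = fact (2 * k) / ((2 / v) ^ k * fact k)"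
  using distributed_integral[OF distr, of "\<lambda>x. x ^ (2 * k)"] integral_normal_moment_even[of "sqrt v" 0 k] v by simp

lemma expectation_X_odd: "expectation (\<lambda>\<omega>. X \<omega> ^ (2 * k + 1)) = 0"
  using distributed_integral[OF distr, of "\<lambda>x. x ^ (2 * k + 1)"] integral_normal_moment_odd[of "sqrt v" 0 k] v by simp

lemma expectation_X: "expectation X = 0" and expectation_X_cube: "expectation (\<lambda>\<omega>. X \<omega> ^ 3) = 0"
  using expectation_X_odd[of 0] expectation_X_odd[of 1] by simp_all

lemma expectation_X_square: "expectation (\<lambda>\<omega>. (X \<omega>)\<^sup>2) = v"
  and expectation_X_fourth: "expectation (\<lambda>\<omega>. X \<omega> ^ 4) = 3 * v\<^sup>2"
  using expectation_X_even[of 1] expectation_X_even[of 2] v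
  by (simp_all add: power_divide fact_numeral)

lemma
  assumes \<xi>: "\<xi> \<in> borel_measurable G" "integrable M \<xi>"
  shows integrable_mult_power: "integrable M (\<lambda>\<omega>. \<xi> \<omega> * X \<omega> ^ k)"
    and expectation_mult_power: "expectation (\<lambda>\<omega>. \<xi> \<omega> * X \<omega> ^ k) = expectation \<xi> * expectation (\<lambda>\<omega>. X \<omega> ^ k)"
proof -
  have *: "indep_var borel \<xi> borel (\<lambda>\<omega>. X \<omega> ^ k)"
    using indep_var_X[OF \<xi>(1), of "\<lambda>x. x ^ k"] by simp
  show "integrable M (\<lambda>\<omega>. \<xi> \<omega> * X \<omega> ^ k)"
    by (rule indep_var_integrable[OF * \<xi>(2) integrable_X_power])
  show "expectation (\<lambda>\<omega>. \<xi> \<omega> * X \<omega> ^ k) = expectation \<xi> * expectation (\<lambda>\<omega>. X \<omega> ^ k)"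
    by (rule indep_var_lebesgue_integral[OF * \<xi>(2) integrable_X_power])
qed

lemma char_X: "expectation (\<lambda>\<omega>. exp (\<i> * complex_of_real (\<theta> * X \<omega>))) = complex_of_real (exp (- (\<theta>\<^sup>2 * v) / 2))"
  using char_normal[OF v distr] .

end

section \<open>Wiener increments weighted by the past\<close>

locale wiener = prob_space +
  fixes F :: "real \<Rightarrow> 'a measure" and z :: "real \<Rightarrow> 'a \<Rightarrow> real"
  assumes F: "filtered_prob_space M F" and W: "wiener_process M F z"
begin

abbreviation "dz s t \<omega> \<equiv> z t \<omega> - z s \<omega>"

lemma subalgebra_F: "subalgebra M (F t)"
  using F by (simp add: filtered_prob_space_def)

lemma subalgebra_F_F: "s \<le> t \<Longrightarrow> subalgebra (F t) (F s)"
  using F by (auto simp: filtered_prob_space_def filtration_def subalgebra_def)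

lemma measurable_F: "\<xi> \<in> measurable (F t) N \<Longrightarrow> \<xi> \<in> measurable M N"
  using subalgebra_F measurable_from_subalg by blast

lemma measurable_F_mono: "\<xi> \<in> measurable (F s) N \<Longrightarrow> s \<le> t \<Longrightarrow> \<xi> \<in> measurable (F t) N"
  using subalgebra_F_F measurable_from_subalg by blast

lemma measurable_z: "0 \<le> s \<Longrightarrow> s \<le> t \<Longrightarrow> z s \<in> borel_measurable (F t)"
  using W measurable_F_mono[of "z s" s borel t] by (auto simp: wiener_process_def adapted_process_def)

lemma measurable_dz: "0 \<le> s \<Longrightarrow> s \<le> t \<Longrightarrow> t \<le> r \<Longrightarrow> dz s t \<in> borel_measurable (F r)"
  by (intro borel_measurable_diff measurable_z) auto

lemma measurable_z_M [measurable]: "0 \<le> s \<Longrightarrow> z s \<in> borel_measurable M"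
  using measurable_z[of s s] measurable_F by auto

lemma normal_indep_dz: "0 \<le> s \<Longrightarrow> s < t \<Longrightarrow> normal_indep M (F s) (dz s t) (t - s)"
  using W subalgebra_F unfolding normal_indep_def normal_indep_axioms_def wiener_process_def
  by (auto simp: prob_space_axioms)

text \<open>Equal times are included because an elementary integrand may have empty intervals,
  whereas the Gaussian law of an increment is given only for s < t.\<close>

lemma
  assumes st: "0 \<le> s" "s \<le> t" and \<xi>: "\<xi> \<in> borel_measurable (F s)" "integrable M \<xi>"
  shows integrable_mult_dz: "integrable M (\<lambda>\<omega>. \<xi> \<omega> * dz s t \<omega>)" (is ?A)
    and expectation_mult_dz: "expectation (\<lambda>\<omega>. \<xi> \<omega> * dz s t \<omega>) = 0" (is ?B)
    and integrable_mult_dz_square: "integrable M (\<lambda>\<omega>. \<xi> \<omega> * (dz s t \<omega>)\<^sup>2)" (is ?C)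
    and expectation_mult_dz_square: "expectation (\<lambda>\<omega>. \<xi> \<omega> * (dz s t \<omega>)\<^sup>2) = expectation \<xi> * (t - s)" (is ?D)
    and integrable_mult_dz_fourth: "integrable M (\<lambda>\<omega>. \<xi> \<omega> * dz s t \<omega> ^ 4)" (is ?E)
    and expectation_mult_dz_fourth: "expectation (\<lambda>\<omega>. \<xi> \<omega> * dz s t \<omega> ^ 4) = expectation \<xi> * (3 * (t - s)\<^sup>2)" (is ?G)
proof -
  consider "s = t" | "s < t" using st by linarith
  then have "?A \<and> ?B \<and> ?C \<and> ?D \<and> ?E \<and> ?G"
  proof cases
    case 2
    interpret normal_indep M "F s" "dz s t" "t - s" using normal_indep_dz st(1) 2 .
    show ?thesis
      using integrable_mult_power[OF \<xi>, of 1] expectation_mult_power[OF \<xi>, of 1]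
        integrable_mult_power[OF \<xi>, of 2] expectation_mult_power[OF \<xi>, of 2]
        integrable_mult_power[OF \<xi>, of 4] expectation_mult_power[OF \<xi>, of 4]
        expectation_X expectation_X_square expectation_X_fourth by simp
  qed simp
  then show ?A ?B ?C ?D ?E ?G
    by auto
qed

lemma square_integrable_mult_dz:
  assumes "0 \<le> s" "s \<le> t" "\<xi> \<in> borel_measurable (F s)" "integrable M (\<lambda>\<omega>. (\<xi> \<omega>)\<^sup>2)"
  shows "integrable M (\<lambda>\<omega>. (\<xi> \<omega> * dz s t \<omega>)\<^sup>2)"
  using integrable_mult_dz_square[of s t "\<lambda>\<omega>. (\<xi> \<omega>)\<^sup>2"] assms by (simp add: power_mult_distrib)

lemma expectation_mult_mult_dz:
  assumes ord: "0 \<le> s" "s \<le> t" and "\<xi> \<in> borel_measurable (F s)" "integrable M (\<lambda>\<omega>. (\<xi> \<omega>)\<^sup>2)"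
    and "\<eta> \<in> borel_measurable (F s)" "integrable M (\<lambda>\<omega>. (\<eta> \<omega>)\<^sup>2)"
  shows "integrable M (\<lambda>\<omega>. \<xi> \<omega> * (\<eta> \<omega> * dz s t \<omega>))" "expectation (\<lambda>\<omega>. \<xi> \<omega> * (\<eta> \<omega> * dz s t \<omega>)) = 0"
proof -
  have 1: "integrable M (\<lambda>\<omega>. \<xi> \<omega> * \<eta> \<omega>)"
    using assms by (intro integrable_mult_if_square_integrable) (auto intro: measurable_F)
  have 2: "(\<lambda>\<omega>. \<xi> \<omega> * \<eta> \<omega>) \<in> borel_measurable (F s)" using assms by auto
  show "integrable M (\<lambda>\<omega>. \<xi> \<omega> * (\<eta> \<omega> * dz s t \<omega>))" "expectation (\<lambda>\<omega>. \<xi> \<omega> * (\<eta> \<omega> * dz s t \<omega>)) = 0"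
    using integrable_mult_dz[OF ord 2 1] expectation_mult_dz[OF ord 2 1] by (simp_all add: mult.assoc)
qed

text \<open>Only the common part of the two intervals contributes, because a later increment is
  orthogonal to everything known before it. Arbitrary positions of the intervals are allowed so that
  integrands on different meshes can be compared without a common refinement.\<close>

lemma expectation_increments:
  assumes ord: "0 \<le> a" "a \<le> b" "0 \<le> c" "c \<le> d"
    and \<xi>: "\<xi> \<in> borel_measurable (F a)" "integrable M (\<lambda>\<omega>. (\<xi> \<omega>)\<^sup>2)"
    and \<eta>: "\<eta> \<in> borel_measurable (F c)" "integrable M (\<lambda>\<omega>. (\<eta> \<omega>)\<^sup>2)"
  shows "expectation (\<lambda>\<omega>. (\<xi> \<omega> * dz a b \<omega>) * (\<eta> \<omega> * dz c d \<omega>))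
    = expectation (\<lambda>\<omega>. \<xi> \<omega> * \<eta> \<omega>) * measure lborel ({a..<b} \<inter> {c..<d})"
proof -
  \<comment> \<open>By symmetry it suffices to treat a \<le> c.\<close>
  have main: "expectation (\<lambda>\<omega>. (\<xi> \<omega> * dz a b \<omega>) * (\<eta> \<omega> * dz c d \<omega>))
    = expectation (\<lambda>\<omega>. \<xi> \<omega> * \<eta> \<omega>) * measure lborel ({a..<b} \<inter> {c..<d})"
    if ord: "0 \<le> a" "a \<le> b" "a \<le> c" "c \<le> d"
      and \<xi>: "\<xi> \<in> borel_measurable (F a)" "integrable M (\<lambda>\<omega>. (\<xi> \<omega>)\<^sup>2)"
      and \<eta>: "\<eta> \<in> borel_measurable (F c)" "integrable M (\<lambda>\<omega>. (\<eta> \<omega>)\<^sup>2)" for a b c d \<xi> \<eta>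
  proof -
    have meas: "(\<lambda>\<omega>. \<xi> \<omega> * dz p q \<omega>) \<in> borel_measurable (F r)" if "a \<le> p" "p \<le> q" "q \<le> r" for p q r
      using that ord measurable_F_mono[OF \<xi>(1), of r] measurable_dz[of p q r] by auto
    have sqi: "integrable M (\<lambda>\<omega>. (\<xi> \<omega> * dz p q \<omega>)\<^sup>2)" if "a \<le> p" "p \<le> q" for p q
      using that ord \<xi> measurable_F_mono[OF \<xi>(1), of p] by (intro square_integrable_mult_dz) auto
    show ?thesis
    proof (cases "b \<le> c")
      case True
      then have "{a..<b} \<inter> {c..<d} = {}" by auto
      then show ?thesis
        using expectation_mult_mult_dz(2)[of c d, OF _ _ meas[of a b c] sqi[of a b] \<eta>] ord True by simp
    next
      case False
      \<comment> \<open>The end of the overlap, which starts at \<open>c\<close>.\<close>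
      define e where "e = min b d"
      have e: "c \<le> e" "e \<le> b" "e \<le> d" using ord False by (auto simp: e_def)
      have len: "measure lborel ({a..<b} \<inter> {c..<d}) = e - c"
      proof -
        have "{a..<b} \<inter> {c..<d} = {c..<e}" using ord False by (auto simp: e_def)
        then show ?thesis using e by simp
      qed
      have \<xi>c: "\<xi> \<in> borel_measurable (F c)" using measurable_F_mono[OF \<xi>(1)] ord by auto
      have \<xi>e: "\<xi> \<in> borel_measurable (F e)" and \<eta>e: "\<eta> \<in> borel_measurable (F e)"
        using measurable_F_mono[OF \<xi>c e(1)] measurable_F_mono[OF \<eta>(1) e(1)] by auto
      have \<xi>\<eta>: "integrable M (\<lambda>\<omega>. \<xi> \<omega> * \<eta> \<omega>)"
        using \<xi> \<eta> by (intro integrable_mult_if_square_integrable) (auto intro: measurable_F)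
      have \<eta>sq: "integrable M (\<lambda>\<omega>. (\<eta> \<omega> * dz c e \<omega>)\<^sup>2)" "(\<lambda>\<omega>. \<eta> \<omega> * dz c e \<omega>) \<in> borel_measurable (F e)"
        using ord e \<eta> \<eta>e measurable_dz[of c e e] by (auto intro!: square_integrable_mult_dz)
      note A = expectation_mult_mult_dz[of c d, OF _ _ meas[of a c c] sqi[of a c] \<eta>]
      note B = integrable_mult_dz_square[of c e, OF _ _ _ \<xi>\<eta>] expectation_mult_dz_square[of c e, OF _ _ _ \<xi>\<eta>]
      note C = expectation_mult_mult_dz[of e d, OF _ _ meas[of c e e] sqi[of c e] \<eta>e \<eta>(2)]
      note D = expectation_mult_mult_dz[of e b, OF _ _ \<eta>sq(2,1) \<xi>e \<xi>(2)]
      have ed: "e = b \<or> e = d" by (auto simp: e_def)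
      \<comment> \<open>The part before \<open>c\<close> and the parts after \<open>e\<close> give
        mean 0. Since \<open>e\<close> is \<open>b\<close> or \<open>d\<close>, one of the
        increments after \<open>e\<close> vanishes, so their mutual product is absent.\<close>
      have split: "(\<xi> \<omega> * dz a b \<omega>) * (\<eta> \<omega> * dz c d \<omega>) = \<xi> \<omega> * dz a c \<omega> * (\<eta> \<omega> * dz c d \<omega>)
          + \<xi> \<omega> * \<eta> \<omega> * (dz c e \<omega>)\<^sup>2 + \<xi> \<omega> * dz c e \<omega> * (\<eta> \<omega> * dz e d \<omega>)
          + \<eta> \<omega> * dz c e \<omega> * (\<xi> \<omega> * dz e b \<omega>)" for \<omega>
        using ed by (auto simp: algebra_simps power2_eq_square)
      show ?thesis
        unfolding split len
        using A B C D ord e \<xi>c \<eta>(1) by simp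
    qed
  qed
  show ?thesis
  proof (cases "a \<le> c")
    case True
    then show ?thesis using main[of a b c d \<xi> \<eta>] assms by blast
  next
    case False
    then show ?thesis using main[of c d a b \<eta> \<xi>] assms by (simp add: mult.commute Int_commute)
  qed
qed

end

section \<open>Simple integrals and the Ito isometry\<close>

lemma nn_integral_square_add_le:
  fixes f g :: "'b \<Rightarrow> real"
  assumes [measurable]: "f \<in> borel_measurable N" "g \<in> borel_measurable N"
  shows "(\<integral>\<^sup>+x. ennreal ((f x + g x)\<^sup>2) \<partial>N)
    \<le> 2 * (\<integral>\<^sup>+x. ennreal ((f x)\<^sup>2) \<partial>N) + 2 * (\<integral>\<^sup>+x. ennreal ((g x)\<^sup>2) \<partial>N)"
proof -
  have "ennreal ((f x + g x)\<^sup>2) \<le> 2 * ennreal ((f x)\<^sup>2) + 2 * ennreal ((g x)\<^sup>2)" for x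
    using ennreal_leI[OF square_add_le[of "f x" "g x"]]
    by (simp add: ennreal_plus ennreal_mult)
  then have "(\<integral>\<^sup>+x. ennreal ((f x + g x)\<^sup>2) \<partial>N) \<le> (\<integral>\<^sup>+x. 2 * ennreal ((f x)\<^sup>2) + 2 * ennreal ((g x)\<^sup>2) \<partial>N)"
    by (intro nn_integral_mono)
  also have "\<dots> = 2 * (\<integral>\<^sup>+x. ennreal ((f x)\<^sup>2) \<partial>N) + 2 * (\<integral>\<^sup>+x. ennreal ((g x)\<^sup>2) \<partial>N)"
    by (simp add: nn_integral_add nn_integral_cmult)
  finally show ?thesis .
qed

lemma integral_double_sum:
  fixes f :: "'i \<Rightarrow> 'j \<Rightarrow> 'b \<Rightarrow> real"
  assumes "\<And>l m. l \<in> L \<Longrightarrow> m \<in> L' \<Longrightarrow> integrable N (f l m)"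
  shows "(\<integral>x. (\<Sum>l\<in>L. \<Sum>m\<in>L'. f l m x) \<partial>N) = (\<Sum>l\<in>L. \<Sum>m\<in>L'. \<integral>x. f l m x \<partial>N)"
proof -
  have "(\<integral>x. (\<Sum>l\<in>L. \<Sum>m\<in>L'. f l m x) \<partial>N) = (\<Sum>l\<in>L. \<integral>x. (\<Sum>m\<in>L'. f l m x) \<partial>N)"
    using assms by (intro Bochner_Integration.integral_sum Bochner_Integration.integrable_sum)
  also have "\<dots> = (\<Sum>l\<in>L. \<Sum>m\<in>L'. \<integral>x. f l m x \<partial>N)"
    using assms by (intro sum.cong refl Bochner_Integration.integral_sum)
  finally show ?thesis .
qed

text \<open>The expected sum of the squares is finite, so the squares are almost surely summable and
  tend to 0. This is what the geometric rate of dyadic meshes is for.\<close>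

lemma AE_tendsto_0_if_square_summable:
  fixes X :: "nat \<Rightarrow> 'a \<Rightarrow> real"
  assumes [measurable]: "\<And>n. X n \<in> borel_measurable M"
    and C: "C \<ge> 0" "\<And>n. (\<integral>\<^sup>+\<omega>. ennreal ((X n \<omega>)\<^sup>2) \<partial>M) \<le> ennreal (C / 2 ^ n)"
  shows "AE \<omega> in M. (\<lambda>n. X n \<omega>) \<longlonglongrightarrow> 0"
proof -
  have sm: "summable (\<lambda>n. C / 2 ^ n)"
    using summable_mult[OF summable_geometric[of "1/2::real"], of C] by (simp add: power_divide)
  have "(\<integral>\<^sup>+\<omega>. (\<Sum>n. ennreal ((X n \<omega>)\<^sup>2)) \<partial>M) = (\<Sum>n. \<integral>\<^sup>+\<omega>. ennreal ((X n \<omega>)\<^sup>2) \<partial>M)"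
    by (intro nn_integral_suminf) simp
  also have "\<dots> \<le> (\<Sum>n. ennreal (C / 2 ^ n))"
    using C by (intro suminf_le) auto
  also have "\<dots> < \<infinity>"
    by (subst suminf_ennreal2[OF _ sm]) (use C(1) in auto)
  finally have "AE \<omega> in M. (\<Sum>n. ennreal ((X n \<omega>)\<^sup>2)) \<noteq> \<infinity>"
    by (intro nn_integral_PInf_AE) auto
  then show ?thesis
  proof eventually_elim
    case (elim \<omega>)
    then have "summable (\<lambda>n. (X n \<omega>)\<^sup>2)"
      by (intro summable_suminf_not_top) auto
    then have "(\<lambda>n. (X n \<omega>)\<^sup>2) \<longlonglongrightarrow> 0" by (rule summable_LIMSEQ_zero)
    then have "(\<lambda>n. sqrt ((X n \<omega>)\<^sup>2)) \<longlonglongrightarrow> sqrt 0" by (rule tendsto_real_sqrt)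
    then show ?case by (simp add: tendsto_rabs_zero_iff)
  qed
qed

lemma emeasure_lborel_Ico_Int: "emeasure lborel ({a..<b} \<inter> {c..<d::real}) < \<infinity>"
  by (rule emeasure_bounded_finite) auto

context wiener
begin

text \<open>The index set is arbitrary and the intervals may overlap, so the difference of two such
  integrands is again one, over the disjoint union of the index sets.\<close>

definition simple_family :: "real \<Rightarrow> 'i set \<Rightarrow> ('i \<Rightarrow> real) \<Rightarrow> ('i \<Rightarrow> real) \<Rightarrow> ('i \<Rightarrow> 'a \<Rightarrow> real) \<Rightarrow> bool" where
  "simple_family T L A B c \<longleftrightarrow> finite L \<and>
     (\<forall>l\<in>L. 0 \<le> A l \<and> A l \<le> B l \<and> B l \<le> T \<and> c l \<in> borel_measurable (F (A l)) \<and> integrable M (\<lambda>\<omega>. (c l \<omega>)\<^sup>2))"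

definition simple_integral :: "'i set \<Rightarrow> ('i \<Rightarrow> real) \<Rightarrow> ('i \<Rightarrow> real) \<Rightarrow> ('i \<Rightarrow> 'a \<Rightarrow> real) \<Rightarrow> 'a \<Rightarrow> real" where
  "simple_integral L A B c \<omega> = (\<Sum>l\<in>L. c l \<omega> * dz (A l) (B l) \<omega>)"

definition simple_process :: "'i set \<Rightarrow> ('i \<Rightarrow> real) \<Rightarrow> ('i \<Rightarrow> real) \<Rightarrow> ('i \<Rightarrow> 'a \<Rightarrow> real) \<Rightarrow> real \<Rightarrow> 'a \<Rightarrow> real" where
  "simple_process L A B c s \<omega> = (\<Sum>l\<in>L. c l \<omega> * indicator {A l..<B l} s)"

abbreviation "time_space T \<equiv> restrict_space lborel {0..T} \<Otimes>\<^sub>M M"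

lemma simple_integral_measurable: "simple_family T L A B c \<Longrightarrow> simple_integral L A B c \<in> borel_measurable M"
  unfolding simple_integral_def[abs_def] simple_family_def
  by (intro borel_measurable_sum borel_measurable_times borel_measurable_diff) (auto intro: measurable_F)

lemma simple_process_measurable:
  assumes "simple_family T L A B c"
  shows "(\<lambda>(s, \<omega>). simple_process L A B c s \<omega>) \<in> borel_measurable (time_space T)"
proof -
  have "(\<lambda>p. c l (snd p) * indicator {A l..<B l} (fst p) :: real) \<in> borel_measurable (time_space T)" if "l \<in> L" for l
  proof (intro borel_measurable_times)
    show "(\<lambda>p. c l (snd p)) \<in> borel_measurable (time_space T)"
      using assms that by (intro measurable_compose[OF measurable_snd]) (auto simp: simple_family_def intro: measurable_F)
    show "(\<lambda>p. indicator {A l..<B l} (fst p) :: real) \<in> borel_measurable (time_space T)"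
      by (intro measurable_compose[OF measurable_fst] measurable_restrict_space1) auto
  qed
  then show ?thesis
    unfolding simple_process_def case_prod_beta' by (intro borel_measurable_sum)
qed

text \<open>Both squares are expanded into double sums. On the left the expected products of
  increments, on the right the integrals of products of indicators, produce the same overlap
  lengths.\<close>

lemma simple_isometry:
  assumes s: "simple_family T L A B c"
  shows "integrable M (\<lambda>\<omega>. (simple_integral L A B c \<omega>)\<^sup>2)"
    and "(\<integral>\<^sup>+\<omega>. ennreal ((simple_integral L A B c \<omega>)\<^sup>2) \<partial>M)
      = (\<integral>\<^sup>+s\<in>{0..T}. (\<integral>\<^sup>+\<omega>. ennreal ((simple_process L A B c s \<omega>)\<^sup>2) \<partial>M) \<partial>lborel)"
proof -
  let ?J = "\<lambda>l m. {A l..<B l} \<inter> {A m..<B m}"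
  define e where "e = (\<lambda>l m. expectation (\<lambda>\<omega>. c l \<omega> * c m \<omega>))"
  have l: "0 \<le> A l" "A l \<le> B l" "B l \<le> T" "c l \<in> borel_measurable (F (A l))" "integrable M (\<lambda>\<omega>. (c l \<omega>)\<^sup>2)" if "l \<in> L" for l
    using s that by (auto simp: simple_family_def)
  have cM: "c l \<in> borel_measurable M" if "l \<in> L" for l using l(4)[OF that] measurable_F by auto
  have ccint: "integrable M (\<lambda>\<omega>. c l \<omega> * c m \<omega>)" if "l \<in> L" "m \<in> L" for l m
    using that l cM by (intro integrable_mult_if_square_integrable) auto
  have dint: "integrable M (\<lambda>\<omega>. (c l \<omega> * dz (A l) (B l) \<omega>)\<^sup>2)"
    and dmeas: "(\<lambda>\<omega>. c l \<omega> * dz (A l) (B l) \<omega>) \<in> borel_measurable M" if "l \<in> L" for l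
    using l[OF that] cM[OF that] by (auto intro!: square_integrable_mult_dz)
  show sint: "integrable M (\<lambda>\<omega>. (simple_integral L A B c \<omega>)\<^sup>2)"
    unfolding simple_integral_def using dint dmeas by (intro integrable_square_sum)
  have E1: "expectation (\<lambda>\<omega>. (simple_integral L A B c \<omega>)\<^sup>2) = (\<Sum>l\<in>L. \<Sum>m\<in>L. e l m * measure lborel (?J l m))"
  proof -
    have "expectation (\<lambda>\<omega>. (simple_integral L A B c \<omega>)\<^sup>2)
        = expectation (\<lambda>\<omega>. \<Sum>l\<in>L. \<Sum>m\<in>L. (c l \<omega> * dz (A l) (B l) \<omega>) * (c m \<omega> * dz (A m) (B m) \<omega>))"
      by (simp add: simple_integral_def power2_eq_square sum_product)
    also have "\<dots> = (\<Sum>l\<in>L. \<Sum>m\<in>L. expectation (\<lambda>\<omega>. (c l \<omega> * dz (A l) (B l) \<omega>) * (c m \<omega> * dz (A m) (B m) \<omega>)))"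
      using dint dmeas by (intro integral_double_sum integrable_mult_if_square_integrable)
    also have "\<dots> = (\<Sum>l\<in>L. \<Sum>m\<in>L. e l m * measure lborel (?J l m))"
      unfolding e_def using l by (intro sum.cong refl expectation_increments) auto
    finally show ?thesis .
  qed
  \<comment> \<open>The second moment of the integrand at time \<open>s\<close> as a function of
    \<open>s\<close>; integrating it term by term gives the overlap lengths.\<close>
  define g where "g = (\<lambda>s. \<Sum>l\<in>L. \<Sum>m\<in>L. e l m * indicator (?J l m) s)"
  have pint: "integrable M (\<lambda>\<omega>. (simple_process L A B c s \<omega>)\<^sup>2)" for s
    unfolding simple_process_def using l(5) cM
    by (intro integrable_square_sum) (auto simp: power_mult_distrib)
  have E2: "expectation (\<lambda>\<omega>. (simple_process L A B c s \<omega>)\<^sup>2) = g s" for s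
  proof -
    have "expectation (\<lambda>\<omega>. (simple_process L A B c s \<omega>)\<^sup>2)
        = expectation (\<lambda>\<omega>. \<Sum>l\<in>L. \<Sum>m\<in>L. (c l \<omega> * c m \<omega>) * indicator (?J l m) s)"
      unfolding simple_process_def power2_eq_square sum_product indicator_inter_arith
      by (intro arg_cong[where f = expectation] ext sum.cong refl) (simp add: mult_ac)
    also have "\<dots> = (\<Sum>l\<in>L. \<Sum>m\<in>L. expectation (\<lambda>\<omega>. (c l \<omega> * c m \<omega>) * indicator (?J l m) s))"
      by (intro integral_double_sum integrable_mult_left ccint)
    finally show ?thesis by (simp add: g_def e_def)
  qed
  have g0: "g s \<ge> 0" for s
    unfolding E2[symmetric] by simp
  have gint: "integrable lborel g"
    unfolding g_def
    by (intro Bochner_Integration.integrable_sum integrable_mult_right integrable_real_indicator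
        emeasure_lborel_Ico_Int) auto
  have gsum: "(LINT s|lborel. g s) = (\<Sum>l\<in>L. \<Sum>m\<in>L. e l m * measure lborel (?J l m))"
  proof -
    have i: "integrable lborel (\<lambda>s. e l m * indicator (?J l m) s)" for l m
      by (intro integrable_mult_right integrable_real_indicator emeasure_lborel_Ico_Int) auto
    show ?thesis
      unfolding g_def using i
      by (subst integral_double_sum) auto
  qed
  have "(\<integral>\<^sup>+s\<in>{0..T}. (\<integral>\<^sup>+\<omega>. ennreal ((simple_process L A B c s \<omega>)\<^sup>2) \<partial>M) \<partial>lborel)
      = (\<integral>\<^sup>+s. ennreal (g s) \<partial>lborel)"
  proof (intro nn_integral_cong)
    fix s :: real
    have "(\<integral>\<^sup>+\<omega>. ennreal ((simple_process L A B c s \<omega>)\<^sup>2) \<partial>M) = ennreal (g s)"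
      using nn_integral_eq_integral[OF pint, of s] E2 by simp
    moreover have "g s = 0" if "s \<notin> {0..T}"
      unfolding g_def
    proof (intro sum.neutral ballI)
      fix k m assume "k \<in> L" "m \<in> L"
      then have "s \<notin> ?J k m" using l(1,3)[of k] that by auto
      then show "e k m * indicator (?J k m) s = 0" by simp
    qed
    ultimately show "(\<integral>\<^sup>+\<omega>. ennreal ((simple_process L A B c s \<omega>)\<^sup>2) \<partial>M) * indicator {0..T} s = ennreal (g s)"
      by (auto simp: indicator_def)
  qed
  also have "\<dots> = ennreal (LINT s|lborel. g s)"
    using gint g0 by (intro nn_integral_eq_integral) auto
  also have "\<dots> = ennreal (expectation (\<lambda>\<omega>. (simple_integral L A B c \<omega>)\<^sup>2))"
    by (simp add: gsum E1)
  also have "\<dots> = (\<integral>\<^sup>+\<omega>. ennreal ((simple_integral L A B c \<omega>)\<^sup>2) \<partial>M)"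
    using sint by (intro nn_integral_eq_integral[symmetric]) auto
  finally show "(\<integral>\<^sup>+\<omega>. ennreal ((simple_integral L A B c \<omega>)\<^sup>2) \<partial>M)
      = (\<integral>\<^sup>+s\<in>{0..T}. (\<integral>\<^sup>+\<omega>. ennreal ((simple_process L A B c s \<omega>)\<^sup>2) \<partial>M) \<partial>lborel)" ..
qed

section \<open>From simple integrands to Ito integrals\<close>

lemma
  fixes T :: real
  assumes Q: "Q \<in> borel_measurable (time_space T)"
  shows nn_integral_time_fst: "(\<integral>\<^sup>+s\<in>{0..T}. (\<integral>\<^sup>+\<omega>. Q (s, \<omega>) \<partial>M) \<partial>lborel) = (\<integral>\<^sup>+p. Q p \<partial>time_space T)"
    and nn_integral_time_snd: "(\<integral>\<^sup>+\<omega>. (\<integral>\<^sup>+s\<in>{0..T}. Q (s, \<omega>) \<partial>lborel) \<partial>M) = (\<integral>\<^sup>+p. Q p \<partial>time_space T)"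
proof -
  interpret R: sigma_finite_measure "restrict_space lborel {0..T}"
    by (intro sigma_finite_measure_restrict_space sigma_finite_lborel) (simp only: sets_lborel atLeastAtMost_borel)
  interpret P: pair_sigma_finite "restrict_space lborel {0..T}" M ..
  show "(\<integral>\<^sup>+s\<in>{0..T}. (\<integral>\<^sup>+\<omega>. Q (s, \<omega>) \<partial>M) \<partial>lborel) = (\<integral>\<^sup>+p. Q p \<partial>time_space T)"
    using nn_integral_fst[OF Q] by (simp add: nn_integral_restrict_space)
  show "(\<integral>\<^sup>+\<omega>. (\<integral>\<^sup>+s\<in>{0..T}. Q (s, \<omega>) \<partial>lborel) \<partial>M) = (\<integral>\<^sup>+p. Q p \<partial>time_space T)"
    using P.nn_integral_snd[OF Q] by (simp add: nn_integral_restrict_space)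
qed

text \<open>The isometry for the disjoint union, with the coefficients of the second family
  negated.\<close>

lemma simple_isometry_diff:
  assumes s: "simple_family T L A B c" and s': "simple_family T L' A' B' c'"
  shows "(\<integral>\<^sup>+\<omega>. ennreal ((simple_integral L A B c \<omega> - simple_integral L' A' B' c' \<omega>)\<^sup>2) \<partial>M)
    = (\<integral>\<^sup>+s\<in>{0..T}. (\<integral>\<^sup>+\<omega>. ennreal ((simple_process L A B c s \<omega> - simple_process L' A' B' c' s \<omega>)\<^sup>2) \<partial>M) \<partial>lborel)"
proof -
  let ?L = "L <+> L'" and ?A = "case_sum A A'" and ?B = "case_sum B B'"
  let ?c = "case_sum c (\<lambda>l \<omega>. - c' l \<omega>)"
  have sum: "simple_family T ?L ?A ?B ?c"
    using s s' by (auto simp: simple_family_def)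
  have i1: "simple_integral ?L ?A ?B ?c \<omega> = simple_integral L A B c \<omega> - simple_integral L' A' B' c' \<omega>" for \<omega>
    using s s' unfolding simple_integral_def simple_family_def
    by (subst sum.Plus) (auto simp: sum_negf)
  have i2: "simple_process ?L ?A ?B ?c r \<omega> = simple_process L A B c r \<omega> - simple_process L' A' B' c' r \<omega>" for r \<omega>
    using s s' unfolding simple_process_def simple_family_def
    by (subst sum.Plus) (auto simp: sum_negf)
  show ?thesis
    using simple_isometry(2)[OF sum] unfolding i1 i2 .
qed

text \<open>The definition only provides some unknown approximating sequence. Passing through its
  k-th member costs a factor 2 for the integrals and again for the integrands, and all errors of
  that sequence vanish in the limit; hence the factor 4. Any convenient approximation of the
  integrand, such as a dyadic one, may thus be used.\<close>

lemma Ito_integral_approx: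
  assumes I: "has_ito_integral M F z T H I" and s: "simple_family T L A B c"
  shows "(\<integral>\<^sup>+\<omega>. ennreal ((I \<omega> - simple_integral L A B c \<omega>)\<^sup>2) \<partial>M)
    \<le> 4 * (\<integral>\<^sup>+s\<in>{0..T}. (\<integral>\<^sup>+\<omega>. ennreal ((H s \<omega> - simple_process L A B c s \<omega>)\<^sup>2) \<partial>M) \<partial>lborel)"
proof -
  let ?S = "simple_integral L A B c" and ?P = "\<lambda>p. simple_process L A B c (fst p) (snd p)"
  let ?H = "\<lambda>p. H (fst p) (snd p)"
  from I have Hm [measurable]: "?H \<in> borel_measurable (time_space T)" and Im [measurable]: "I \<in> borel_measurable M"
    by (auto simp: has_ito_integral_def case_prod_beta')
  have Sm [measurable]: "?S \<in> borel_measurable M" using simple_integral_measurable[OF s] .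
  have Pm [measurable]: "?P \<in> borel_measurable (time_space T)"
    using simple_process_measurable[OF s] by (simp add: case_prod_beta')
  from I obtain n \<tau> \<xi> where el: "\<And>k. elementary_integrand M F T (n k) (\<tau> k) (\<xi> k)"
    and lim1: "(\<lambda>k. \<integral>\<^sup>+\<omega>. (\<integral>\<^sup>+s\<in>{0..T}. ennreal ((H s \<omega> - elementary_process (n k) (\<tau> k) (\<xi> k) s \<omega>)\<^sup>2) \<partial>lborel) \<partial>M) \<longlonglongrightarrow> 0"
    and lim2: "(\<lambda>k. \<integral>\<^sup>+\<omega>. ennreal ((I \<omega> - elementary_integral z (n k) (\<tau> k) (\<xi> k) \<omega>)\<^sup>2) \<partial>M) \<longlonglongrightarrow> 0"
    unfolding has_ito_integral_def by blast
  let ?E = "\<lambda>k. elementary_integral z (n k) (\<tau> k) (\<xi> k)" and ?e = "\<lambda>k. elementary_process (n k) (\<tau> k) (\<xi> k)"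
  define d where "d = (\<integral>\<^sup>+p. ennreal ((?H p - ?P p)\<^sup>2) \<partial>time_space T)"
  have d: "(\<integral>\<^sup>+s\<in>{0..T}. (\<integral>\<^sup>+\<omega>. ennreal ((H s \<omega> - simple_process L A B c s \<omega>)\<^sup>2) \<partial>M) \<partial>lborel) = d"
    unfolding d_def by (subst nn_integral_time_fst[symmetric]) simp_all
  have bound: "(\<integral>\<^sup>+\<omega>. ennreal ((I \<omega> - ?S \<omega>)\<^sup>2) \<partial>M)
     \<le> 2 * (\<integral>\<^sup>+\<omega>. ennreal ((I \<omega> - ?E k \<omega>)\<^sup>2) \<partial>M)
     + 2 * (2 * (\<integral>\<^sup>+\<omega>. (\<integral>\<^sup>+s\<in>{0..T}. ennreal ((H s \<omega> - ?e k s \<omega>)\<^sup>2) \<partial>lborel) \<partial>M) + 2 * d)" for k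
  proof -
    have mono: "\<tau> k i \<le> \<tau> k j" if "i \<le> j" "j \<le> n k" for i j
      using that
    proof (induction rule: dec_induct)
      case (step m)
      then have "\<tau> k m \<le> \<tau> k (Suc m)"
        using el[of k] unfolding elementary_integrand_def by auto
      with step show ?case by simp
    qed simp
    have e: "\<tau> k 0 = 0" "\<tau> k (n k) = T"
      "\<And>i. i < n k \<Longrightarrow> \<xi> k i \<in> borel_measurable (F (\<tau> k i))" "\<And>i. i < n k \<Longrightarrow> integrable M (\<lambda>\<omega>. (\<xi> k i \<omega>)\<^sup>2)"
      using el[of k] by (auto simp: elementary_integrand_def)
    \<comment> \<open>An elementary integrand is the special case of consecutive intervals.\<close>
    have e1: "simple_family T {..<n k} (\<tau> k) (\<lambda>i. \<tau> k (Suc i)) (\<xi> k)"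
      using e mono[of 0] mono[of _ "n k"] mono unfolding simple_family_def by force
    have [measurable]: "?E k \<in> borel_measurable M"
      using simple_integral_measurable[OF e1] unfolding simple_integral_def[abs_def] elementary_integral_def[abs_def] .
    have [measurable]: "(\<lambda>p. ?e k (fst p) (snd p)) \<in> borel_measurable (time_space T)"
      using simple_process_measurable[OF e1] unfolding simple_process_def elementary_process_def case_prod_beta' .
    have "(\<integral>\<^sup>+\<omega>. ennreal ((?E k \<omega> - ?S \<omega>)\<^sup>2) \<partial>M)
        = (\<integral>\<^sup>+p. ennreal ((?e k (fst p) (snd p) - ?P p)\<^sup>2) \<partial>time_space T)"
      using simple_isometry_diff[OF e1 s]
      unfolding simple_integral_def[of "{..<n k}"] simple_process_def[of "{..<n k}"]
        elementary_integral_def[symmetric] elementary_process_def[symmetric]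
      by (subst nn_integral_time_fst[symmetric]) simp_all
    also have "\<dots> = (\<integral>\<^sup>+p. ennreal ((- (?H p - ?e k (fst p) (snd p)) + (?H p - ?P p))\<^sup>2) \<partial>time_space T)"
      by simp
    also have "\<dots> \<le> 2 * (\<integral>\<^sup>+p. ennreal ((- (?H p - ?e k (fst p) (snd p)))\<^sup>2) \<partial>time_space T) + 2 * d"
      unfolding d_def by (rule nn_integral_square_add_le) auto
    also have "(\<integral>\<^sup>+p. ennreal ((- (?H p - ?e k (fst p) (snd p)))\<^sup>2) \<partial>time_space T)
        = (\<integral>\<^sup>+\<omega>. (\<integral>\<^sup>+s\<in>{0..T}. ennreal ((H s \<omega> - ?e k s \<omega>)\<^sup>2) \<partial>lborel) \<partial>M)"
      unfolding power2_minus by (subst nn_integral_time_snd[symmetric]) simp_all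
    finally have 2: "(\<integral>\<^sup>+\<omega>. ennreal ((?E k \<omega> - ?S \<omega>)\<^sup>2) \<partial>M)
        \<le> 2 * (\<integral>\<^sup>+\<omega>. (\<integral>\<^sup>+s\<in>{0..T}. ennreal ((H s \<omega> - ?e k s \<omega>)\<^sup>2) \<partial>lborel) \<partial>M) + 2 * d" .
    have "(\<integral>\<^sup>+\<omega>. ennreal ((I \<omega> - ?S \<omega>)\<^sup>2) \<partial>M)
      = (\<integral>\<^sup>+\<omega>. ennreal (((I \<omega> - ?E k \<omega>) + (?E k \<omega> - ?S \<omega>))\<^sup>2) \<partial>M)"
      by simp
    also have "\<dots> \<le> 2 * (\<integral>\<^sup>+\<omega>. ennreal ((I \<omega> - ?E k \<omega>)\<^sup>2) \<partial>M)
       + 2 * (\<integral>\<^sup>+\<omega>. ennreal ((?E k \<omega> - ?S \<omega>)\<^sup>2) \<partial>M)"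
      by (rule nn_integral_square_add_le) auto
    also have "\<dots> \<le> 2 * (\<integral>\<^sup>+\<omega>. ennreal ((I \<omega> - ?E k \<omega>)\<^sup>2) \<partial>M)
     + 2 * (2 * (\<integral>\<^sup>+\<omega>. (\<integral>\<^sup>+s\<in>{0..T}. ennreal ((H s \<omega> - ?e k s \<omega>)\<^sup>2) \<partial>lborel) \<partial>M) + 2 * d)"
      using 2 by (intro add_left_mono mult_left_mono) auto
    finally show ?thesis .
  qed
  have "(\<integral>\<^sup>+\<omega>. ennreal ((I \<omega> - ?S \<omega>)\<^sup>2) \<partial>M) \<le> 2 * 0 + 2 * (2 * 0 + 2 * d)"
    by (rule LIMSEQ_le_const[OF tendsto_add[OF ennreal_tendsto_cmult[OF _ lim2]
          ennreal_tendsto_cmult[OF _ tendsto_add[OF ennreal_tendsto_cmult[OF _ lim1] tendsto_const]]]])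
      (use bound in auto)
  then show ?thesis
    unfolding d by (simp flip: mult.assoc)
qed

text \<open>The partial sums form a martingale, so their second moments add up. A squared Gaussian
  increment minus its mean \<open>h\<close> has second moment 3 h^2 - 2 h^2 + h^2 = 2 h^2.\<close>

lemma weighted_quadratic_variation:
  assumes t: "\<And>i. 0 \<le> t i" "\<And>i. t (Suc i) - t i = h" "h \<ge> 0"
    and c: "\<And>i. c i \<in> borel_measurable (F (t i))" "\<And>i \<omega>. \<bar>c i \<omega>\<bar> \<le> C"
  defines "S \<equiv> \<lambda>m \<omega>. \<Sum>i<m. c i \<omega> * ((dz (t i) (t (Suc i)) \<omega>)\<^sup>2 - h)"
  shows "S m \<in> borel_measurable (F (t m))" "integrable M (\<lambda>\<omega>. (S m \<omega>)\<^sup>2)"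
    "expectation (\<lambda>\<omega>. (S m \<omega>)\<^sup>2) \<le> real m * (2 * C\<^sup>2 * h\<^sup>2)"
proof -
  have "S m \<in> borel_measurable (F (t m)) \<and> integrable M (\<lambda>\<omega>. (S m \<omega>)\<^sup>2) \<and>
    expectation (\<lambda>\<omega>. (S m \<omega>)\<^sup>2) \<le> real m * (2 * C\<^sup>2 * h\<^sup>2)"
  proof (induction m)
    case 0
    then show ?case by (simp add: S_def)
  next
    case (Suc m)
    let ?d = "dz (t m) (t (Suc m))"
    let ?D = "\<lambda>\<omega>. c m \<omega> * ((?d \<omega>)\<^sup>2 - h)"
    have le: "t m \<le> t (Suc m)" using t(2)[of m] t(3) by simp
    have cm: "c m \<in> borel_measurable M" using measurable_F[OF c(1)] .
    have C: "C \<ge> 0" using c(2)[of 0 undefined] by linarith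
    have csq_le: "(c m \<omega>)\<^sup>2 \<le> C\<^sup>2" for \<omega> using c(2)[of m \<omega>] C by (simp add: abs_le_square_iff[symmetric])
    have csq: "integrable M (\<lambda>\<omega>. (c m \<omega>)\<^sup>2)"
      using cm csq_le by (intro integrable_const_bound[of _ "C\<^sup>2"]) auto
    note 4 = integrable_mult_dz_fourth[OF t(1) le _ csq] expectation_mult_dz_fourth[OF t(1) le _ csq]
    note 2 = integrable_mult_dz_square[OF t(1) le _ csq] expectation_mult_dz_square[OF t(1) le _ csq]
    have Dsq: "(?D \<omega>)\<^sup>2 = (c m \<omega>)\<^sup>2 * ?d \<omega> ^ 4 - 2 * h * ((c m \<omega>)\<^sup>2 * (?d \<omega>)\<^sup>2) + h\<^sup>2 * (c m \<omega>)\<^sup>2" for \<omega>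
      by (simp add: power_mult_distrib power2_diff right_diff_distrib distrib_left power2_eq_square power4_eq_xxxx mult_ac)
    have csqF: "(\<lambda>\<omega>. (c m \<omega>)\<^sup>2) \<in> borel_measurable (F (t m))" using c(1) by auto
    have Dint: "integrable M (\<lambda>\<omega>. (?D \<omega>)\<^sup>2)"
      unfolding Dsq using 4(1)[OF csqF] 2(1)[OF csqF] csq by (intro Bochner_Integration.integrable_add Bochner_Integration.integrable_diff integrable_mult_right)
    have "expectation (\<lambda>\<omega>. (?D \<omega>)\<^sup>2) = expectation (\<lambda>\<omega>. (c m \<omega>)\<^sup>2) * (2 * h\<^sup>2)"
    proof -
      have "expectation (\<lambda>\<omega>. (?D \<omega>)\<^sup>2) = expectation (\<lambda>\<omega>. (c m \<omega>)\<^sup>2 * ?d \<omega> ^ 4)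
          - 2 * h * expectation (\<lambda>\<omega>. (c m \<omega>)\<^sup>2 * (?d \<omega>)\<^sup>2) + h\<^sup>2 * expectation (\<lambda>\<omega>. (c m \<omega>)\<^sup>2)"
        unfolding Dsq
        by (subst Bochner_Integration.integral_add, (intro Bochner_Integration.integrable_diff integrable_mult_right 4(1) 2(1) csq csqF)+,
          subst Bochner_Integration.integral_diff, (intro integrable_mult_right 4(1) 2(1) csq csqF)+) simp
      then show ?thesis
        unfolding 4(2)[OF csqF] 2(2)[OF csqF] t(2) by (simp add: power2_eq_square)
    qed
    also have "\<dots> \<le> C\<^sup>2 * (2 * h\<^sup>2)"
      using csq csq_le by (intro mult_right_mono integral_le_const) auto
    finally have ED: "expectation (\<lambda>\<omega>. (?D \<omega>)\<^sup>2) \<le> 2 * C\<^sup>2 * h\<^sup>2" by simp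
    have Dm: "?D \<in> borel_measurable (F (t (Suc m)))"
      using measurable_F_mono[OF c(1) le] measurable_dz[OF t(1) le] by auto
    have Sm: "S m \<in> borel_measurable (F (t m))" "integrable M (\<lambda>\<omega>. (S m \<omega>)\<^sup>2)" using Suc by auto
    have Sc: "integrable M (\<lambda>\<omega>. S m \<omega> * c m \<omega>)" "(\<lambda>\<omega>. S m \<omega> * c m \<omega>) \<in> borel_measurable (F (t m))"
      using Sm csq cm c(1) by (auto intro!: integrable_mult_if_square_integrable dest: measurable_F)
    \<comment> \<open>The cross term vanishes because the squared increment has mean
      \<open>h\<close> given the past, which contains \<open>S m\<close> and
      \<open>c m\<close>.\<close>
    note SD = integrable_mult_dz_square[OF t(1) le Sc(2,1)] expectation_mult_dz_square[OF t(1) le Sc(2,1)]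
    have SD_eq: "S m \<omega> * ?D \<omega> = S m \<omega> * c m \<omega> * (?d \<omega>)\<^sup>2 - h * (S m \<omega> * c m \<omega>)" for \<omega>
      by (simp add: algebra_simps)
    have SDint: "integrable M (\<lambda>\<omega>. S m \<omega> * ?D \<omega>)" and ESD: "expectation (\<lambda>\<omega>. S m \<omega> * ?D \<omega>) = 0"
      unfolding SD_eq using SD Sc(1) t(2)[of m] by (auto simp: mult.commute)
    have SS: "S (Suc m) = (\<lambda>\<omega>. S m \<omega> + ?D \<omega>)" by (simp add: S_def)
    have sq: "(S m \<omega> + ?D \<omega>)\<^sup>2 = (S m \<omega>)\<^sup>2 + (?D \<omega>)\<^sup>2 + 2 * (S m \<omega> * ?D \<omega>)" for \<omega>
      by (simp add: power2_sum)
    show ?case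
      unfolding SS sq
    proof (intro conjI)
      show "(\<lambda>\<omega>. S m \<omega> + ?D \<omega>) \<in> borel_measurable (F (t (Suc m)))"
        using measurable_F_mono[OF Sm(1) le] Dm by (intro borel_measurable_add)
      show "integrable M (\<lambda>\<omega>. (S m \<omega>)\<^sup>2 + (?D \<omega>)\<^sup>2 + 2 * (S m \<omega> * ?D \<omega>))"
        using Sm(2) Dint SDint by (intro Bochner_Integration.integrable_add integrable_mult_right)
      have "expectation (\<lambda>\<omega>. (S m \<omega>)\<^sup>2 + (?D \<omega>)\<^sup>2 + 2 * (S m \<omega> * ?D \<omega>))
          = expectation (\<lambda>\<omega>. (S m \<omega>)\<^sup>2) + expectation (\<lambda>\<omega>. (?D \<omega>)\<^sup>2)"
        using Sm(2) Dint SDint ESD by (simp only: Bochner_Integration.integral_add Bochner_Integration.integrable_add integrable_mult_right integral_mult_right_zero mult_zero_right add_0_right)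
      then show "expectation (\<lambda>\<omega>. (S m \<omega>)\<^sup>2 + (?D \<omega>)\<^sup>2 + 2 * (S m \<omega> * ?D \<omega>)) \<le> real (Suc m) * (2 * C\<^sup>2 * h\<^sup>2)"
        using Suc ED by (simp add: distrib_right)
    qed
  qed
  then show "S m \<in> borel_measurable (F (t m))" "integrable M (\<lambda>\<omega>. (S m \<omega>)\<^sup>2)"
    "expectation (\<lambda>\<omega>. (S m \<omega>)\<^sup>2) \<le> real m * (2 * C\<^sup>2 * h\<^sup>2)" by auto
qed

text \<open>With 2^n cells of length T / 2^n the second moment is at most 2 C^2 T^2 / 2^n, which is
  summable.\<close>

lemma AE_weighted_quadratic_variation_tendsto_0:
  assumes "0 \<le> T" and c: "\<And>n i. i < 2 ^ n \<Longrightarrow> c n i \<in> borel_measurable (F (mesh 0 T n i))" "\<And>n i \<omega>. \<bar>c n i \<omega>\<bar> \<le> C"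
  shows "AE \<omega> in M. (\<lambda>n. \<Sum>i<2^n. c n i \<omega> * ((dz (mesh 0 T n i) (mesh 0 T n (Suc i)) \<omega>)\<^sup>2 - (T - 0) / 2 ^ n)) \<longlonglongrightarrow> 0"
proof -
  define S where "S = (\<lambda>n \<omega>. \<Sum>i<2^n. c n i \<omega> * ((dz (mesh 0 T n i) (mesh 0 T n (Suc i)) \<omega>)\<^sup>2 - (T - 0) / 2 ^ n))"
  have S: "S n \<in> borel_measurable M" "(\<integral>\<^sup>+\<omega>. ennreal ((S n \<omega>)\<^sup>2) \<partial>M) \<le> ennreal (2 * C\<^sup>2 * T\<^sup>2 / 2 ^ n)" for n
  proof -
    \<comment> \<open>The weights are continued by 0 past the last cell, since the moment estimate
      asks for a weight at every index.\<close>
    define c' where "c' = (\<lambda>i. if i < 2 ^ n then c n i else (\<lambda>_. 0))"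
    have c': "c' i \<in> borel_measurable (F (mesh 0 T n i))" "\<bar>c' i \<omega>\<bar> \<le> C" for i \<omega>
      using c(1)[of i n] c(2)[of n i \<omega>] by (auto simp: c'_def)
    have Seq: "S n \<omega> = (\<Sum>i<2^n. c' i \<omega> * ((dz (mesh 0 T n i) (mesh 0 T n (Suc i)) \<omega>)\<^sup>2 - (T - 0) / 2 ^ n))" for \<omega>
      unfolding S_def c'_def by (intro sum.cong) auto
    note w = weighted_quadratic_variation[of "mesh 0 T n" "(T - 0) / 2 ^ n" c' C "2 ^ n",
        OF mesh_ge[OF assms(1)] mesh_diff _ c', folded Seq]
    show "S n \<in> borel_measurable M" using w(1) assms(1) measurable_F by auto
    have "(\<integral>\<^sup>+\<omega>. ennreal ((S n \<omega>)\<^sup>2) \<partial>M) = ennreal (expectation (\<lambda>\<omega>. (S n \<omega>)\<^sup>2))"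
      using w(2) assms(1) by (intro nn_integral_eq_integral) auto
    also have "\<dots> \<le> ennreal (2 * C\<^sup>2 * T\<^sup>2 / 2 ^ n)"
      using w(3) assms(1) by (intro ennreal_leI) (simp add: power_divide power2_eq_square)
    finally show "(\<integral>\<^sup>+\<omega>. ennreal ((S n \<omega>)\<^sup>2) \<partial>M) \<le> ennreal (2 * C\<^sup>2 * T\<^sup>2 / 2 ^ n)" .
  qed
  show ?thesis
    using AE_tendsto_0_if_square_summable[OF S(1) _ S(2)] unfolding S_def by simp
qed

end

section \<open>Law of the Ornstein-Uhlenbeck process\<close>

text \<open>Levy's uniqueness theorem is applied to the law of \<open>X\<close> conditioned on each event of \<open>G\<close>.\<close>

lemma (in prob_space) normal_indepI:
  assumes v: "v > 0" and subalg: "subalgebra M G" and X [measurable]: "X \<in> borel_measurable M"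
    and char: "\<And>A \<theta>. A \<in> sets G \<Longrightarrow> expectation (\<lambda>\<omega>. indicator A \<omega> *\<^sub>R exp (\<i> * complex_of_real (\<theta> * X \<omega>)))
      = complex_of_real (prob A * exp (- (\<theta>\<^sup>2 * v) / 2))"
  shows "normal_indep M G X v"
proof -
  define \<nu> where "\<nu> = density lborel (\<lambda>x. ennreal (normal_density 0 (sqrt v) x))"
  interpret \<nu>: prob_space \<nu>
    unfolding \<nu>_def using v by (intro prob_space_normal_density) simp
  have sets_\<nu> [simp, measurable_cong]: "sets \<nu> = sets borel" and space_\<nu> [simp]: "space \<nu> = UNIV"
    by (auto simp: \<nu>_def)
  have \<nu>rd: "real_distribution \<nu>"
    by (simp add: real_distribution_def real_distribution_axioms_def \<nu>.prob_space_axioms)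
  have "distributed \<nu> lborel (\<lambda>x. x) (normal_density 0 (sqrt v))"
    unfolding distributed_def by (auto simp: \<nu>_def intro!: distr_id2)
  from \<nu>.char_normal[OF v this] have char_\<nu>: "char \<nu> \<theta> = complex_of_real (exp (- (\<theta>\<^sup>2 * v) / 2))" for \<theta>
    by (simp add: char_def)
  have key: "prob (A \<inter> (X -` B \<inter> space M)) = prob A * measure \<nu> B"
    if A: "A \<in> sets G" and B [measurable]: "B \<in> sets borel" for A B
  proof (cases "prob A = 0")
    case True
    have "A \<in> events" using A subalg by (auto simp: subalgebra_def)
    then have "prob (A \<inter> (X -` B \<inter> space M)) \<le> prob A" by (intro finite_measure_mono) auto
    then show ?thesis using True by (simp add: measure_le_0_iff)
  next
    case False
    then have p: "prob A > 0" by (simp add: zero_less_measure_iff)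
    have A' [measurable]: "A \<in> events" using A subalg by (auto simp: subalgebra_def)
    \<comment> \<open>The probability conditioned on \<open>A\<close>; events of probability 0 had
      to be treated apart.\<close>
    define MA where "MA = density M (\<lambda>\<omega>. ennreal (indicator A \<omega> / prob A))"
    have sets_MA [simp, measurable_cong]: "sets MA = sets M" and space_MA [simp]: "space MA = space M"
      by (auto simp: MA_def)
    have em: "emeasure MA C = ennreal (prob (A \<inter> C) / prob A)" if C [measurable]: "C \<in> events" for C
    proof -
      have "emeasure MA C = (\<integral>\<^sup>+\<omega>. ennreal (1 / prob A) * indicator (A \<inter> C) \<omega> \<partial>M)"
        unfolding MA_def by (subst emeasure_density) (auto intro!: nn_integral_cong simp: indicator_def)
      also have "\<dots> = ennreal (1 / prob A) * emeasure M (A \<inter> C)"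
        by (subst nn_integral_cmult_indicator) auto
      also have "\<dots> = ennreal (prob (A \<inter> C) / prob A)"
        unfolding emeasure_eq_measure using p by (simp flip: ennreal_mult)
      finally show ?thesis .
    qed
    interpret MA: prob_space MA
      using p em[of "space M"] sets.sets_into_space[OF A'] by (intro prob_spaceI) (simp add: Int_absorb2)
    have "char (distr MA borel X) \<theta> = char \<nu> \<theta>" for \<theta>
    proof -
      have "char (distr MA borel X) \<theta> = (CLINT \<omega>|MA. exp (\<i> * complex_of_real (\<theta> * X \<omega>)))"
        unfolding char_def by (subst integral_distr) auto
      also have "\<dots> = (CLINT \<omega>|M. (indicator A \<omega> / prob A) *\<^sub>R exp (\<i> * complex_of_real (\<theta> * X \<omega>)))"
        unfolding MA_def by (subst integral_density) (auto simp: p)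
      also have "\<dots> = (CLINT \<omega>|M. (1 / prob A) *\<^sub>R (indicator A \<omega> *\<^sub>R exp (\<i> * complex_of_real (\<theta> * X \<omega>))))"
        by simp
      also have "\<dots> = (1 / prob A) *\<^sub>R expectation (\<lambda>\<omega>. indicator A \<omega> *\<^sub>R exp (\<i> * complex_of_real (\<theta> * X \<omega>)))"
        by (rule integral_scaleR_right)
      also have "\<dots> = char \<nu> \<theta>"
        unfolding char[OF A] char_\<nu> using p by (simp add: scaleR_conv_of_real)
      finally show ?thesis .
    qed
    then have "distr MA borel X = \<nu>"
      by (intro Levy_uniqueness MA.real_distribution_distr \<nu>rd ext) auto
    then have "measure \<nu> B = measure MA (X -` B \<inter> space M)"
      by (metis B X measurable_cong_sets measure_distr sets_MA space_MA)
    also have "\<dots> = prob (A \<inter> (X -` B \<inter> space M)) / prob A"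
      unfolding measure_def[of MA] by (subst em) (auto simp: p less_imp_le)
    finally show ?thesis using p by (simp add: field_simps)
  qed
  \<comment> \<open>Conditioning on the whole space yields the unconditional law of
    \<open>X\<close>, which turns \<open>key\<close> into a product formula.\<close>
  have spG: "space M \<in> sets G" using subalg by (metis sets.top subalgebra_def)
  have law: "prob (X -` B \<inter> space M) = measure \<nu> B" if "B \<in> sets borel" for B
    using key[OF spG that] by (simp add: prob_space Int_absorb1)
  have "distributed M lborel X (normal_density 0 (sqrt v))"
    unfolding distributed_def
  proof (intro conjI)
    show "distr M lborel X = density lborel (\<lambda>x. ennreal (normal_density 0 (sqrt v) x))"
      unfolding \<nu>_def[symmetric]
      by (rule measure_eqI) (auto simp: emeasure_distr emeasure_eq_measure \<nu>.emeasure_eq_measure law)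
  qed auto
  moreover have "indep_set (sets G) (sets (vimage_algebra (space M) X borel))"
    unfolding indep_sets2_eq
  proof (intro conjI ballI)
    show "sets G \<subseteq> events" using subalg by (simp add: subalgebra_def)
    have V: "\<exists>B\<in>sets borel. C = X -` B \<inter> space M" if "C \<in> sets (vimage_algebra (space M) X borel)" for C
      using that by (auto simp: sets_vimage_algebra2)
    then show "sets (vimage_algebra (space M) X borel) \<subseteq> events" by (auto dest!: V)
    fix A C assume "A \<in> sets G" "C \<in> sets (vimage_algebra (space M) X borel)"
    with V[of C] show "prob (A \<inter> C) = prob A * prob C" by (auto simp: key law)
  qed
  ultimately show ?thesis
    using v subalg by (simp add: normal_indep_def normal_indep_axioms_def prob_space_axioms)
qed

lemma borel_measurable_cexp: "(\<lambda>x. exp (\<i> * complex_of_real (\<theta> * x))) \<in> borel_measurable borel"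
  by (intro borel_measurable_continuous_onI continuous_intros)

text \<open>The increments are split off from the last one backwards: each is independent of the
  sigma-algebra at its left end, which contains \<open>A\<close> and all earlier increments.\<close>

lemma (in wiener) char_sum_increments:
  assumes t: "\<And>i. 0 \<le> t i" "\<And>i. t i < t (Suc i)" and A: "A \<in> sets (F (t 0))"
  shows "expectation (\<lambda>\<omega>. indicator A \<omega> *\<^sub>R exp (\<i> * complex_of_real (\<theta> * (\<Sum>i<m. k i * dz (t i) (t (Suc i)) \<omega>))))
    = complex_of_real (prob A * exp (- (\<theta>\<^sup>2 * (\<Sum>i<m. (k i)\<^sup>2 * (t (Suc i) - t i))) / 2))"
proof (induction m)
  case 0
  have "A \<in> events" using A subalgebra_F by (auto simp: subalgebra_def)
  then show ?case by (simp, subst integral_scaleR_left) (auto simp: scaleR_conv_of_real emeasure_eq_measure intro!: integrable_real_indicator)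
next
  case (Suc m)
  define Y where "Y = (\<lambda>\<omega>. indicator A \<omega> *\<^sub>R exp (\<i> * complex_of_real (\<theta> * (\<Sum>i<m. k i * dz (t i) (t (Suc i)) \<omega>))))"
  interpret normal_indep M "F (t m)" "dz (t m) (t (Suc m))" "t (Suc m) - t m"
    by (intro normal_indep_dz t)
  have mono: "t i \<le> t j" if "i \<le> j" for i j
    using that by (induction rule: dec_induct) (auto intro: less_imp_le[OF t(2)] order_trans)
  have [measurable]: "A \<in> sets (F (t m))"
    using A subalgebra_F_F[OF mono[of 0 m]] by (auto simp: subalgebra_def)
  have [measurable]: "dz (t i) (t (Suc i)) \<in> borel_measurable (F (t m))" if "i < m" for i
    using that by (intro measurable_dz t less_imp_le[OF t(2)] mono) auto
  have Y: "Y \<in> borel_measurable (F (t m))"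
    unfolding Y_def by (intro borel_measurable_scaleR measurable_compose[OF _ borel_measurable_cexp] borel_measurable_sum borel_measurable_times) auto
  define g where "g = (\<lambda>x::real. exp (\<i> * complex_of_real ((\<theta> * k m) * x)))"
  have gm [measurable]: "g \<in> borel_measurable borel" unfolding g_def by (rule borel_measurable_cexp)
  have Yint: "integrable M Y"
    using measurable_G[OF Y] by (intro integrable_const_bound[of _ 1]) (auto simp: Y_def indicator_def)
  have gint: "integrable M (\<lambda>\<omega>. g (dz (t m) (t (Suc m)) \<omega>))"
    by (intro integrable_const_bound[of _ 1] measurable_compose[OF measurable_X gm])
      (simp add: g_def del: of_real_mult)
  have "expectation (\<lambda>\<omega>. indicator A \<omega> *\<^sub>R exp (\<i> * complex_of_real (\<theta> * (\<Sum>i<Suc m. k i * dz (t i) (t (Suc i)) \<omega>))))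
      = expectation (\<lambda>\<omega>. Y \<omega> * g (dz (t m) (t (Suc m)) \<omega>))"
    unfolding Y_def g_def
    by (intro arg_cong[where f = expectation] ext) (simp add: distrib_left exp_add mult_ac flip: mult_scaleR_left)
  also have "\<dots> = expectation Y * expectation (\<lambda>\<omega>. g (dz (t m) (t (Suc m)) \<omega>))"
    by (rule indep_var_lebesgue_integral[OF indep_var_X[OF Y gm] Yint gint])
  also have "expectation (\<lambda>\<omega>. g (dz (t m) (t (Suc m)) \<omega>)) = complex_of_real (exp (- ((\<theta> * k m)\<^sup>2 * (t (Suc m) - t m)) / 2))"
    unfolding g_def by (rule char_X)
  also have "expectation Y = complex_of_real (prob A * exp (- (\<theta>\<^sup>2 * (\<Sum>i<m. (k i)\<^sup>2 * (t (Suc i) - t i))) / 2))"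
    unfolding Y_def by (rule Suc)
  finally show ?case
    by (simp add: distrib_left add_divide_distrib diff_divide_distrib power_mult_distrib mult_ac flip: exp_add of_real_mult)
qed

section \<open>Innovations of the Ornstein-Uhlenbeck process\<close>

locale ou = wiener +
  fixes \<alpha> \<sigma> :: real and x :: "real \<Rightarrow> 'a \<Rightarrow> real"
  assumes \<alpha>: "\<alpha> > 0" and \<sigma>: "\<sigma> > 0" and ou: "ou_process M F z \<alpha> \<sigma> x"
    and x0: "integrable M (\<lambda>\<omega>. x 0 \<omega> ^ 4)"
begin

lemma x_F: "0 \<le> t \<Longrightarrow> x t \<in> borel_measurable (F t)"
  using ou by (auto simp: ou_process_def adapted_process_def)

lemma x_M [measurable]: "0 \<le> t \<Longrightarrow> x t \<in> borel_measurable M"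
  using x_F measurable_F by auto

lemma x_continuous: "\<omega> \<in> space M \<Longrightarrow> 0 \<le> a \<Longrightarrow> continuous_on {a..b} (\<lambda>s. x s \<omega>)"
  using ou by (auto simp: ou_process_def continuous_paths_def intro: continuous_on_subset)

text \<open>A constant integrand is itself simple, so its approximation error is 0.\<close>

lemma Ito_integral_const:
  assumes I: "has_ito_integral M F z t (\<lambda>_ _. \<sigma>) I" and t: "0 \<le> t"
  shows "AE \<omega> in M. I \<omega> = \<sigma> * dz 0 t \<omega>"
proof -
  have s: "simple_family t {()} (\<lambda>_. 0) (\<lambda>_. t) (\<lambda>_ _. \<sigma>)"
    using t by (simp add: simple_family_def)
  have [measurable]: "I \<in> borel_measurable M" using I by (simp add: has_ito_integral_def)
  \<comment> \<open>The half-open interval of the simple process misses the end point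
    \<open>t\<close>, a null set.\<close>
  have ae: "AE s in lborel. s \<noteq> t" by (rule AE_lborel_singleton)
  have "(\<integral>\<^sup>+s\<in>{0..t}. (\<integral>\<^sup>+\<omega>. ennreal ((\<sigma> - simple_process {()} (\<lambda>_. 0) (\<lambda>_. t) (\<lambda>_ _. \<sigma>) s \<omega>)\<^sup>2) \<partial>M) \<partial>lborel)
      = (\<integral>\<^sup>+(s::real). 0 \<partial>lborel)"
  proof (rule nn_integral_cong_AE)
    show "AE s in lborel. (\<integral>\<^sup>+\<omega>. ennreal ((\<sigma> - simple_process {()} (\<lambda>_. 0) (\<lambda>_. t) (\<lambda>_ _. \<sigma>) s \<omega>)\<^sup>2) \<partial>M) * indicator {0..t} s = 0"
      using ae by eventually_elim (auto simp: simple_process_def indicator_def)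
  qed
  with Ito_integral_approx[OF I s]
  have "(\<integral>\<^sup>+\<omega>. ennreal ((I \<omega> - simple_integral {()} (\<lambda>_. 0) (\<lambda>_. t) (\<lambda>_ _. \<sigma>) \<omega>)\<^sup>2) \<partial>M) = 0"
    by simp
  then have "AE \<omega> in M. ennreal ((I \<omega> - \<sigma> * dz 0 t \<omega>)\<^sup>2) = 0"
    using t by (subst (asm) nn_integral_0_iff_AE) (auto simp: simple_integral_def)
  then show ?thesis by eventually_elim (simp add: ennreal_eq_0_iff power2_le_iff_abs_le)
qed

lemma x_increment:
  assumes "0 \<le> r" "r \<le> s"
  shows "AE \<omega> in M. x s \<omega> - x r \<omega> = integral {r..s} (\<lambda>v. - \<alpha> * x v \<omega>) + \<sigma> * dz r s \<omega>"
proof -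
  have eq: "AE \<omega> in M. x t \<omega> = x 0 \<omega> + integral {0..t} (\<lambda>v. - \<alpha> * x v \<omega>) + \<sigma> * dz 0 t \<omega>" if t: "0 \<le> t" for t
  proof -
    from ou t obtain I where I: "has_ito_integral M F z t (\<lambda>_ _. \<sigma>) I"
      and int: "AE \<omega> in M. set_integrable lborel {0..t} (\<lambda>v. - \<alpha> * x v \<omega>)"
      and xt: "AE \<omega> in M. x t \<omega> = x 0 \<omega> + (LINT v:{0..t}|lborel. - \<alpha> * x v \<omega>) + I \<omega>"
      by (auto simp: ou_process_def ito_process_def)
    show ?thesis
      using int xt Ito_integral_const[OF I t]
    proof eventually_elim
      case (elim \<omega>)
      then show ?case using set_borel_integral_eq_integral(2)[OF elim(1)] by simp
    qed
  qed
  show ?thesis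
    using eq[OF assms(1)] eq[OF order_trans[OF assms]] AE_space
  proof eventually_elim
    case (elim \<omega>)
    have "(\<lambda>v. - \<alpha> * x v \<omega>) integrable_on {0..s}"
      using x_continuous[OF elim(3) order_refl, of s] by (intro integrable_continuous_real continuous_intros)
    then have "integral {0..r} (\<lambda>v. - \<alpha> * x v \<omega>) + integral {r..s} (\<lambda>v. - \<alpha> * x v \<omega>) = integral {0..s} (\<lambda>v. - \<alpha> * x v \<omega>)"
      using assms by (intro Henstock_Kurzweil_Integration.integral_combine) auto
    with elim assms show ?case by (simp add: algebra_simps)
  qed
qed

lemma AE_ou_path:
  assumes "0 \<le> a" "a \<le> b"
  shows "AE \<omega> in M. ou_path a b \<alpha> \<sigma> (\<lambda>s. x s \<omega>) (\<lambda>s. z s \<omega>)"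
proof -
  have "AE \<omega> in M. \<forall>n i. x (mesh a b n (Suc i)) \<omega> - x (mesh a b n i) \<omega>
      = integral {mesh a b n i..mesh a b n (Suc i)} (\<lambda>v. - \<alpha> * x v \<omega>) + \<sigma> * dz (mesh a b n i) (mesh a b n (Suc i)) \<omega>"
    using assms mesh_ge[OF assms(2)] mesh_mono[OF assms(2)]
    by (intro AE_all_countable[THEN iffD2] allI x_increment) (auto intro: order_trans)
  then show ?thesis
    using AE_space
    by eventually_elim (use assms x_continuous \<alpha> in \<open>auto simp: ou_path_def\<close>)
qed

text \<open>This is the Wiener integral of \<sigma> exp (- \<alpha> (b - s)) over the times from
  \<open>a\<close> to \<open>b\<close>, expressed through \<open>x\<close> itself.\<close>

definition innovation :: "real \<Rightarrow> real \<Rightarrow> 'a \<Rightarrow> real" where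
  "innovation a b \<omega> = x b \<omega> - exp (- \<alpha> * (b - a)) * x a \<omega>"

text \<open>The integral of \<sigma>^2 exp (- 2 \<alpha> s) for s from 0 to \<open>t\<close>; it
  increases to the stationary variance \<sigma>^2 / (2 \<alpha>).\<close>

definition innovation_variance :: "real \<Rightarrow> real" where
  "innovation_variance t = \<sigma>\<^sup>2 * (1 - exp (- 2 * \<alpha> * t)) / (2 * \<alpha>)"

lemma innovation_variance_pos: "t > 0 \<Longrightarrow> innovation_variance t > 0"
  using \<alpha> \<sigma> by (simp add: innovation_variance_def)

lemma innovation_variance_le: "innovation_variance t \<le> \<sigma>\<^sup>2 * t"
proof -
  have "1 - exp (- 2 * \<alpha> * t) \<le> 2 * \<alpha> * t" using exp_ge_add_one_self[of "- 2 * \<alpha> * t"] by linarith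
  then have "\<sigma>\<^sup>2 * (1 - exp (- 2 * \<alpha> * t)) \<le> \<sigma>\<^sup>2 * (2 * \<alpha> * t)" by (intro mult_left_mono) auto
  then show ?thesis using \<alpha> by (simp add: innovation_variance_def field_simps)
qed

lemma innovation_variance_bound: "t \<ge> 0 \<Longrightarrow> innovation_variance t \<le> \<sigma>\<^sup>2 / (2 * \<alpha>)"
  using \<alpha> by (simp add: innovation_variance_def divide_right_mono mult_left_le)

lemma innovation_measurable [measurable]: "0 \<le> a \<Longrightarrow> 0 \<le> b \<Longrightarrow> innovation a b \<in> borel_measurable M"
  unfolding innovation_def[abs_def] by measurable

text \<open>The innovation is the almost sure limit of sums of increments with deterministic
  coefficients. On each event of \<open>F a\<close> their characteristic functions are explicit, and
  dominated convergence carries them to the limit. The variances are Riemann sums.\<close>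

lemma normal_indep_innovation:
  assumes a: "0 \<le> a" and ab: "a < b"
  shows "normal_indep M (F a) (innovation a b) (innovation_variance (b - a))"
proof (rule normal_indepI)
  let ?t = "mesh a b" and ?k = "\<lambda>n i. \<sigma> * exp (- \<alpha> * (b - mesh a b n i))"
  show "innovation_variance (b - a) > 0" using ab innovation_variance_pos by simp
  show "subalgebra M (F a)" by (rule subalgebra_F)
  show "innovation a b \<in> borel_measurable M" using a ab by simp
  have lim: "AE \<omega> in M. (\<lambda>n. \<Sum>i<2^n. ?k n i * dz (?t n i) (?t n (Suc i)) \<omega>) \<longlonglongrightarrow> innovation a b \<omega>"
    using AE_ou_path[OF a less_imp_le[OF ab]]
  proof eventually_elim
    case (elim \<omega>)
    interpret ou_path a b \<alpha> \<sigma> "\<lambda>s. x s \<omega>" "\<lambda>s. z s \<omega>" by fact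
    have 1: "(\<lambda>n. exp (- \<alpha> * b) * (\<Sum>i<2^n. exp (\<alpha> * ?t n i) * \<sigma> * dz (?t n i) (?t n (Suc i)) \<omega>))
        \<longlonglongrightarrow> exp (- \<alpha> * b) * (exp (\<alpha> * b) * x b \<omega> - exp (\<alpha> * a) * x a \<omega>)"
      by (intro tendsto_mult_left exp_sum_tendsto)
    have 2: "exp (- \<alpha> * b) * (exp (\<alpha> * b) * x b \<omega> - exp (\<alpha> * a) * x a \<omega>) = innovation a b \<omega>"
      by (simp add: innovation_def right_diff_distrib flip: mult.assoc exp_add)
    have 3: "exp (- \<alpha> * b) * (\<Sum>i<2^n. exp (\<alpha> * ?t n i) * \<sigma> * dz (?t n i) (?t n (Suc i)) \<omega>)
        = (\<Sum>i<2^n. ?k n i * dz (?t n i) (?t n (Suc i)) \<omega>)" for n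
      unfolding sum_distrib_left
      by (intro sum.cong refl) (simp add: right_diff_distrib exp_diff exp_minus field_simps)
    show ?case using 1 unfolding 2 3 .
  qed
  have var: "(\<lambda>n. \<Sum>i<2^n. (?k n i)\<^sup>2 * (?t n (Suc i) - ?t n i)) \<longlonglongrightarrow> innovation_variance (b - a)"
  proof -
    have "((\<lambda>s. \<sigma>\<^sup>2 * exp (- 2 * \<alpha> * (b - s))) has_integral
        \<sigma>\<^sup>2 / (2 * \<alpha>) * exp (- 2 * \<alpha> * (b - b)) - \<sigma>\<^sup>2 / (2 * \<alpha>) * exp (- 2 * \<alpha> * (b - a))) {a..b}"
      using ab \<alpha> by (intro fundamental_theorem_of_calculus)
        (auto intro!: derivative_eq_intros simp flip: has_real_derivative_iff_has_vector_derivative)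
    moreover have "\<sigma>\<^sup>2 / (2 * \<alpha>) * exp (- 2 * \<alpha> * (b - b)) - \<sigma>\<^sup>2 / (2 * \<alpha>) * exp (- 2 * \<alpha> * (b - a)) = innovation_variance (b - a)"
      by (simp add: innovation_variance_def algebra_simps diff_divide_distrib)
    ultimately have int: "integral {a..b} (\<lambda>s. \<sigma>\<^sup>2 * exp (- 2 * \<alpha> * (b - s))) = innovation_variance (b - a)"
      by (metis integral_unique)
    have "(\<lambda>n. \<Sum>i<2^n. \<sigma>\<^sup>2 * exp (- 2 * \<alpha> * (b - ?t n i)) * ((b - a) / 2 ^ n)) \<longlonglongrightarrow> innovation_variance (b - a)"
      unfolding int[symmetric] using ab
      by (intro riemann_sum_tendsto_integral continuous_intros) auto
    moreover have "\<sigma>\<^sup>2 * exp (- 2 * \<alpha> * (b - s)) = (\<sigma> * exp (- \<alpha> * (b - s)))\<^sup>2" for s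
      by (simp add: power_mult_distrib power2_eq_square flip: exp_add)
    ultimately show ?thesis by (simp only: mesh_diff)
  qed
  fix A \<theta> assume A: "A \<in> sets (F a)"
  have [measurable]: "A \<in> events" using A subalgebra_F by (auto simp: subalgebra_def)
  have [measurable]: "dz (?t n i) (?t n (Suc i)) \<in> borel_measurable M" for n i
    using a ab mesh_ge[of a b] by (intro borel_measurable_diff measurable_z_M) (auto intro: order_trans)
  have "(\<lambda>n. expectation (\<lambda>\<omega>. indicator A \<omega> *\<^sub>R exp (\<i> * complex_of_real (\<theta> * (\<Sum>i<2^n. ?k n i * dz (?t n i) (?t n (Suc i)) \<omega>)))))
      \<longlonglongrightarrow> expectation (\<lambda>\<omega>. indicator A \<omega> *\<^sub>R exp (\<i> * complex_of_real (\<theta> * innovation a b \<omega>)))"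
  proof (rule integral_dominated_convergence[where w = "\<lambda>_. 1"])
    show "AE \<omega> in M. (\<lambda>n. indicator A \<omega> *\<^sub>R exp (\<i> * complex_of_real (\<theta> * (\<Sum>i<2^n. ?k n i * dz (?t n i) (?t n (Suc i)) \<omega>))))
        \<longlonglongrightarrow> indicator A \<omega> *\<^sub>R exp (\<i> * complex_of_real (\<theta> * innovation a b \<omega>))"
      using lim by eventually_elim (intro tendsto_intros)
    show "(\<lambda>\<omega>. indicator A \<omega> *\<^sub>R exp (\<i> * complex_of_real (\<theta> * (\<Sum>i<2^n. ?k n i * dz (?t n i) (?t n (Suc i)) \<omega>)))) \<in> borel_measurable M" for n
      by (intro borel_measurable_scaleR measurable_compose[OF _ borel_measurable_cexp] borel_measurable_sum borel_measurable_times) auto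
    show "(\<lambda>\<omega>. indicator A \<omega> *\<^sub>R exp (\<i> * complex_of_real (\<theta> * innovation a b \<omega>))) \<in> borel_measurable M"
      using a ab by (intro borel_measurable_scaleR measurable_compose[OF _ borel_measurable_cexp]) auto
  qed (auto simp: indicator_def simp del: of_real_sum of_real_mult)
  moreover have "(\<lambda>n. expectation (\<lambda>\<omega>. indicator A \<omega> *\<^sub>R exp (\<i> * complex_of_real (\<theta> * (\<Sum>i<2^n. ?k n i * dz (?t n i) (?t n (Suc i)) \<omega>)))))
      \<longlonglongrightarrow> complex_of_real (prob A * exp (- (\<theta>\<^sup>2 * innovation_variance (b - a)) / 2))"
  proof -
    have "expectation (\<lambda>\<omega>. indicator A \<omega> *\<^sub>R exp (\<i> * complex_of_real (\<theta> * (\<Sum>i<2^n. ?k n i * dz (?t n i) (?t n (Suc i)) \<omega>))))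
      = complex_of_real (prob A * exp (- (\<theta>\<^sup>2 * (\<Sum>i<2^n. (?k n i)\<^sup>2 * (?t n (Suc i) - ?t n i))) / 2))" for n
      using a ab A mesh_ge[of a b] mesh_strict_mono[OF ab]
      by (intro char_sum_increments) (auto intro: order_trans)
    then show ?thesis
      using var by (auto intro!: tendsto_intros)
  qed
  ultimately show "expectation (\<lambda>\<omega>. indicator A \<omega> *\<^sub>R exp (\<i> * complex_of_real (\<theta> * innovation a b \<omega>)))
      = complex_of_real (prob A * exp (- (\<theta>\<^sup>2 * innovation_variance (b - a)) / 2))"
    by (rule LIMSEQ_unique)
qed

end

section \<open>Riemann sums for stochastic integrals\<close>

lemma mesh_cell:
  assumes "a < b" "a \<le> s" "s < b"
  obtains i where "i < 2 ^ n" "mesh a b n i \<le> s" "s < mesh a b n (Suc i)"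
proof -
  define i where "i = nat \<lfloor>(s - a) * 2 ^ n / (b - a)\<rfloor>"
  have nn: "(s - a) * 2 ^ n / (b - a) \<ge> 0" using assms by simp
  then have i: "real i \<le> (s - a) * 2 ^ n / (b - a)" "(s - a) * 2 ^ n / (b - a) < real i + 1"
    unfolding i_def by linarith+
  have "(s - a) * 2 ^ n / (b - a) < 2 ^ n" using assms by (simp add: field_simps)
  then have "real i < 2 ^ n" using i by linarith
  then have "i < 2 ^ n" by (metis of_nat_less_iff of_nat_numeral of_nat_power)
  moreover have "mesh a b n i \<le> s" "s < mesh a b n (Suc i)"
    using i assms by (auto simp: mesh_def field_simps)
  ultimately show ?thesis using that by blast
qed

lemma numeral_mult_ennreal: "0 \<le> a \<Longrightarrow> numeral k * ennreal a = ennreal (numeral k * a)"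
  by (simp add: ennreal_mult)

lemma power4_add_le: "(p + q) ^ 4 \<le> 8 * p ^ 4 + 8 * (q::real) ^ 4"
proof -
  have "(p + q) ^ 4 = ((p + q)\<^sup>2)\<^sup>2" by simp
  also have "\<dots> \<le> (2 * p\<^sup>2 + 2 * q\<^sup>2)\<^sup>2" by (intro power_mono square_add_le) auto
  also have "\<dots> \<le> 2 * (2 * p\<^sup>2)\<^sup>2 + 2 * (2 * q\<^sup>2)\<^sup>2" by (rule square_add_le)
  also have "\<dots> = 8 * p ^ 4 + 8 * q ^ 4" by (simp add: power_mult_distrib)
  finally show ?thesis .
qed

lemma AE_tendsto_if_square_summable:
  fixes X :: "nat \<Rightarrow> 'a \<Rightarrow> real"
  assumes "\<And>n. X n \<in> borel_measurable M" "Y \<in> borel_measurable M"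
    and "C \<ge> 0" "\<And>n. (\<integral>\<^sup>+\<omega>. ennreal ((Y \<omega> - X n \<omega>)\<^sup>2) \<partial>M) \<le> ennreal (C / 2 ^ n)"
  shows "AE \<omega> in M. (\<lambda>n. X n \<omega>) \<longlonglongrightarrow> Y \<omega>"
proof -
  have "AE \<omega> in M. (\<lambda>n. Y \<omega> - X n \<omega>) \<longlonglongrightarrow> 0"
    using assms by (intro AE_tendsto_0_if_square_summable[where C = C]) auto
  then show ?thesis
  proof eventually_elim
    case (elim \<omega>)
    from tendsto_diff[OF tendsto_const elim, of "Y \<omega>"] show ?case by simp
  qed
qed

context ou
begin

text \<open>The factor 8 comes from \<open>power4_add_le\<close>, and 24 is 8 times the Gaussian
  constant 3. The squared quantity is the stationary variance, which dominates every innovation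
  variance.\<close>

definition fourth_bound :: real where
  "fourth_bound = 8 * expectation (\<lambda>\<omega>. x 0 \<omega> ^ 4) + 24 * (\<sigma>\<^sup>2 / (2 * \<alpha>))\<^sup>2"

lemma fourth_bound_nonneg: "fourth_bound \<ge> 0"
  by (simp add: fourth_bound_def)

lemma x_eq_innovation: "x t \<omega> = exp (- \<alpha> * t) * x 0 \<omega> + innovation 0 t \<omega>"
  by (simp add: innovation_def)

lemma
  assumes t: "0 \<le> t"
  shows integrable_x_fourth: "integrable M (\<lambda>\<omega>. x t \<omega> ^ 4)"
    and expectation_x_fourth_le: "expectation (\<lambda>\<omega>. x t \<omega> ^ 4) \<le> fourth_bound"
proof -
  have "integrable M (\<lambda>\<omega>. x t \<omega> ^ 4) \<and> expectation (\<lambda>\<omega>. x t \<omega> ^ 4) \<le> fourth_bound"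
  proof (cases "t = 0")
    case True
    have "0 \<le> expectation (\<lambda>\<omega>. x 0 \<omega> ^ 4)" by simp
    then have "expectation (\<lambda>\<omega>. x 0 \<omega> ^ 4) \<le> fourth_bound"
      unfolding fourth_bound_def using zero_le_power2[of "\<sigma>\<^sup>2 / (2 * \<alpha>)"] by linarith
    then show ?thesis using True x0 by simp
  next
    case False
    interpret N: normal_indep M "F 0" "innovation 0 t" "innovation_variance t"
      using normal_indep_innovation[of 0 t] t False by simp
    have bound: "x t \<omega> ^ 4 \<le> 8 * x 0 \<omega> ^ 4 + 8 * innovation 0 t \<omega> ^ 4" for \<omega>
    proof -
      have "x t \<omega> ^ 4 \<le> 8 * (exp (- \<alpha> * t) * x 0 \<omega>) ^ 4 + 8 * innovation 0 t \<omega> ^ 4"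
        unfolding x_eq_innovation[of t] by (rule power4_add_le)
      also have "(exp (- \<alpha> * t) * x 0 \<omega>) ^ 4 \<le> 1 * x 0 \<omega> ^ 4"
        unfolding power_mult_distrib using \<alpha> t by (intro mult_right_mono power_le_one) auto
      finally show ?thesis by simp
    qed
    have int: "integrable M (\<lambda>\<omega>. 8 * x 0 \<omega> ^ 4 + 8 * innovation 0 t \<omega> ^ 4)"
      using x0 N.integrable_X_power by auto
    have int4: "integrable M (\<lambda>\<omega>. x t \<omega> ^ 4)"
      using t bound by (intro Bochner_Integration.integrable_bound[OF int]) (auto simp: abs_of_nonneg)
    have "expectation (\<lambda>\<omega>. x t \<omega> ^ 4) \<le> expectation (\<lambda>\<omega>. 8 * x 0 \<omega> ^ 4 + 8 * innovation 0 t \<omega> ^ 4)"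
      by (intro integral_mono int int4 bound)
    also have "\<dots> = 8 * expectation (\<lambda>\<omega>. x 0 \<omega> ^ 4) + 24 * (innovation_variance t)\<^sup>2"
      using x0 N.integrable_X_power[of 4] N.expectation_X_fourth by simp
    also have "\<dots> \<le> fourth_bound"
      unfolding fourth_bound_def using t False innovation_variance_pos[of t] innovation_variance_bound[of t]
      by (intro add_left_mono mult_left_mono power_mono) auto
    finally show ?thesis using int4 by simp
  qed
  then show "integrable M (\<lambda>\<omega>. x t \<omega> ^ 4)" "expectation (\<lambda>\<omega>. x t \<omega> ^ 4) \<le> fourth_bound" by auto
qed

lemma
  assumes t: "0 \<le> t"
  shows integrable_x_square: "integrable M (\<lambda>\<omega>. (x t \<omega>)\<^sup>2)"
    and expectation_x_square_le: "expectation (\<lambda>\<omega>. (x t \<omega>)\<^sup>2) \<le> 1 + fourth_bound"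
proof -
  have le: "y\<^sup>2 \<le> 1 + y ^ 4" for y :: real
  proof -
    have "2 * y\<^sup>2 \<le> 1 + y ^ 4" using sum_squares_bound[of 1 "y\<^sup>2"] by simp
    with zero_le_power2[of y] show ?thesis by linarith
  qed
  have int: "integrable M (\<lambda>\<omega>. 1 + x t \<omega> ^ 4)" using integrable_x_fourth[OF t] by simp
  show sq: "integrable M (\<lambda>\<omega>. (x t \<omega>)\<^sup>2)"
    using t le by (intro Bochner_Integration.integrable_bound[OF int]) (auto simp: abs_of_nonneg)
  have "expectation (\<lambda>\<omega>. (x t \<omega>)\<^sup>2) \<le> expectation (\<lambda>\<omega>. 1 + x t \<omega> ^ 4)"
    by (intro integral_mono sq int le)
  then show "expectation (\<lambda>\<omega>. (x t \<omega>)\<^sup>2) \<le> 1 + fourth_bound"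
    using integrable_x_fourth[OF t] expectation_x_fourth_le[OF t] by (simp add: prob_space)
qed

text \<open>A Lipschitz constant in time for the mean-square increments of \<open>x\<close> up to
  time \<open>T\<close>: the first term comes from the noise, the second from the mean
  reversion.\<close>

definition modulus :: "real \<Rightarrow> real" where
  "modulus T = 2 * \<sigma>\<^sup>2 + 2 * \<alpha>\<^sup>2 * T * (1 + fourth_bound)"

lemma modulus_nonneg: "0 \<le> T \<Longrightarrow> 0 \<le> modulus T"
  using fourth_bound_nonneg by (simp add: modulus_def)

lemma x_mean_square_continuity:
  assumes r: "0 \<le> r" and rs: "r \<le> s" and sT: "s \<le> T"
  shows "integrable M (\<lambda>\<omega>. (x s \<omega> - x r \<omega>)\<^sup>2)"
    and "expectation (\<lambda>\<omega>. (x s \<omega> - x r \<omega>)\<^sup>2) \<le> modulus T * (s - r)"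
proof -
  have "integrable M (\<lambda>\<omega>. (x s \<omega> - x r \<omega>)\<^sup>2) \<and> expectation (\<lambda>\<omega>. (x s \<omega> - x r \<omega>)\<^sup>2) \<le> modulus T * (s - r)"
  proof (cases "r = s")
    case False
    with rs have rs: "r < s" by simp
    interpret N: normal_indep M "F r" "innovation r s" "innovation_variance (s - r)"
      by (rule normal_indep_innovation[OF r rs])
    \<comment> \<open>The fraction of \<open>x r\<close> lost by mean reversion. Its square is of
      second order in s - r, and one factor is given up for \<open>T\<close> to match the linear
      bound of the noise.\<close>
    define q where "q = 1 - exp (- \<alpha> * (s - r))"
    have q: "0 \<le> q" "q \<le> \<alpha> * (s - r)"
      using \<alpha> rs exp_ge_add_one_self[of "- \<alpha> * (s - r)"] unfolding q_def by auto
    have "q\<^sup>2 \<le> (\<alpha> * (s - r))\<^sup>2" using q by (intro power_mono)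
    also have "\<dots> = \<alpha>\<^sup>2 * ((s - r) * (s - r))" by (simp add: power2_eq_square mult_ac)
    also have "\<dots> \<le> \<alpha>\<^sup>2 * (T * (s - r))" using r rs sT by (intro mult_left_mono mult_right_mono) auto
    finally have q2: "q\<^sup>2 \<le> \<alpha>\<^sup>2 * (T * (s - r))" .
    have int: "integrable M (\<lambda>\<omega>. 2 * (innovation r s \<omega>)\<^sup>2 + 2 * (q\<^sup>2 * (x r \<omega>)\<^sup>2))"
      using N.integrable_X_power[of 2] integrable_x_square[OF r] by auto
    have le: "(x s \<omega> - x r \<omega>)\<^sup>2 \<le> 2 * (innovation r s \<omega>)\<^sup>2 + 2 * (q\<^sup>2 * (x r \<omega>)\<^sup>2)" for \<omega>
    proof -
      have e: "x s \<omega> - x r \<omega> = innovation r s \<omega> + - q * x r \<omega>"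
        by (simp add: innovation_def q_def algebra_simps)
      show ?thesis
        unfolding e using square_add_le[of "innovation r s \<omega>" "- q * x r \<omega>"] by (simp add: power_mult_distrib)
    qed
    have sq: "integrable M (\<lambda>\<omega>. (x s \<omega> - x r \<omega>)\<^sup>2)"
      using r rs le by (intro Bochner_Integration.integrable_bound[OF int]) (auto simp: abs_of_nonneg)
    have "expectation (\<lambda>\<omega>. (x s \<omega> - x r \<omega>)\<^sup>2) \<le> expectation (\<lambda>\<omega>. 2 * (innovation r s \<omega>)\<^sup>2 + 2 * (q\<^sup>2 * (x r \<omega>)\<^sup>2))"
      by (intro integral_mono sq int le)
    also have "\<dots> = 2 * innovation_variance (s - r) + 2 * (q\<^sup>2 * expectation (\<lambda>\<omega>. (x r \<omega>)\<^sup>2))"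
      using N.integrable_X_power[of 2] integrable_x_square[OF r] N.expectation_X_square by simp
    also have "\<dots> \<le> 2 * (\<sigma>\<^sup>2 * (s - r)) + 2 * (\<alpha>\<^sup>2 * (T * (s - r)) * (1 + fourth_bound))"
      using q2 innovation_variance_le[of "s - r"] expectation_x_square_le[OF r] r rs sT
      by (intro add_mono mult_left_mono mult_mono) auto
    also have "\<dots> = modulus T * (s - r)" by (simp add: modulus_def algebra_simps)
    finally show ?thesis using sq by simp
  qed simp
  then show "integrable M (\<lambda>\<omega>. (x s \<omega> - x r \<omega>)\<^sup>2)"
    "expectation (\<lambda>\<omega>. (x s \<omega> - x r \<omega>)\<^sup>2) \<le> modulus T * (s - r)" by auto
qed

definition Ito_sum :: "(real \<Rightarrow> real) \<Rightarrow> real \<Rightarrow> nat \<Rightarrow> 'a \<Rightarrow> real" where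
  "Ito_sum g T n = simple_integral {..<2 ^ n} (mesh 0 T n) (\<lambda>i. mesh 0 T n (Suc i)) (\<lambda>i \<omega>. g (x (mesh 0 T n i) \<omega>) * \<sigma>)"

definition Ito_step :: "(real \<Rightarrow> real) \<Rightarrow> real \<Rightarrow> nat \<Rightarrow> real \<Rightarrow> 'a \<Rightarrow> real" where
  "Ito_step g T n = simple_process {..<2 ^ n} (mesh 0 T n) (\<lambda>i. mesh 0 T n (Suc i)) (\<lambda>i \<omega>. g (x (mesh 0 T n i) \<omega>) * \<sigma>)"

lemma Ito_sum_eq:
  "Ito_sum g T n \<omega> = (\<Sum>i<2^n. g (x (mesh 0 T n i) \<omega>) * \<sigma> * dz (mesh 0 T n i) (mesh 0 T n (Suc i)) \<omega>)"
  by (simp add: Ito_sum_def simple_integral_def)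

lemma Ito_sum_diff: "Ito_sum (\<lambda>y. f y - g y) T n \<omega> = Ito_sum f T n \<omega> - Ito_sum g T n \<omega>"
  by (simp add: Ito_sum_eq left_diff_distrib sum_subtractf)

text \<open>The half-open cells are disjoint and cover all times before \<open>T\<close>, so one
  term survives. At \<open>T\<close> itself the step process is 0, which forces the strict
  inequality.\<close>

lemma Ito_step_eq:
  assumes "0 \<le> s" "s < T"
  obtains r where "0 \<le> r" "r \<le> s" "s \<le> r + T / 2 ^ n" "\<And>\<omega>. Ito_step g T n s \<omega> = g (x r \<omega>) * \<sigma>"
proof -
  obtain i where i: "i < 2 ^ n" "mesh 0 T n i \<le> s" "s < mesh 0 T n (Suc i)"
    using mesh_cell[of 0 T s n] assms by auto
  have T: "0 \<le> T" using assms by simp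
  have "Ito_step g T n s \<omega> = g (x (mesh 0 T n i) \<omega>) * \<sigma>" for \<omega>
  proof -
    have "Ito_step g T n s \<omega> = (\<Sum>j<2^n. if j = i then g (x (mesh 0 T n i) \<omega>) * \<sigma> else 0)"
      unfolding Ito_step_def simple_process_def
    proof (intro sum.cong refl)
      fix j
      have "mesh 0 T n (Suc j) \<le> mesh 0 T n i \<or> j = i \<or> mesh 0 T n (Suc i) \<le> mesh 0 T n j"
        using mesh_mono[OF T] by (metis Suc_leI linorder_neqE_nat)
      then show "g (x (mesh 0 T n j) \<omega>) * \<sigma> * indicator {mesh 0 T n j..<mesh 0 T n (Suc j)} s
          = (if j = i then g (x (mesh 0 T n i) \<omega>) * \<sigma> else 0)"
        using i by (auto simp: indicator_def)
    qed
    then show ?thesis using i by simp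
  qed
  moreover have "s \<le> mesh 0 T n i + T / 2 ^ n" using i mesh_diff[of 0 T n i] by simp
  ultimately show ?thesis using that i mesh_ge[OF T] by blast
qed

end

text \<open>The Lipschitz condition is stable under differences, so the locale serves both the
  policy itself and its difference from the derivative of the Poisson solution.\<close>

locale ou_lipschitz = ou +
  fixes g :: "real \<Rightarrow> real" and K :: real
  assumes lipschitz: "\<And>p q. \<bar>g p - g q\<bar> \<le> K * \<bar>p - q\<bar>"
begin

section \<open>Convergence of the left-endpoint sums\<close>

lemma K_nonneg: "0 \<le> K"
  using lipschitz[of 1 0] by simp

lemma g_measurable [measurable]: "g \<in> borel_measurable borel"
proof (rule borel_measurable_continuous_onI)
  have "K-lipschitz_on UNIV g"
    using lipschitz K_nonneg by (intro lipschitz_onI) (auto simp: dist_real_def)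
  then show "continuous_on UNIV g" by (rule lipschitz_on_continuous_on)
qed

lemma integrable_g_square:
  assumes t: "0 \<le> t"
  shows "integrable M (\<lambda>\<omega>. (g (x t \<omega>))\<^sup>2)"
proof (rule Bochner_Integration.integrable_bound)
  show "integrable M (\<lambda>\<omega>. 2 * (g 0)\<^sup>2 + 2 * (K\<^sup>2 * (x t \<omega>)\<^sup>2))"
    using integrable_x_square[OF t] by simp
  have "(g y)\<^sup>2 \<le> 2 * (g 0)\<^sup>2 + 2 * (K\<^sup>2 * y\<^sup>2)" for y
  proof -
    have "(g y - g 0)\<^sup>2 \<le> (K * \<bar>y\<bar>)\<^sup>2"
      using lipschitz[of y 0] K_nonneg by (simp add: abs_le_square_iff[symmetric] abs_mult)
    then show ?thesis using square_add_le[of "g 0" "g y - g 0"] by (simp add: power_mult_distrib)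
  qed
  then show "AE \<omega> in M. norm ((g (x t \<omega>))\<^sup>2) \<le> norm (2 * (g 0)\<^sup>2 + 2 * (K\<^sup>2 * (x t \<omega>)\<^sup>2))"
    by simp
  show "(\<lambda>\<omega>. (g (x t \<omega>))\<^sup>2) \<in> borel_measurable M" using t by measurable
qed

lemma simple_family_Ito:
  assumes "0 \<le> T"
  shows "simple_family T {..<2 ^ n} (mesh 0 T n) (\<lambda>i. mesh 0 T n (Suc i)) (\<lambda>i \<omega>. g (x (mesh 0 T n i) \<omega>) * \<sigma>)"
  using assms mesh_ge[OF assms] mesh_mono[OF assms] mesh_le[OF assms] integrable_g_square
    measurable_compose[OF x_F g_measurable]
  by (auto simp: simple_family_def power_mult_distrib Suc_le_eq)

lemma Ito_sum_measurable [measurable]: "0 \<le> T \<Longrightarrow> Ito_sum g T n \<in> borel_measurable M"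
  unfolding Ito_sum_def by (rule simple_integral_measurable[OF simple_family_Ito])

lemma Ito_sum_square_integrable: "0 \<le> T \<Longrightarrow> integrable M (\<lambda>\<omega>. (Ito_sum g T n \<omega>)\<^sup>2)"
  unfolding Ito_sum_def by (rule simple_isometry(1)[OF simple_family_Ito])

lemma expectation_Ito_sum:
  assumes T: "0 \<le> T"
  shows "expectation (Ito_sum g T n) = 0"
proof -
  have *: "integrable M (\<lambda>\<omega>. g (x (mesh 0 T n i) \<omega>) * \<sigma> * dz (mesh 0 T n i) (mesh 0 T n (Suc i)) \<omega>)
    \<and> expectation (\<lambda>\<omega>. g (x (mesh 0 T n i) \<omega>) * \<sigma> * dz (mesh 0 T n i) (mesh 0 T n (Suc i)) \<omega>) = 0" for i
  proof -
    have 1: "(\<lambda>\<omega>. g (x (mesh 0 T n i) \<omega>) * \<sigma>) \<in> borel_measurable (F (mesh 0 T n i))"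
      using measurable_compose[OF x_F g_measurable] mesh_ge[OF T] by auto
    have "integrable M (\<lambda>\<omega>. g (x (mesh 0 T n i) \<omega>))"
      by (rule square_integrable_imp_integrable[OF measurable_compose[OF x_M[OF mesh_ge[OF T]] g_measurable]
            integrable_g_square[OF mesh_ge[OF T]]])
    then have 2: "integrable M (\<lambda>\<omega>. g (x (mesh 0 T n i) \<omega>) * \<sigma>)" by simp
    show ?thesis
      using integrable_mult_dz[OF _ _ 1 2] expectation_mult_dz[OF _ _ 1 2] mesh_ge[OF T] mesh_mono[OF T]
      by auto
  qed
  have "expectation (Ito_sum g T n) = (\<Sum>i<2^n. expectation (\<lambda>\<omega>. g (x (mesh 0 T n i) \<omega>) * \<sigma> * dz (mesh 0 T n i) (mesh 0 T n (Suc i)) \<omega>))"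
    unfolding Ito_sum_eq[abs_def] using * by (intro Bochner_Integration.integral_sum) blast
  also have "\<dots> = 0" using * by (intro sum.neutral) blast
  finally show ?thesis .
qed

definition step_error :: "real \<Rightarrow> real" where
  "step_error T = \<sigma>\<^sup>2 * K\<^sup>2 * modulus T * T"

lemma step_error_nonneg: "0 \<le> T \<Longrightarrow> 0 \<le> step_error T"
  using modulus_nonneg by (simp add: step_error_def)

lemma Ito_step_error:
  assumes "0 \<le> s" "s < T"
  shows "(\<integral>\<^sup>+\<omega>. ennreal ((g (x s \<omega>) * \<sigma> - Ito_step g T n s \<omega>)\<^sup>2) \<partial>M) \<le> ennreal (step_error T / 2 ^ n)"
proof -
  obtain r where r: "0 \<le> r" "r \<le> s" "s \<le> r + T / 2 ^ n" "\<And>\<omega>. Ito_step g T n s \<omega> = g (x r \<omega>) * \<sigma>"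
    using Ito_step_eq[OF assms] by blast
  note x = x_mean_square_continuity[OF r(1,2) less_imp_le[OF assms(2)]]
  have "(g (x s \<omega>) * \<sigma> - g (x r \<omega>) * \<sigma>)\<^sup>2 \<le> \<sigma>\<^sup>2 * (K\<^sup>2 * (x s \<omega> - x r \<omega>)\<^sup>2)" for \<omega>
  proof -
    have "(g (x s \<omega>) - g (x r \<omega>))\<^sup>2 \<le> (K * \<bar>x s \<omega> - x r \<omega>\<bar>)\<^sup>2"
      using lipschitz[of "x s \<omega>" "x r \<omega>"] K_nonneg by (simp add: abs_le_square_iff[symmetric] abs_mult)
    then have "\<sigma>\<^sup>2 * (g (x s \<omega>) - g (x r \<omega>))\<^sup>2 \<le> \<sigma>\<^sup>2 * (K\<^sup>2 * (x s \<omega> - x r \<omega>)\<^sup>2)"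
      by (intro mult_left_mono) (auto simp: power_mult_distrib)
    moreover have "g (x s \<omega>) * \<sigma> - g (x r \<omega>) * \<sigma> = \<sigma> * (g (x s \<omega>) - g (x r \<omega>))"
      by (simp add: algebra_simps)
    ultimately show ?thesis
      by (simp only: power_mult_distrib)
  qed
  then have "(\<integral>\<^sup>+\<omega>. ennreal ((g (x s \<omega>) * \<sigma> - Ito_step g T n s \<omega>)\<^sup>2) \<partial>M)
      \<le> (\<integral>\<^sup>+\<omega>. ennreal (\<sigma>\<^sup>2 * (K\<^sup>2 * (x s \<omega> - x r \<omega>)\<^sup>2)) \<partial>M)"
    unfolding r(4) by (intro nn_integral_mono ennreal_leI)
  also have "\<dots> = ennreal (\<sigma>\<^sup>2 * (K\<^sup>2 * expectation (\<lambda>\<omega>. (x s \<omega> - x r \<omega>)\<^sup>2)))"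
    using x(1) by (subst nn_integral_eq_integral) auto
  also have "\<dots> \<le> ennreal (\<sigma>\<^sup>2 * (K\<^sup>2 * (modulus T * (T / 2 ^ n))))"
  proof (intro ennreal_leI mult_left_mono)
    have "modulus T * (s - r) \<le> modulus T * (T / 2 ^ n)"
      using r(3) modulus_nonneg[of T] assms by (intro mult_left_mono) auto
    then show "expectation (\<lambda>\<omega>. (x s \<omega> - x r \<omega>)\<^sup>2) \<le> modulus T * (T / 2 ^ n)" using x(2) by linarith
  qed auto
  also have "\<dots> = ennreal (step_error T / 2 ^ n)" by (simp add: step_error_def mult.assoc)
  finally show ?thesis .
qed

lemma set_nn_integral_le_const:
  assumes "0 \<le> T" "0 \<le> C" "\<And>s. 0 \<le> s \<Longrightarrow> s < T \<Longrightarrow> h s \<le> ennreal C"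
  shows "(\<integral>\<^sup>+s\<in>{0..T}. h s \<partial>lborel) \<le> ennreal (T * C)"
proof -
  have ae: "AE s in lborel. s \<noteq> T" by (rule AE_lborel_singleton)
  have "(\<integral>\<^sup>+s\<in>{0..T}. h s \<partial>lborel) \<le> (\<integral>\<^sup>+s. ennreal C * indicator {0..T} s \<partial>lborel)"
  proof (rule nn_integral_mono_AE)
    show "AE s in lborel. h s * indicator {0..T} s \<le> ennreal C * indicator {0..T} s"
      using ae by eventually_elim (use assms in \<open>auto simp: indicator_def\<close>)
  qed
  also have "\<dots> = ennreal (T * C)"
    using assms by (simp add: nn_integral_cmult_indicator mult.commute flip: ennreal_mult)
  finally show ?thesis .
qed

text \<open>By the isometry it suffices to compare the two step processes at each time, and both are
  close to the common integrand \<open>g (x s) * \<sigma>\<close>.\<close>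

lemma Ito_sum_Cauchy:
  assumes T: "0 \<le> T"
  shows "(\<integral>\<^sup>+\<omega>. ennreal ((Ito_sum g T m \<omega> - Ito_sum g T n \<omega>)\<^sup>2) \<partial>M)
    \<le> ennreal (T * (2 * (step_error T / 2 ^ m) + 2 * (step_error T / 2 ^ n)))"
  unfolding Ito_sum_def simple_isometry_diff[OF simple_family_Ito[OF T] simple_family_Ito[OF T]] Ito_step_def[symmetric]
proof (rule set_nn_integral_le_const[OF T])
  show "0 \<le> 2 * (step_error T / 2 ^ m) + 2 * (step_error T / 2 ^ n)" using step_error_nonneg[OF T] by simp
  fix s assume s: "0 \<le> s" "s < T"
  have [measurable]: "Ito_step g T k s \<in> borel_measurable M" for k
  proof -
    obtain r where r: "0 \<le> r" "\<And>\<omega>. Ito_step g T k s \<omega> = g (x r \<omega>) * \<sigma>"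
      using Ito_step_eq[OF s] by blast
    from r(2) have "Ito_step g T k s = (\<lambda>\<omega>. g (x r \<omega>) * \<sigma>)" by auto
    then show ?thesis using r(1) by simp
  qed
  have "(\<integral>\<^sup>+\<omega>. ennreal ((Ito_step g T m s \<omega> - Ito_step g T n s \<omega>)\<^sup>2) \<partial>M)
      = (\<integral>\<^sup>+\<omega>. ennreal ((- (g (x s \<omega>) * \<sigma> - Ito_step g T m s \<omega>) + (g (x s \<omega>) * \<sigma> - Ito_step g T n s \<omega>))\<^sup>2) \<partial>M)"
    by simp
  also have "\<dots> \<le> 2 * (\<integral>\<^sup>+\<omega>. ennreal ((- (g (x s \<omega>) * \<sigma> - Ito_step g T m s \<omega>))\<^sup>2) \<partial>M)
      + 2 * (\<integral>\<^sup>+\<omega>. ennreal ((g (x s \<omega>) * \<sigma> - Ito_step g T n s \<omega>)\<^sup>2) \<partial>M)"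
    using s by (intro nn_integral_square_add_le) auto
  also have "\<dots> \<le> 2 * ennreal (step_error T / 2 ^ m) + 2 * ennreal (step_error T / 2 ^ n)"
    unfolding power2_minus by (intro add_mono mult_left_mono Ito_step_error s) auto
  also have "\<dots> = ennreal (2 * (step_error T / 2 ^ m) + 2 * (step_error T / 2 ^ n))"
    using step_error_nonneg[OF T]
    by (subst (1 2) numeral_mult_ennreal, simp, simp, subst ennreal_plus) auto
  finally show "(\<integral>\<^sup>+\<omega>. ennreal ((Ito_step g T m s \<omega> - Ito_step g T n s \<omega>)\<^sup>2) \<partial>M)
    \<le> ennreal (2 * (step_error T / 2 ^ m) + 2 * (step_error T / 2 ^ n))" .
qed

lemma Ito_sum_AE_tendsto:
  assumes T: "0 \<le> T" and I: "has_ito_integral M F z T (\<lambda>s \<omega>. g (x s \<omega>) * \<sigma>) I"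
  shows "AE \<omega> in M. (\<lambda>n. Ito_sum g T n \<omega>) \<longlonglongrightarrow> I \<omega>"
proof (rule AE_tendsto_if_square_summable[where C = "4 * (T * step_error T)"])
  show "I \<in> borel_measurable M" using I by (simp add: has_ito_integral_def)
  show "0 \<le> 4 * (T * step_error T)" using T step_error_nonneg[OF T] by simp
  fix n
  have "(\<integral>\<^sup>+\<omega>. ennreal ((I \<omega> - Ito_sum g T n \<omega>)\<^sup>2) \<partial>M)
      \<le> 4 * (\<integral>\<^sup>+s\<in>{0..T}. (\<integral>\<^sup>+\<omega>. ennreal ((g (x s \<omega>) * \<sigma> - Ito_step g T n s \<omega>)\<^sup>2) \<partial>M) \<partial>lborel)"
    unfolding Ito_sum_def Ito_step_def by (rule Ito_integral_approx[OF I simple_family_Ito[OF T]])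
  also have "\<dots> \<le> 4 * ennreal (T * (step_error T / 2 ^ n))"
    using step_error_nonneg[OF T] by (intro mult_left_mono set_nn_integral_le_const T Ito_step_error) auto
  also have "\<dots> = ennreal (4 * (T * step_error T) / 2 ^ n)"
    using T step_error_nonneg[OF T] by (subst numeral_mult_ennreal) auto
  finally show "(\<integral>\<^sup>+\<omega>. ennreal ((I \<omega> - Ito_sum g T n \<omega>)\<^sup>2) \<partial>M) \<le> ennreal (4 * (T * step_error T) / 2 ^ n)" .
qed (use T in auto)

text \<open>For differences of integrands the limit is known only almost surely. Fatou's lemma in
  the first index of the Cauchy estimate recovers the mean-square error.\<close>

lemma Ito_sum_limit:
  assumes T: "0 \<le> T" and R [measurable]: "R \<in> borel_measurable M"
    and lim: "AE \<omega> in M. (\<lambda>n. Ito_sum g T n \<omega>) \<longlonglongrightarrow> R \<omega>"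
  shows "(\<integral>\<^sup>+\<omega>. ennreal ((R \<omega> - Ito_sum g T n \<omega>)\<^sup>2) \<partial>M) \<le> ennreal (4 * T * step_error T / 2 ^ n)"
proof -
  have "(\<integral>\<^sup>+\<omega>. ennreal ((R \<omega> - Ito_sum g T n \<omega>)\<^sup>2) \<partial>M)
      = (\<integral>\<^sup>+\<omega>. liminf (\<lambda>m. ennreal ((Ito_sum g T m \<omega> - Ito_sum g T n \<omega>)\<^sup>2)) \<partial>M)"
  proof (rule nn_integral_cong_AE)
    show "AE \<omega> in M. ennreal ((R \<omega> - Ito_sum g T n \<omega>)\<^sup>2) = liminf (\<lambda>m. ennreal ((Ito_sum g T m \<omega> - Ito_sum g T n \<omega>)\<^sup>2))"
      using lim
    proof eventually_elim
      case (elim \<omega>)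
      then have "(\<lambda>m. ennreal ((Ito_sum g T m \<omega> - Ito_sum g T n \<omega>)\<^sup>2)) \<longlonglongrightarrow> ennreal ((R \<omega> - Ito_sum g T n \<omega>)\<^sup>2)"
        by (intro tendsto_intros)
      from lim_imp_Liminf[OF trivial_limit_sequentially this] show ?case by (rule sym)
    qed
  qed
  also have "\<dots> \<le> liminf (\<lambda>m. \<integral>\<^sup>+\<omega>. ennreal ((Ito_sum g T m \<omega> - Ito_sum g T n \<omega>)\<^sup>2) \<partial>M)"
    using T by (intro nn_integral_liminf) auto
  also have "\<dots> \<le> ennreal (4 * T * step_error T / 2 ^ n)"
  proof (rule Liminf_le)
    show "\<forall>\<^sub>F m in sequentially. (\<integral>\<^sup>+\<omega>. ennreal ((Ito_sum g T m \<omega> - Ito_sum g T n \<omega>)\<^sup>2) \<partial>M) \<le> ennreal (4 * T * step_error T / 2 ^ n)"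
      using eventually_ge_at_top[of n]
    proof eventually_elim
      case (elim m)
      \<comment> \<open>For m \<ge> n the finer mesh has the smaller error, so the two terms with
        factor 2 merge into one with factor 4.\<close>
      have "step_error T / 2 ^ m \<le> step_error T / 2 ^ n"
        using elim step_error_nonneg[OF T] by (intro divide_left_mono power_increasing) auto
      then have "T * (2 * (step_error T / 2 ^ m) + 2 * (step_error T / 2 ^ n)) \<le> T * (4 * (step_error T / 2 ^ n))"
        using T by (intro mult_left_mono) auto
      then show ?case
        using order_trans[OF Ito_sum_Cauchy[OF T] ennreal_leI] by (simp add: mult_ac)
    qed
  qed simp
  finally show ?thesis .
qed

end

section \<open>Ito's formula for functions of the mispricing\<close>

context ou
begin

text \<open>The bound on \<open>V2\<close> makes \<open>V2 (x s)\<close> an admissible weight for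
  the quadratic variation, so both hypotheses of the pathwise formula hold almost surely.\<close>

lemma Ito_sum_AE_tendsto_Ito_formula:
  assumes T: "0 \<le> T"
    and V: "\<And>y. (V has_real_derivative V1 y) (at y)" "\<And>y. (V1 has_real_derivative V2 y) (at y)"
    and V2: "continuous_on UNIV V2" "\<And>y. \<bar>V2 y\<bar> \<le> C"
  shows "AE \<omega> in M. (\<lambda>n. Ito_sum V1 T n \<omega>) \<longlonglongrightarrow>
    V (x T \<omega>) - V (x 0 \<omega>) - integral {0..T} (\<lambda>s. - \<alpha> * x s \<omega> * V1 (x s \<omega>) + \<sigma>\<^sup>2 / 2 * V2 (x s \<omega>))"
proof -
  have "AE \<omega> in M. (\<lambda>n. \<Sum>i<2^n. 1 * ((dz (mesh 0 T n i) (mesh 0 T n (Suc i)) \<omega>)\<^sup>2 - (T - 0) / 2 ^ n)) \<longlonglongrightarrow> 0"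
    by (rule AE_weighted_quadratic_variation_tendsto_0[OF T, where C = 1]) auto
  moreover have "AE \<omega> in M. (\<lambda>n. \<Sum>i<2^n. V2 (x (mesh 0 T n i) \<omega>) * ((dz (mesh 0 T n i) (mesh 0 T n (Suc i)) \<omega>)\<^sup>2 - (T - 0) / 2 ^ n)) \<longlonglongrightarrow> 0"
    using borel_measurable_continuous_onI[OF V2(1)] mesh_ge[OF T] V2(2)
    by (intro AE_weighted_quadratic_variation_tendsto_0[OF T]) (auto intro: measurable_compose[OF x_F])
  ultimately show ?thesis
    using AE_ou_path[OF order_refl T]
  proof eventually_elim
    case (elim \<omega>)
    interpret ou_path 0 T \<alpha> \<sigma> "\<lambda>s. x s \<omega>" "\<lambda>s. z s \<omega>" by fact
    show ?case
      unfolding Ito_sum_eq using elim(1,2) by (intro Ito_sum_tendsto V V2(1)) simp_all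
  qed
qed

text \<open>Subtracting Ito's formula for \<open>V\<close> removes the drift of \<open>u\<close> up to the constant rate \<open>c\<close>.\<close>

lemma log_wealth_decomposition:
  assumes T: "0 \<le> T" and u: "log_wealth_process M F z \<alpha> \<sigma> x f u"
    and f: "\<And>p q. \<bar>f p - f q\<bar> \<le> K * \<bar>p - q\<bar>"
    and V: "\<And>y. (V has_real_derivative V1 y) (at y)" "\<And>y. (V1 has_real_derivative V2 y) (at y)"
    and V2: "continuous_on UNIV V2" "\<And>y. \<bar>V2 y\<bar> \<le> C"
    and generator: "\<And>y. - \<alpha> * y * V1 y + \<sigma>\<^sup>2 / 2 * V2 y = f y * (- \<alpha> * y) + c"
  shows "AE \<omega> in M. (\<lambda>n. Ito_sum (\<lambda>y. f y - V1 y) T n \<omega>) \<longlonglongrightarrow>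
    u T \<omega> - u 0 \<omega> - (V (x T \<omega>) - V (x 0 \<omega>)) + c * T"
proof -
  interpret f: ou_lipschitz M F z \<alpha> \<sigma> x f K
    by unfold_locales (rule f)
  from u T obtain I where I: "has_ito_integral M F z T (\<lambda>s \<omega>. f (x s \<omega>) * \<sigma>) I"
    and int: "AE \<omega> in M. set_integrable lborel {0..T} (\<lambda>s. f (x s \<omega>) * (- \<alpha> * x s \<omega>))"
    and uT: "AE \<omega> in M. u T \<omega> = u 0 \<omega> + (LINT s:{0..T}|lborel. f (x s \<omega>) * (- \<alpha> * x s \<omega>)) + I \<omega>"
    by (auto simp: log_wealth_process_def ito_process_def)
  show ?thesis
    using f.Ito_sum_AE_tendsto[OF T I] Ito_sum_AE_tendsto_Ito_formula[OF T V V2] int uT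
  proof eventually_elim
    case (elim \<omega>)
    note J = set_borel_integral_eq_integral[OF elim(3)]
    \<comment> \<open>Integrating the generator equation along the path: the drift of
      \<open>V\<close> is the drift of \<open>u\<close> plus \<open>c\<close>.\<close>
    have "integral {0..T} (\<lambda>s. - \<alpha> * x s \<omega> * V1 (x s \<omega>) + \<sigma>\<^sup>2 / 2 * V2 (x s \<omega>))
        = integral {0..T} (\<lambda>s. f (x s \<omega>) * (- \<alpha> * x s \<omega>)) + c * T"
      unfolding generator using J(1) T by (subst Henstock_Kurzweil_Integration.integral_add) auto
    then have "u T \<omega> - u 0 \<omega> - (V (x T \<omega>) - V (x 0 \<omega>)) + c * T = I \<omega> - (V (x T \<omega>) - V (x 0 \<omega>)
        - integral {0..T} (\<lambda>s. - \<alpha> * x s \<omega> * V1 (x s \<omega>) + \<sigma>\<^sup>2 / 2 * V2 (x s \<omega>)))"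
      using elim(4) J(2) by linarith
    then show ?case
      unfolding Ito_sum_diff using tendsto_diff[OF elim(1,2)] by (simp only:)
  qed
qed

end

section \<open>The Poisson equation\<close>

lemma has_real_derivative_normal_density:
  "s > 0 \<Longrightarrow> (normal_density 0 s has_real_derivative - (y / s\<^sup>2) * normal_density 0 s y) (at y)"
  unfolding normal_density_def
  by (auto intro!: derivative_eq_intros simp: field_simps power2_eq_square)

lemma normal_density_tendsto_0:
  assumes "s > 0"
  shows "(normal_density 0 s \<longlongrightarrow> 0) at_top"
proof -
  have "filterlim (\<lambda>y::real. 1 / (2 * s\<^sup>2) * y\<^sup>2) at_top at_top"
    using assms by (intro filterlim_tendsto_pos_mult_at_top[OF tendsto_const] filterlim_pow_at_top filterlim_ident) auto
  then have "filterlim (\<lambda>y::real. - (1 / (2 * s\<^sup>2) * y\<^sup>2)) at_bot at_top"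
    by (simp add: filterlim_uminus_at_top)
  from tendsto_mult_left[OF filterlim_compose[OF exp_at_bot this], of "1 / sqrt (2 * pi * s\<^sup>2)"]
  show ?thesis by (simp add: normal_density_def[abs_def])
qed

text \<open>The classical Gaussian tail estimate: beyond \<open>x\<close> the factor y / x is at
  least 1, and y times the density has an elementary primitive. A general set \<open>S\<close>
  covers closed and open half-lines, the latter arising by reflection.\<close>

lemma normal_tail_bound:
  fixes h :: "real \<Rightarrow> real"
  assumes s: "s > 0" and x: "x > 0" and S: "S \<subseteq> {x..}" "S \<in> sets borel"
    and h: "integrable lborel h" "\<And>y. \<bar>h y\<bar> \<le> \<kappa> * normal_density 0 s y"
  shows "\<bar>LINT y:S|lborel. h y\<bar> \<le> \<kappa> * s\<^sup>2 * normal_density 0 s x / x"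
proof -
  let ?\<phi> = "normal_density 0 s"
  have \<kappa>: "\<kappa> \<ge> 0"
    using order_trans[OF abs_ge_zero h(2)[of 0]] normal_density_pos[OF s, of 0 0] by (simp add: zero_le_mult_iff)
  let ?F = "\<lambda>y. - (\<kappa> * s\<^sup>2 / x) * ?\<phi> y"
  have F: "(?F has_real_derivative \<kappa> * (y / x) * ?\<phi> y) (at y)" for y
    using DERIV_cmult[OF has_real_derivative_normal_density[OF s], of "- (\<kappa> * s\<^sup>2 / x)" y] s
    by (simp add: field_simps)
  have "ennreal \<bar>LINT y:S|lborel. h y\<bar> \<le> (\<integral>\<^sup>+y. norm (indicator S y *\<^sub>R h y) \<partial>lborel)"
    unfolding set_lebesgue_integral_def using h(1) S(2)
    by (metis integral_norm_bound_ennreal integrable_mult_indicator real_norm_def sets_lborel)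
  also have "\<dots> \<le> (\<integral>\<^sup>+y. ennreal (\<kappa> * (y / x) * ?\<phi> y) * indicator {x..} y \<partial>lborel)"
  proof (intro nn_integral_mono)
    fix y :: real
    have "\<bar>h y\<bar> \<le> \<kappa> * (y / x) * ?\<phi> y" if "x \<le> y"
    proof -
      have "\<kappa> * 1 \<le> \<kappa> * (y / x)"
        using that x \<kappa> by (intro mult_left_mono) auto
      then have "\<kappa> * ?\<phi> y \<le> \<kappa> * (y / x) * ?\<phi> y"
        by (intro mult_right_mono) auto
      with h(2)[of y] show ?thesis by linarith
    qed
    then show "ennreal (norm (indicator S y *\<^sub>R h y)) \<le> ennreal (\<kappa> * (y / x) * ?\<phi> y) * indicator {x..} y"
      using S(1) by (auto simp: indicator_def subset_iff intro!: ennreal_leI)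
  qed
  also have "\<dots> = ennreal (0 - ?F x)"
  proof (rule nn_integral_FTC_atLeast[where F = ?F])
    show "(?F \<longlongrightarrow> 0) at_top"
      using tendsto_mult_left[OF normal_density_tendsto_0[OF s], of "- (\<kappa> * s\<^sup>2 / x)"] by simp
    show "0 \<le> \<kappa> * (y / x) * ?\<phi> y" if "x \<le> y" for y
      using that x \<kappa> by (intro mult_nonneg_nonneg) auto
  qed (use F in auto)
  finally show ?thesis
    using \<kappa> x by (subst (asm) ennreal_le_iff) (auto intro!: mult_nonneg_nonneg)
qed

lemma has_real_derivative_set_integral_lessThan:
  fixes h :: "real \<Rightarrow> real"
  assumes h: "integrable lborel h" "continuous_on UNIV h"
  shows "((\<lambda>x. LINT y:{..<x}|lborel. h y) has_real_derivative h x) (at x)"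
proof -
  \<comment> \<open>Near \<open>x\<close> only the integral over a compact window varies; the part
    below the window is constant.\<close>
  define a where "a = x - 1"
  define b where "b = x + 1"
  have si: "set_integrable lborel A h" if "A \<in> sets borel" for A
    unfolding set_integrable_def using h(1) that by (intro integrable_mult_indicator) auto
  have eq: "(LINT y:{..<a}|lborel. h y) + integral {a..u} h = (LINT y:{..<u}|lborel. h y)" if u: "u \<in> {a..b}" for u
  proof -
    have "(LINT y:{a..u}|lborel. h y) = (LINT y:{a..<u}|lborel. h y)"
      unfolding set_lebesgue_integral_def
    proof (rule integral_cong_AE)
      have "AE y in lborel. y \<noteq> u" by (rule AE_lborel_singleton)
      then show "AE y in lborel. indicator {a..u} y *\<^sub>R h y = indicator {a..<u} y *\<^sub>R h y"
        by eventually_elim (auto simp: indicator_def)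
    qed (use si[of "{a..u}"] si[of "{a..<u}"] in \<open>auto simp: set_integrable_def\<close>)
    then have "integral {a..u} h = (LINT y:{a..<u}|lborel. h y)"
      using set_borel_integral_eq_integral(2)[OF si[of "{a..u}"]] by simp
    moreover have "{..<u} = {..<a} \<union> {a..<u}" using u by auto
    moreover have "(LINT y:{..<a} \<union> {a..<u}|lborel. h y) = (LINT y:{..<a}|lborel. h y) + (LINT y:{a..<u}|lborel. h y)"
      by (intro set_integral_Un si) auto
    ultimately show ?thesis by simp
  qed
  have "((\<lambda>u. (LINT y:{..<a}|lborel. h y) + integral {a..u} h) has_real_derivative h x) (at x within {a..b})"
    using integral_has_real_derivative[of a b h x] continuous_on_subset[OF h(2)]
    by (auto intro!: derivative_eq_intros simp: a_def b_def)
  then have "((\<lambda>u. (LINT y:{..<a}|lborel. h y) + integral {a..u} h) has_real_derivative h x) (at x)"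
    by (subst (asm) at_within_Icc_at) (auto simp: a_def b_def)
  then show ?thesis
    by (rule has_field_derivative_transform_within[where d = 1], simp, simp, intro eq)
      (auto simp: a_def b_def dist_real_def)
qed

text \<open>With \<open>\<phi>\<close> the stationary density and \<open>m\<close> the stationary mean of \<open>f'\<close>, the equation for
  \<open>r = f - V1\<close> reads \<open>(r \<phi>)' = (f' - m) \<phi>\<close>. The right-hand side has integral \<open>0\<close>, so its
  primitive \<open>\<Phi>\<close> is as small as the Gaussian tails on both sides, and \<open>y r y\<close> stays bounded.\<close>

lemma Poisson_equation:
  fixes f D :: "real \<Rightarrow> real"
  assumes \<alpha>: "\<alpha> > 0" and \<sigma>: "\<sigma> > 0"
    and f: "\<And>y. (f has_real_derivative D y) (at y)"
    and D: "continuous_on UNIV D" "\<And>y. \<bar>D y\<bar> \<le> K"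
  obtains V V1 V2 c C where "\<And>y. (V has_real_derivative V1 y) (at y)" "\<And>y. (V1 has_real_derivative V2 y) (at y)"
    "continuous_on UNIV V2" "\<And>y. \<bar>V2 y\<bar> \<le> C"
    "\<And>y. - \<alpha> * y * V1 y + \<sigma>\<^sup>2 / 2 * V2 y = f y * (- \<alpha> * y) + c"
    "(\<forall>y. f y = V1 y) \<longrightarrow> (\<forall>y. D y = D 0)"
proof -
  \<comment> \<open>The stationary standard deviation.\<close>
  define s where "s = \<sigma> / sqrt (2 * \<alpha>)"
  have s: "s > 0" and s2: "s\<^sup>2 = \<sigma>\<^sup>2 / (2 * \<alpha>)"
    using \<alpha> \<sigma> by (auto simp: s_def power_divide)
  define \<phi> where "\<phi> = normal_density 0 s"
  have \<phi>pos: "\<phi> y > 0" for y using normal_density_pos[OF s] by (simp add: \<phi>_def)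
  have d\<phi>: "(\<phi> has_real_derivative - (y / s\<^sup>2) * \<phi> y) (at y)" for y
    unfolding \<phi>_def by (rule has_real_derivative_normal_density[OF s])
  have \<phi>int: "integrable lborel \<phi>" "(LINT y|lborel. \<phi> y) = 1"
    using s by (auto simp: \<phi>_def)
  have \<phi>even: "\<phi> (- y) = \<phi> y" for y by (simp add: \<phi>_def normal_density_def)
  have \<phi>c: "continuous_on UNIV \<phi>"
    using d\<phi> by (intro DERIV_continuous_on) (auto intro: DERIV_subset)
  have Dint: "integrable lborel (\<lambda>y. D y * \<phi> y)"
  proof (rule Bochner_Integration.integrable_bound[of _ "\<lambda>y. K * \<phi> y"])
    show "(\<lambda>y. D y * \<phi> y) \<in> borel_measurable lborel"
      using borel_measurable_continuous_onI[OF continuous_on_mult[OF D(1) \<phi>c]] by simp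
    show "AE y in lborel. norm (D y * \<phi> y) \<le> norm (K * \<phi> y)"
      using D(2) \<phi>pos by (intro AE_I2) (auto simp: abs_mult intro!: mult_right_mono order_trans[OF D(2)])
  qed (use \<phi>int in auto)
  \<comment> \<open>Subtracting the stationary mean gives \<open>h\<close> total integral 0, without
    which its primitive would not decay on the right.\<close>
  define m where "m = (LINT y|lborel. D y * \<phi> y)"
  define h where "h = (\<lambda>y. (D y - m) * \<phi> y)"
  define \<kappa> where "\<kappa> = K + \<bar>m\<bar>"
  have hint: "integrable lborel h" "(LINT y|lborel. h y) = 0"
    using Dint \<phi>int by (simp_all add: h_def left_diff_distrib m_def)
  have hc: "continuous_on UNIV h"
    unfolding h_def by (intro continuous_intros D(1) \<phi>c)
  have k\<kappa>: "\<bar>D y - m\<bar> \<le> \<kappa>" for y using D(2)[of y] by (simp add: \<kappa>_def)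
  have h_le: "\<bar>h y\<bar> \<le> \<kappa> * \<phi> y" for y
    using k\<kappa>[of y] \<phi>pos[of y] by (simp add: h_def abs_mult mult_right_mono)
  have \<kappa>0: "\<kappa> \<ge> 0" using k\<kappa>[of 0] by linarith
  define \<Phi> where "\<Phi> = (\<lambda>x. LINT y:{..<x}|lborel. h y)"
  have d\<Phi>: "(\<Phi> has_real_derivative h y) (at y)" for y
    unfolding \<Phi>_def by (rule has_real_derivative_set_integral_lessThan[OF hint(1) hc])
  have \<Phi>_le: "\<bar>y * \<Phi> y\<bar> \<le> \<kappa> * s\<^sup>2 * \<phi> y" for y
  proof -
    consider "y = 0" | "y > 0" | "y < 0" by linarith
    then show ?thesis
    proof cases
      case 1
      then show ?thesis using \<kappa>0 \<phi>pos[of 0] by simp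
    next
      case 2
      have si: "set_integrable lborel A h" if "A \<in> sets borel" for A
        unfolding set_integrable_def using hint(1) that by (intro integrable_mult_indicator) auto
      \<comment> \<open>For positive \<open>y\<close> the primitive equals minus the upper tail,
        because the total integral is 0.\<close>
      have "(LINT v:{..<y} \<union> {y..}|lborel. h v) = \<Phi> y + (LINT v:{y..}|lborel. h v)"
        unfolding \<Phi>_def by (intro set_integral_Un si) auto
      moreover have "{..<y} \<union> {y..} = (UNIV :: real set)" by auto
      ultimately have "\<Phi> y = - (LINT v:{y..}|lborel. h v)"
        using hint(2) by (simp add: set_lebesgue_integral_def)
      then have "\<bar>\<Phi> y\<bar> \<le> \<kappa> * s\<^sup>2 * \<phi> y / y"
        using normal_tail_bound[OF s 2, of "{y..}" h \<kappa>] hint(1) h_le by (simp add: \<phi>_def)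
      then show ?thesis using 2 by (simp add: abs_mult field_simps)
    next
      case 3
      \<comment> \<open>For negative \<open>y\<close> the lower tail is reflected to an upper one;
        the density is even.\<close>
      have "\<Phi> y = (LINT v:{v. - v \<in> {..<y}}|lborel. h (- v))"
        unfolding \<Phi>_def by (rule set_integral_reflect)
      also have "{v. - v \<in> {..<y}} = {- y<..}" by auto
      finally have "\<Phi> y = (LINT v:{- y<..}|lborel. h (- v))" .
      moreover have "{- y<..} \<subseteq> {- y..}" by auto
      moreover have "integrable lborel (\<lambda>v. h (- v))"
        using lborel_integrable_real_affine[OF hint(1), of "- 1" 0] by simp
      ultimately have "\<bar>\<Phi> y\<bar> \<le> \<kappa> * s\<^sup>2 * \<phi> (- y) / (- y)"
        using normal_tail_bound[OF s, of "- y" "{- y<..}" "\<lambda>v. h (- v)" \<kappa>] 3 h_le[of "- v" for v] \<phi>even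
        by (auto simp: \<phi>_def[symmetric])
      then show ?thesis using 3 by (simp add: abs_mult \<phi>even field_simps)
    qed
  qed
  define r where "r = (\<lambda>y. \<Phi> y / \<phi> y)"
  have dr: "(r has_real_derivative D y - m + y / s\<^sup>2 * r y) (at y)" for y
    unfolding r_def using \<phi>pos[of y]
    by (auto intro!: derivative_eq_intros d\<Phi> d\<phi> simp: h_def field_simps power2_eq_square)
  have rc: "continuous_on UNIV r"
    using dr by (intro DERIV_continuous_on) (auto intro: DERIV_subset)
  have fc: "continuous_on UNIV f"
    using f by (intro DERIV_continuous_on) (auto intro: DERIV_subset)
  have yr: "\<bar>y / s\<^sup>2 * r y\<bar> \<le> \<kappa>" for y
    using \<Phi>_le[of y] \<phi>pos[of y] s by (simp add: r_def abs_mult field_simps)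
  define V1 where "V1 = (\<lambda>y. f y - r y)"
  \<comment> \<open>This is f' - r': the derivative of \<open>f\<close> cancels, and what remains is
    bounded by \<open>yr\<close>.\<close>
  define V2 where "V2 = (\<lambda>y. m - y / s\<^sup>2 * r y)"
  have V1c: "continuous_on UNIV V1" unfolding V1_def by (intro continuous_intros fc rc)
  obtain V where V: "\<And>y. (V has_real_derivative V1 y) (at y)"
  proof -
    obtain V where "\<forall>y::real. - \<infinity> < ereal y \<longrightarrow> ereal y < \<infinity> \<longrightarrow> (V has_vector_derivative V1 y) (at y)"
      using einterval_antiderivative[of "- \<infinity>" \<infinity> V1] V1c by (auto simp: continuous_on_eq_continuous_at)
    then show ?thesis by (intro that[of V]) (simp add: has_real_derivative_iff_has_vector_derivative)
  qed
  show thesis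
  \<comment> \<open>The terms with \<open>r\<close> cancel in the generator because \<sigma>^2 / (2
    s^2) = \<alpha>, which leaves the constant \<sigma>^2 m / 2.\<close>
  proof (rule that[of V V1 V2 "\<bar>m\<bar> + \<kappa>" "\<sigma>\<^sup>2 / 2 * m"])
    show "(V has_real_derivative V1 y) (at y)" for y by (rule V)
    show "(V1 has_real_derivative V2 y) (at y)" for y
      unfolding V1_def V2_def by (auto intro!: derivative_eq_intros f dr)
    show "continuous_on UNIV V2"
      unfolding V2_def using s by (intro continuous_intros rc) auto
    show "\<bar>V2 y\<bar> \<le> \<bar>m\<bar> + \<kappa>" for y
      unfolding V2_def using yr[of y] by linarith
    show "- \<alpha> * y * V1 y + \<sigma>\<^sup>2 / 2 * V2 y = f y * (- \<alpha> * y) + \<sigma>\<^sup>2 / 2 * m" for y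
      using \<alpha> \<sigma> by (simp add: V1_def V2_def s2 field_simps)
    show "(\<forall>y. f y = V1 y) \<longrightarrow> (\<forall>y. D y = D 0)"
    proof
      assume "\<forall>y. f y = V1 y"
      then have "r = (\<lambda>_. 0)" by (auto simp: V1_def)
      \<comment> \<open>If \<open>r\<close> vanishes identically, so does its derivative, and the
        equation for \<open>r\<close> reduces to f' = m.\<close>
      then have "D y - m = 0" for y
        using DERIV_unique[OF dr[of y]] by (metis DERIV_const mult_zero_right add.right_neutral)
      then show "\<forall>y. D y = D 0" by (metis eq_iff_diff_eq_0)
    qed
  qed
qed

section \<open>Growth of the stochastic integral\<close>

lemma lipschitz_if_derivative_bounded:
  fixes f D :: "real \<Rightarrow> real"
  assumes "\<And>y. (f has_real_derivative D y) (at y)" "\<And>y. \<bar>D y\<bar> \<le> K"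
  shows "\<bar>f p - f q\<bar> \<le> K * \<bar>p - q\<bar>"
  using field_differentiable_bound[of UNIV f D K p q] assms by simp

lemma integrable_square_if_nn_integral_le:
  fixes X :: "'a \<Rightarrow> real"
  assumes [measurable]: "X \<in> borel_measurable M" and c: "c \<ge> 0" and le: "(\<integral>\<^sup>+\<omega>. ennreal ((X \<omega>)\<^sup>2) \<partial>M) \<le> ennreal c"
  shows "integrable M (\<lambda>\<omega>. (X \<omega>)\<^sup>2)" "(LINT \<omega>|M. (X \<omega>)\<^sup>2) \<le> c"
proof -
  show int: "integrable M (\<lambda>\<omega>. (X \<omega>)\<^sup>2)"
    using le by (intro integrableI_bounded) (auto intro: le_less_trans)
  show "(LINT \<omega>|M. (X \<omega>)\<^sup>2) \<le> c"
    using le c by (subst (asm) nn_integral_eq_integral[OF int]) auto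
qed

lemma (in prob_space) expectation_square_le:
  fixes X :: "'a \<Rightarrow> real"
  assumes "X \<in> borel_measurable M" "integrable M (\<lambda>\<omega>. (X \<omega>)\<^sup>2)"
  shows "(expectation X)\<^sup>2 \<le> expectation (\<lambda>\<omega>. (X \<omega>)\<^sup>2)"
  using variance_eq[OF square_integrable_imp_integrable[OF assms] assms(2)] variance_positive[of X] by simp

text \<open>The bound depends on the variance only through \<open>v0\<close>: the upper bound on
  \<open>v\<close> controls the normalizing factor, the lower bound the exponent.\<close>

lemma (in normal_indep) prob_interval_ge:
  assumes v0: "v0 / 2 \<le> v" "v \<le> v0" and d: "d > 0"
  shows "2 * d * (1 / sqrt (2 * pi * v0) * exp (- (\<bar>p\<bar> + d)\<^sup>2 / v0)) \<le> prob (X -` {p - d<..<p + d} \<inter> space M)"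
proof -
  define c where "c = 1 / sqrt (2 * pi * v0) * exp (- (\<bar>p\<bar> + d)\<^sup>2 / v0)"
  have v0pos: "v0 > 0" using v v0 by linarith
  then have c0: "c \<ge> 0" by (simp add: c_def)
  have c_le: "c \<le> normal_density 0 (sqrt v) y" if "y \<in> {p - d<..<p + d}" for y
  proof -
    have "\<bar>y\<bar> \<le> \<bar>p\<bar> + d" using that by auto
    then have "y\<^sup>2 \<le> (\<bar>p\<bar> + d)\<^sup>2" using d by (simp add: abs_le_square_iff[symmetric])
    then have "y\<^sup>2 / (2 * v) \<le> (\<bar>p\<bar> + d)\<^sup>2 / v0" using v0 v0pos v by (intro frac_le) auto
    moreover have "1 / sqrt (2 * pi * v0) \<le> 1 / sqrt (2 * pi * v)" using v v0 by (intro divide_left_mono) auto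
    ultimately show ?thesis
      unfolding c_def normal_density_def using v by (intro mult_mono) auto
  qed
  have "ennreal (2 * d * c) = (\<integral>\<^sup>+y. ennreal c * indicator {p - d<..<p + d} y \<partial>lborel)"
    using c0 d by (subst nn_integral_cmult_indicator) (auto simp: mult.commute simp flip: ennreal_mult)
  also have "\<dots> \<le> (\<integral>\<^sup>+y. ennreal (normal_density 0 (sqrt v) y) * indicator {p - d<..<p + d} y \<partial>lborel)"
    using c_le by (intro nn_integral_mono) (auto simp: indicator_def intro!: ennreal_leI)
  also have "\<dots> = ennreal (prob (X -` {p - d<..<p + d} \<inter> space M))"
    using distributed_emeasure[OF distr, of "{p - d<..<p + d}"] by (simp add: emeasure_eq_measure)
  finally show ?thesis unfolding c_def[symmetric] by simp
qed

section \<open>Lower bounds at late times\<close>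

context ou
begin

text \<open>Near \<open>p\<close> the square of \<open>r\<close> stays above a positive constant, so
  it suffices that \<open>x s\<close> is near \<open>p\<close> with a probability bounded below.
  This happens when \<open>x 0\<close> is moderate and the innovation is near \<open>p\<close>, two
  independent events.\<close>

lemma expectation_square_bounded_below:
  fixes r :: "real \<Rightarrow> real"
  assumes r: "continuous_on UNIV r" "r p \<noteq> 0" and int: "\<And>s. 0 \<le> s \<Longrightarrow> integrable M (\<lambda>\<omega>. (r (x s \<omega>))\<^sup>2)"
  obtains t0 \<kappa> where "t0 \<ge> 0" "\<kappa> > 0" "\<And>s. s \<ge> t0 \<Longrightarrow> \<kappa> \<le> expectation (\<lambda>\<omega>. (r (x s \<omega>))\<^sup>2)"
proof -
  have rm [measurable]: "r \<in> borel_measurable borel" using r(1) by (rule borel_measurable_continuous_onI)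
  define e where "e = \<bar>r p\<bar> / 2"
  have e: "e > 0" using r(2) by (simp add: e_def)
  obtain d where d: "d > 0" "\<And>y. \<bar>y - p\<bar> < d \<Longrightarrow> \<bar>r y - r p\<bar> < e"
    using r(1) e unfolding continuous_on_iff dist_real_def by (metis UNIV_I)
  have re: "e\<^sup>2 \<le> (r y)\<^sup>2" if "\<bar>y - p\<bar> < d" for y
  proof -
    have "e \<le> \<bar>r y\<bar>" using d(2)[OF that] unfolding e_def by linarith
    then show ?thesis using e by (simp add: abs_le_square_iff[symmetric])
  qed
  define v0 where "v0 = \<sigma>\<^sup>2 / (2 * \<alpha>)"
  \<comment> \<open>The squared threshold is twice the bound for the second moment, so Markov's
    inequality leaves probability at least 1/2.\<close>
  define R0 where "R0 = sqrt (2 * (1 + fourth_bound))"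
  have B: "1 + fourth_bound > 0" using fourth_bound_nonneg by linarith
  have PA: "1 / 2 \<le> prob {\<omega>\<in>space M. \<bar>x 0 \<omega>\<bar> < R0}"
  proof -
    have "prob {\<omega>\<in>space M. 2 * (1 + fourth_bound) \<le> (x 0 \<omega>)\<^sup>2} \<le> expectation (\<lambda>\<omega>. (x 0 \<omega>)\<^sup>2) / (2 * (1 + fourth_bound))"
      using integrable_x_square[of 0] B by (intro integral_Markov_inequality_measure[where A = "space M"]) auto
    also have "\<dots> \<le> (1 + fourth_bound) / (2 * (1 + fourth_bound))"
      using expectation_x_square_le[of 0] B by (intro divide_right_mono) auto
    also have "\<dots> = 1 / 2" using B by simp
    finally have "prob {\<omega>\<in>space M. 2 * (1 + fourth_bound) \<le> (x 0 \<omega>)\<^sup>2} \<le> 1 / 2" .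
    moreover have "prob {\<omega>\<in>space M. \<not> 2 * (1 + fourth_bound) \<le> (x 0 \<omega>)\<^sup>2} = 1 - prob {\<omega>\<in>space M. 2 * (1 + fourth_bound) \<le> (x 0 \<omega>)\<^sup>2}"
      by (intro prob_neg) auto
    moreover have "{\<omega>\<in>space M. \<not> 2 * (1 + fourth_bound) \<le> (x 0 \<omega>)\<^sup>2} = {\<omega>\<in>space M. \<bar>x 0 \<omega>\<bar> < R0}"
      unfolding R0_def by (auto simp: not_le real_less_rsqrt real_sqrt_less_iff simp flip: real_sqrt_abs)
    ultimately show ?thesis by simp
  qed
  define c1 where "c1 = 2 * (d / 2) * (1 / sqrt (2 * pi * v0) * exp (- (\<bar>p\<bar> + d / 2)\<^sup>2 / v0))"
  have v0: "v0 > 0" using \<alpha> \<sigma> by (simp add: v0_def)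
  have c1: "c1 > 0" using d(1) v0 by (simp add: c1_def)
  have "((\<lambda>t. exp (- \<alpha> * t)) \<longlongrightarrow> 0) at_top"
    using \<alpha> by (intro filterlim_compose[OF exp_at_bot] filterlim_tendsto_neg_mult_at_bot[OF tendsto_const] filterlim_ident) auto
  then have lim: "((\<lambda>t. exp (- \<alpha> * t) * R0) \<longlongrightarrow> 0 * R0) at_top" "((\<lambda>t. (exp (- \<alpha> * t))\<^sup>2) \<longlongrightarrow> 0\<^sup>2) at_top"
    by (intro tendsto_intros; assumption)+
  \<comment> \<open>From \<open>t0\<close> on, a moderate \<open>x 0\<close> contributes less than d
    / 2, the innovation variance is at least half its limit \<open>v0\<close>, and \<open>t\<close>
    is positive.\<close>
  have "\<forall>\<^sub>F t in at_top. exp (- \<alpha> * t) * R0 < d / 2 \<and> (exp (- \<alpha> * t))\<^sup>2 < 1 / 2 \<and> t \<ge> 1"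
    using d(1) by (intro eventually_conj order_tendstoD(2)[OF lim(1)] order_tendstoD(2)[OF lim(2)] eventually_ge_at_top) auto
  then obtain t0 where t0: "\<And>t. t \<ge> t0 \<Longrightarrow> exp (- \<alpha> * t) * R0 < d / 2 \<and> (exp (- \<alpha> * t))\<^sup>2 < 1 / 2 \<and> t \<ge> 1"
    unfolding eventually_at_top_linorder by blast
  show thesis
  proof (rule that[of t0 "e\<^sup>2 * (1 / 2 * c1)"])
    show "t0 \<ge> 0" using t0[of t0] by simp
    show "0 < e\<^sup>2 * (1 / 2 * c1)" using e c1 by simp
    fix s assume s: "t0 \<le> s"
    note t = t0[OF s]
    interpret N: normal_indep M "F 0" "innovation 0 s" "innovation_variance s"
      using normal_indep_innovation[of 0 s] t by simp
    let ?A = "{\<omega>\<in>space M. \<bar>x 0 \<omega>\<bar> < R0}" and ?B = "innovation 0 s -` {p - d / 2<..<p + d / 2} \<inter> space M"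
    have "(exp (- \<alpha> * s))\<^sup>2 = exp (- 2 * \<alpha> * s)" by (simp add: power2_eq_square flip: exp_add)
    then have "v0 * (1 / 2) \<le> v0 * (1 - exp (- 2 * \<alpha> * s))" using t v0 by (intro mult_left_mono) auto
    then have "v0 / 2 \<le> innovation_variance s" by (simp add: innovation_variance_def v0_def)
    then have PB: "c1 \<le> prob ?B"
      unfolding c1_def using N.prob_interval_ge[of v0 "d / 2" p] innovation_variance_bound[of s] t d(1)
      by (auto simp: v0_def)
    have A: "?A \<in> sets (F 0)"
    proof -
      have "{\<omega>\<in>space (F 0). \<bar>x 0 \<omega>\<bar> < R0} \<in> sets (F 0)"
        using x_F[of 0] by measurable
      then show ?thesis using subalgebra_F[of 0] by (simp add: subalgebra_def)
    qed
    have "prob (?A \<inter> ?B) = prob ?A * prob ?B"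
      by (rule indep_setD[OF N.indep A]) (auto intro: in_vimage_algebra)
    moreover have "1 / 2 * c1 \<le> prob ?A * prob ?B"
      using PA PB c1 by (intro mult_mono) auto
    ultimately have P: "1 / 2 * c1 \<le> prob (?A \<inter> ?B)" by simp
    have AB [measurable]: "?A \<inter> ?B \<in> events" using t by measurable
    have "e\<^sup>2 * (1 / 2 * c1) \<le> e\<^sup>2 * prob (?A \<inter> ?B)" using P by (intro mult_left_mono) auto
    also have "\<dots> = expectation (\<lambda>\<omega>. e\<^sup>2 * indicator (?A \<inter> ?B) \<omega>)"
      using AB by (simp add: measure_def)
    also have "\<dots> \<le> expectation (\<lambda>\<omega>. (r (x s \<omega>))\<^sup>2)"
    proof (rule integral_mono)
      show "integrable M (\<lambda>\<omega>. e\<^sup>2 * indicator (?A \<inter> ?B) \<omega>)"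
        using AB by (intro integrable_mult_right integrable_real_indicator) (auto simp: emeasure_eq_measure)
      show "integrable M (\<lambda>\<omega>. (r (x s \<omega>))\<^sup>2)" using int t by simp
      fix \<omega> assume "\<omega> \<in> space M"
      show "e\<^sup>2 * indicator (?A \<inter> ?B) \<omega> \<le> (r (x s \<omega>))\<^sup>2"
      proof (cases "\<omega> \<in> ?A \<inter> ?B")
        case True
        have "\<bar>exp (- \<alpha> * s) * x 0 \<omega>\<bar> \<le> exp (- \<alpha> * s) * R0"
          using True by (simp add: abs_mult)
        then have "\<bar>exp (- \<alpha> * s) * x 0 \<omega>\<bar> < d / 2" using t by linarith
        moreover have "p - d / 2 < innovation 0 s \<omega>" "innovation 0 s \<omega> < p + d / 2" using True by auto
        ultimately have "\<bar>x s \<omega> - p\<bar> < d"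
          unfolding x_eq_innovation[of s] by linarith
        then show ?thesis using re[of "x s \<omega>"] True by simp
      qed simp
    qed
    finally show "e\<^sup>2 * (1 / 2 * c1) \<le> expectation (\<lambda>\<omega>. (r (x s \<omega>))\<^sup>2)" .
  qed
qed

end

context ou_lipschitz
begin

lemma expectation_Ito_sum_square_ge:
  assumes T: "0 \<le> T" and t0: "0 \<le> t0" and \<kappa>: "0 \<le> \<kappa>" "\<And>s. s \<ge> t0 \<Longrightarrow> \<kappa> \<le> expectation (\<lambda>\<omega>. (g (x s \<omega>))\<^sup>2)"
  shows "\<sigma>\<^sup>2 * \<kappa> * (T - t0 - T / 2 ^ n) \<le> expectation (\<lambda>\<omega>. (Ito_sum g T n \<omega>)\<^sup>2)"
proof (cases "t0 + T / 2 ^ n \<le> T")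
  case False
  then have "\<sigma>\<^sup>2 * \<kappa> * (T - t0 - T / 2 ^ n) \<le> 0" using \<kappa>(1) by (intro mult_nonneg_nonpos) auto
  also have "0 \<le> expectation (\<lambda>\<omega>. (Ito_sum g T n \<omega>)\<^sup>2)" by simp
  finally show ?thesis .
next
  case True
  \<comment> \<open>The step process lags by up to one cell, so the lower bound holds only one cell
    length after \<open>t0\<close>.\<close>
  have "ennreal (\<sigma>\<^sup>2 * \<kappa> * (T - t0 - T / 2 ^ n)) = (\<integral>\<^sup>+s. ennreal (\<sigma>\<^sup>2 * \<kappa>) * indicator {t0 + T / 2 ^ n..<T} s \<partial>lborel)"
    using True \<kappa>(1) by (subst nn_integral_cmult_indicator) (auto simp: diff_diff_eq simp flip: ennreal_mult)
  also have "\<dots> \<le> (\<integral>\<^sup>+s\<in>{0..T}. (\<integral>\<^sup>+\<omega>. ennreal ((Ito_step g T n s \<omega>)\<^sup>2) \<partial>M) \<partial>lborel)"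
  proof (rule nn_integral_mono)
    fix s :: real
    have "ennreal (\<sigma>\<^sup>2 * \<kappa>) \<le> (\<integral>\<^sup>+\<omega>. ennreal ((Ito_step g T n s \<omega>)\<^sup>2) \<partial>M)" "s \<in> {0..T}" if s: "s \<in> {t0 + T / 2 ^ n..<T}"
    proof -
      have h: "0 \<le> T / 2 ^ n" using T by simp
      show "s \<in> {0..T}" using s t0 h by (simp only: atLeastAtMost_iff atLeastLessThan_iff) linarith
      then obtain q where q: "0 \<le> q" "q \<le> s" "s \<le> q + T / 2 ^ n" "\<And>\<omega>. Ito_step g T n s \<omega> = g (x q \<omega>) * \<sigma>"
        using Ito_step_eq[of s T n g] s by auto
      have "t0 \<le> q" using q(3) s by (simp only: atLeastLessThan_iff) linarith
      then have "\<sigma>\<^sup>2 * \<kappa> \<le> \<sigma>\<^sup>2 * expectation (\<lambda>\<omega>. (g (x q \<omega>))\<^sup>2)"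
        by (intro mult_left_mono \<kappa>(2)) auto
      also have "\<dots> = expectation (\<lambda>\<omega>. (g (x q \<omega>) * \<sigma>)\<^sup>2)"
        by (simp add: power_mult_distrib mult.commute)
      finally have "\<sigma>\<^sup>2 * \<kappa> \<le> expectation (\<lambda>\<omega>. (g (x q \<omega>) * \<sigma>)\<^sup>2)" .
      then have "ennreal (\<sigma>\<^sup>2 * \<kappa>) \<le> ennreal (expectation (\<lambda>\<omega>. (g (x q \<omega>) * \<sigma>)\<^sup>2))" by (rule ennreal_leI)
      also have "\<dots> = (\<integral>\<^sup>+\<omega>. ennreal ((g (x q \<omega>) * \<sigma>)\<^sup>2) \<partial>M)"
        using integrable_g_square[OF q(1)] by (intro nn_integral_eq_integral[symmetric]) (auto simp: power_mult_distrib)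
      finally show "ennreal (\<sigma>\<^sup>2 * \<kappa>) \<le> (\<integral>\<^sup>+\<omega>. ennreal ((Ito_step g T n s \<omega>)\<^sup>2) \<partial>M)" unfolding q(4) .
    qed
    then show "ennreal (\<sigma>\<^sup>2 * \<kappa>) * indicator {t0 + T / 2 ^ n..<T} s
        \<le> (\<integral>\<^sup>+\<omega>. ennreal ((Ito_step g T n s \<omega>)\<^sup>2) \<partial>M) * indicator {0..T} s"
      by (cases "s \<in> {t0 + T / 2 ^ n..<T}") (simp_all del: atLeastLessThan_iff atLeastAtMost_iff)
  qed
  also have "\<dots> = (\<integral>\<^sup>+\<omega>. ennreal ((Ito_sum g T n \<omega>)\<^sup>2) \<partial>M)"
    unfolding Ito_sum_def Ito_step_def by (rule simple_isometry(2)[OF simple_family_Ito[OF T], symmetric])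
  also have "\<dots> = ennreal (expectation (\<lambda>\<omega>. (Ito_sum g T n \<omega>)\<^sup>2))"
    using Ito_sum_square_integrable[OF T] by (intro nn_integral_eq_integral) auto
  finally show ?thesis by (subst (asm) ennreal_le_iff) simp_all
qed

text \<open>The mean and the growth of the second moment pass from the Riemann sums to the limit.
  The factor 2 is the price of comparing squares by \<open>square_add_le\<close>; it does not affect
  linear growth in \<open>T\<close>.\<close>

lemma Ito_limit_moments:
  assumes T: "0 \<le> T" and R [measurable]: "R \<in> borel_measurable M"
    and lim: "AE \<omega> in M. (\<lambda>n. Ito_sum g T n \<omega>) \<longlonglongrightarrow> R \<omega>"
    and t0: "0 \<le> t0" and \<kappa>: "0 \<le> \<kappa>" "\<And>s. s \<ge> t0 \<Longrightarrow> \<kappa> \<le> expectation (\<lambda>\<omega>. (g (x s \<omega>))\<^sup>2)"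
  shows "integrable M (\<lambda>\<omega>. (R \<omega>)\<^sup>2)" "expectation R = 0" "\<sigma>\<^sup>2 * \<kappa> * (T - t0) \<le> 2 * expectation (\<lambda>\<omega>. (R \<omega>)\<^sup>2)"
proof -
  let ?S = "Ito_sum g T" and ?C = "4 * T * step_error T"
  have [measurable]: "?S n \<in> borel_measurable M" for n using T by simp
  have C: "?C / 2 ^ n \<ge> 0" for n using T step_error_nonneg[OF T] by simp
  have D: "integrable M (\<lambda>\<omega>. (R \<omega> - ?S n \<omega>)\<^sup>2)" "expectation (\<lambda>\<omega>. (R \<omega> - ?S n \<omega>)\<^sup>2) \<le> ?C / 2 ^ n" for n
    using integrable_square_if_nn_integral_le[OF _ C Ito_sum_limit[OF T R lim]] by auto
  have Ssq: "integrable M (\<lambda>\<omega>. (?S n \<omega>)\<^sup>2)" for n by (rule Ito_sum_square_integrable[OF T])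
  have S1: "integrable M (?S n)" for n by (rule square_integrable_imp_integrable[OF _ Ssq]) simp
  show Rsq: "integrable M (\<lambda>\<omega>. (R \<omega>)\<^sup>2)"
    using integrable_square_add[OF _ _ D(1)[of 0] Ssq[of 0]] by simp
  have R1: "integrable M R" by (rule square_integrable_imp_integrable[OF R Rsq])
  \<comment> \<open>The sums have mean 0, so the mean of \<open>R\<close> is that of the
    approximation error.\<close>
  have "(expectation R)\<^sup>2 \<le> ?C / 2 ^ n" for n
  proof -
    have "expectation R = expectation (\<lambda>\<omega>. R \<omega> - ?S n \<omega>)"
      using R1 S1 expectation_Ito_sum[OF T] by simp
    then show ?thesis
      using expectation_square_le[OF _ D(1), of n] D(2)[of n] by simp
  qed
  then have "(expectation R)\<^sup>2 \<le> 0"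
    by (intro LIMSEQ_le_const[OF mesh_width_tendsto_0]) auto
  then show "expectation R = 0" by simp
  have "\<sigma>\<^sup>2 * \<kappa> * (T - t0 - T / 2 ^ n) \<le> 2 * expectation (\<lambda>\<omega>. (R \<omega>)\<^sup>2) + 2 * (?C / 2 ^ n)" for n
  proof -
    have "(?S n \<omega>)\<^sup>2 \<le> 2 * (R \<omega>)\<^sup>2 + 2 * (R \<omega> - ?S n \<omega>)\<^sup>2" for \<omega>
      using square_add_le[of "R \<omega>" "- (R \<omega> - ?S n \<omega>)"] by (simp add: power2_commute)
    then have "expectation (\<lambda>\<omega>. (?S n \<omega>)\<^sup>2) \<le> expectation (\<lambda>\<omega>. 2 * (R \<omega>)\<^sup>2 + 2 * (R \<omega> - ?S n \<omega>)\<^sup>2)"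
      using Ssq Rsq D(1) by (intro integral_mono) auto
    also have "\<dots> = 2 * expectation (\<lambda>\<omega>. (R \<omega>)\<^sup>2) + 2 * expectation (\<lambda>\<omega>. (R \<omega> - ?S n \<omega>)\<^sup>2)"
      using Rsq D(1) by simp
    finally show ?thesis
      using D(2)[of n] expectation_Ito_sum_square_ge[OF T t0 \<kappa>, of n] by linarith
  qed
  moreover have "(\<lambda>n. \<sigma>\<^sup>2 * \<kappa> * (T - t0 - T / 2 ^ n)) \<longlonglongrightarrow> \<sigma>\<^sup>2 * \<kappa> * (T - t0 - 0)"
    by (intro tendsto_intros mesh_width_tendsto_0)
  moreover have "(\<lambda>n. 2 * expectation (\<lambda>\<omega>. (R \<omega>)\<^sup>2) + 2 * (?C / 2 ^ n)) \<longlonglongrightarrow> 2 * expectation (\<lambda>\<omega>. (R \<omega>)\<^sup>2) + 2 * 0"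
    by (intro tendsto_intros mesh_width_tendsto_0)
  ultimately show "\<sigma>\<^sup>2 * \<kappa> * (T - t0) \<le> 2 * expectation (\<lambda>\<omega>. (R \<omega>)\<^sup>2)"
    using LIMSEQ_le by fastforce
qed

end

section \<open>Variance of the logarithm of wealth\<close>

lemma integrable_square_mult:
  fixes X :: "'a \<Rightarrow> real"
  shows "integrable M (\<lambda>\<omega>. (X \<omega>)\<^sup>2) \<Longrightarrow> integrable M (\<lambda>\<omega>. (c * X \<omega>)\<^sup>2)"
  by (simp add: power_mult_distrib)

locale log_wealth = ou +
  fixes f :: "real \<Rightarrow> real" and u :: "real \<Rightarrow> 'a \<Rightarrow> real" and K :: real
  assumes D_policy: "D_policy K f" and log_wealth: "log_wealth_process M F z \<alpha> \<sigma> x f u"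
    and u0: "integrable M (\<lambda>\<omega>. (u 0 \<omega>)\<^sup>2)"
begin

lemma u_M [measurable]: "0 \<le> t \<Longrightarrow> u t \<in> borel_measurable M"
  using log_wealth by (simp add: log_wealth_process_def ito_process_def)

lemma u0_F: "u 0 \<in> borel_measurable (F 0)"
  using log_wealth by (simp add: log_wealth_process_def ito_process_def)

text \<open>If f - V' is nonzero somewhere, the centred martingale part \<open>R\<close> has
  linearly growing second moment, while the rest of \<open>u\<close> has bounded second moment up to
  a deterministic drift. The variance is then unbounded.\<close>

lemma linear_if_asymptotically_constant:
  assumes var: "asymptotically_constant (\<lambda>t. variance (u t))"
  shows "linear_policy f"
proof -
  obtain D where D: "\<And>y. (f has_real_derivative D y) (at y)" "continuous_on UNIV D"
    using D_policy unfolding D_policy_def C1_differentiable_on_def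
    by (auto simp: has_real_derivative_iff_has_vector_derivative)
  have DK: "\<bar>D y\<bar> \<le> K" for y
    using D_policy DERIV_imp_deriv[OF D(1)[of y]] unfolding D_policy_def by metis
  obtain V V1 V2 c C where V: "\<And>y. (V has_real_derivative V1 y) (at y)" "\<And>y. (V1 has_real_derivative V2 y) (at y)"
    and V2: "continuous_on UNIV V2" "\<And>y. \<bar>V2 y\<bar> \<le> C"
    and generator: "\<And>y. - \<alpha> * y * V1 y + \<sigma>\<^sup>2 / 2 * V2 y = f y * (- \<alpha> * y) + c"
    and const: "(\<forall>y. f y = V1 y) \<longrightarrow> (\<forall>y. D y = D 0)"
    by (rule Poisson_equation[OF \<alpha> \<sigma> D DK]) (rule that)
  show ?thesis
  proof (cases "\<forall>y. f y = V1 y")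
    case True
    then have D0: "D y = D 0" for y using const by blast
    have "((\<lambda>y. f y - D 0 * y) has_real_derivative 0) (at y)" for y
      using D(1)[of y] D0[of y] by (auto intro!: derivative_eq_intros)
    then have "f y - D 0 * y = f 0 - D 0 * 0" for y
      by (intro DERIV_isconst_all) blast
    then have "\<forall>y. f y = D 0 * y + f 0"
      by (metis add.commute diff_add_cancel diff_zero mult_zero_right)
    then show ?thesis
      unfolding linear_policy_def by blast
  next
    case False
    then obtain p where p: "f p - V1 p \<noteq> 0" by auto
    have flip: "\<bar>f a - f b\<bar> \<le> K * \<bar>a - b\<bar>" and V1lip: "\<bar>V1 a - V1 b\<bar> \<le> C * \<bar>a - b\<bar>" for a b
      by (rule lipschitz_if_derivative_bounded[OF D(1) DK], rule lipschitz_if_derivative_bounded[OF V(2) V2(2)])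
    interpret r: ou_lipschitz M F z \<alpha> \<sigma> x "\<lambda>y. f y - V1 y" "K + C"
    proof unfold_locales
      fix a b
      show "\<bar>(f a - V1 a) - (f b - V1 b)\<bar> \<le> (K + C) * \<bar>a - b\<bar>"
        using flip[of a b] V1lip[of a b] unfolding distrib_right by linarith
    qed
    have rc: "continuous_on UNIV (\<lambda>y. f y - V1 y)"
      using D(1) V(2) by (intro continuous_on_diff DERIV_continuous_on) (auto intro: DERIV_subset)
    obtain t0 \<kappa> where t0: "t0 \<ge> 0" and \<kappa>: "\<kappa> > 0" "\<And>s. s \<ge> t0 \<Longrightarrow> \<kappa> \<le> expectation (\<lambda>\<omega>. (f (x s \<omega>) - V1 (x s \<omega>))\<^sup>2)"
      using expectation_square_bounded_below[OF rc p r.integrable_g_square] by blast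
    have [measurable]: "V \<in> borel_measurable borel"
      using V(1) by (intro borel_measurable_continuous_onI DERIV_continuous_on) (auto intro: DERIV_subset)
    \<comment> \<open>Coefficients of a bound A0 + A2 y^2 for \<bar>V y\<bar>; the linear Taylor
      term is absorbed by \<bar>y\<bar> \<le> 1 + y^2.\<close>
    define A0 where "A0 = \<bar>V 0\<bar> + \<bar>V1 0\<bar>"
    define A2 where "A2 = \<bar>V1 0\<bar> + \<bar>V2 0\<bar> / 2 + C"
    have V_le: "(V y)\<^sup>2 \<le> 2 * A0\<^sup>2 + 2 * A2\<^sup>2 * y ^ 4" for y
    proof -
      \<comment> \<open>Taylor's estimate at the origin with the crude oscillation bound 2 C for
        \<open>V2\<close>, valid everywhere.\<close>
      have "\<bar>V y - V 0 - V1 0 * (y - 0) - V2 0 / 2 * (y - 0)\<^sup>2\<bar> \<le> (2 * C) / 2 * (y - 0)\<^sup>2"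
      proof (rule abs_diff_Taylor_2_le[OF V])
        fix w show "\<bar>V2 w - V2 0\<bar> \<le> 2 * C" using V2(2)[of w] V2(2)[of 0] by linarith
      qed
      then have 1: "\<bar>V y - V 0 - V1 0 * y - V2 0 / 2 * y\<^sup>2\<bar> \<le> C * y\<^sup>2" by simp
      have "\<bar>V1 0 * y\<bar> \<le> \<bar>V1 0\<bar> * (1 + y\<^sup>2)"
        unfolding abs_mult using sum_squares_bound[of 1 "\<bar>y\<bar>"] by (intro mult_left_mono) (auto simp: power2_eq_square)
      moreover have "\<bar>V2 0 / 2 * y\<^sup>2\<bar> = \<bar>V2 0\<bar> / 2 * y\<^sup>2" by (simp add: abs_mult)
      ultimately have "\<bar>V y\<bar> \<le> \<bar>V 0\<bar> + \<bar>V1 0\<bar> * (1 + y\<^sup>2) + \<bar>V2 0\<bar> / 2 * y\<^sup>2 + C * y\<^sup>2"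
        using 1 by linarith
      also have "\<dots> = A0 + A2 * y\<^sup>2" by (simp add: A0_def A2_def algebra_simps)
      finally have "(V y)\<^sup>2 \<le> (A0 + A2 * y\<^sup>2)\<^sup>2"
        by (metis abs_ge_zero power2_abs power_mono)
      also have "\<dots> \<le> 2 * A0\<^sup>2 + 2 * (A2 * y\<^sup>2)\<^sup>2" by (rule square_add_le)
      finally show ?thesis by (simp add: power_mult_distrib)
    qed
    define BV where "BV = 2 * A0\<^sup>2 + 2 * A2\<^sup>2 * fourth_bound"
    have Vsq: "integrable M (\<lambda>\<omega>. (V (x t \<omega>))\<^sup>2)" "expectation (\<lambda>\<omega>. (V (x t \<omega>))\<^sup>2) \<le> BV" if t: "0 \<le> t" for t
    proof -
      have int: "integrable M (\<lambda>\<omega>. 2 * A0\<^sup>2 + 2 * A2\<^sup>2 * x t \<omega> ^ 4)" using integrable_x_fourth[OF t] by simp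
      show sq: "integrable M (\<lambda>\<omega>. (V (x t \<omega>))\<^sup>2)"
        using t V_le by (intro Bochner_Integration.integrable_bound[OF int]) auto
      have "expectation (\<lambda>\<omega>. (V (x t \<omega>))\<^sup>2) \<le> expectation (\<lambda>\<omega>. 2 * A0\<^sup>2 + 2 * A2\<^sup>2 * x t \<omega> ^ 4)"
        by (intro integral_mono sq int V_le)
      also have "\<dots> = 2 * A0\<^sup>2 + 2 * A2\<^sup>2 * expectation (\<lambda>\<omega>. x t \<omega> ^ 4)"
        using integrable_x_fourth[OF t] by (simp add: prob_space)
      also have "\<dots> \<le> BV"
        unfolding BV_def using expectation_x_fourth_le[OF t] by (intro add_left_mono mult_left_mono) auto
      finally show "expectation (\<lambda>\<omega>. (V (x t \<omega>))\<^sup>2) \<le> BV" .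
    qed
    define BD where "BD = 2 * expectation (\<lambda>\<omega>. (u 0 \<omega>)\<^sup>2) + 2 * (2 * BV + 2 * BV)"
    have main: "\<sigma>\<^sup>2 * \<kappa> * (T - t0) \<le> 4 * variance (u T) + 4 * BD" if T: "0 \<le> T" for T
    proof -
      define Y where "Y = (\<lambda>\<omega>. u 0 \<omega> + (V (x T \<omega>) - V (x 0 \<omega>)))"
      define R where "R = (\<lambda>\<omega>. u T \<omega> - u 0 \<omega> - (V (x T \<omega>) - V (x 0 \<omega>)) + c * T)"
      have [measurable]: "Y \<in> borel_measurable M" "R \<in> borel_measurable M"
        using T by (auto simp: Y_def R_def)
      have lim: "AE \<omega> in M. (\<lambda>n. Ito_sum (\<lambda>y. f y - V1 y) T n \<omega>) \<longlonglongrightarrow> R \<omega>"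
        unfolding R_def by (rule log_wealth_decomposition[OF T log_wealth flip V V2 generator])
      have Rm: "R \<in> borel_measurable M" by measurable
      have R: "integrable M (\<lambda>\<omega>. (R \<omega>)\<^sup>2)" "expectation R = 0"
          "\<sigma>\<^sup>2 * \<kappa> * (T - t0) \<le> 2 * expectation (\<lambda>\<omega>. (R \<omega>)\<^sup>2)"
        using r.Ito_limit_moments[OF T Rm lim t0 less_imp_le[OF \<kappa>(1)]] \<kappa>(2) by blast+
      have Y_le: "(Y \<omega>)\<^sup>2 \<le> 2 * (u 0 \<omega>)\<^sup>2 + 2 * (2 * (V (x T \<omega>))\<^sup>2 + 2 * (V (x 0 \<omega>))\<^sup>2)" for \<omega>
      proof -
        have "(Y \<omega>)\<^sup>2 \<le> 2 * (u 0 \<omega>)\<^sup>2 + 2 * (V (x T \<omega>) - V (x 0 \<omega>))\<^sup>2" unfolding Y_def by (rule square_add_le)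
        also have "\<dots> \<le> 2 * (u 0 \<omega>)\<^sup>2 + 2 * (2 * (V (x T \<omega>))\<^sup>2 + 2 * (V (x 0 \<omega>))\<^sup>2)"
          using square_add_le[of "V (x T \<omega>)" "- V (x 0 \<omega>)"] by (intro add_left_mono mult_left_mono) auto
        finally show ?thesis .
      qed
      have Yint: "integrable M (\<lambda>\<omega>. 2 * (u 0 \<omega>)\<^sup>2 + 2 * (2 * (V (x T \<omega>))\<^sup>2 + 2 * (V (x 0 \<omega>))\<^sup>2))"
        using u0 Vsq(1)[OF T] Vsq(1)[of 0] by simp
      have Ysq: "integrable M (\<lambda>\<omega>. (Y \<omega>)\<^sup>2)"
        using Y_le by (intro Bochner_Integration.integrable_bound[OF Yint]) (auto intro: order_trans[OF _ abs_ge_self])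
      have "expectation (\<lambda>\<omega>. (Y \<omega>)\<^sup>2) \<le> expectation (\<lambda>\<omega>. 2 * (u 0 \<omega>)\<^sup>2 + 2 * (2 * (V (x T \<omega>))\<^sup>2 + 2 * (V (x 0 \<omega>))\<^sup>2))"
        by (intro integral_mono Ysq Yint Y_le)
      also have "\<dots> = 2 * expectation (\<lambda>\<omega>. (u 0 \<omega>)\<^sup>2) + 2 * (2 * expectation (\<lambda>\<omega>. (V (x T \<omega>))\<^sup>2) + 2 * expectation (\<lambda>\<omega>. (V (x 0 \<omega>))\<^sup>2))"
        using u0 Vsq(1)[OF T] Vsq(1)[of 0] by simp
      also have "\<dots> \<le> BD"
        unfolding BD_def using Vsq(2)[OF T] Vsq(2)[of 0] by simp
      finally have EY: "expectation (\<lambda>\<omega>. (Y \<omega>)\<^sup>2) \<le> BD" .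
      have Y1: "integrable M Y" and R1: "integrable M R"
        by (rule square_integrable_imp_integrable[OF _ Ysq], measurable, rule square_integrable_imp_integrable[OF Rm R(1)])
      have uT: "u T = (\<lambda>\<omega>. R \<omega> + Y \<omega> - c * T)" by (auto simp: R_def Y_def)
      have usq: "integrable M (\<lambda>\<omega>. (u T \<omega>)\<^sup>2)"
        unfolding uT diff_conv_add_uminus
        by (intro integrable_square_add R(1) Ysq) auto
      have u1: "integrable M (u T)" unfolding uT using R1 Y1 by simp
      have Eu: "expectation (u T) = expectation Y - c * T"
        unfolding uT using R1 Y1 R(2) by (simp add: prob_space)
      have var_int: "integrable M (\<lambda>\<omega>. (X \<omega> - a)\<^sup>2)"
        if "integrable M (\<lambda>\<omega>. (X \<omega>)\<^sup>2)" "integrable M X" for X :: "'a \<Rightarrow> real" and a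
        unfolding power2_diff using that by simp
      have "(R \<omega>)\<^sup>2 \<le> 2 * (u T \<omega> - expectation (u T))\<^sup>2 + 2 * (Y \<omega> - expectation Y)\<^sup>2" for \<omega>
      proof -
        \<comment> \<open>Since \<open>R\<close> has mean 0, it is the difference of the centred
          \<open>u T\<close> and the centred \<open>Y\<close>. Bounding its square avoids any
          covariance of \<open>R\<close> and \<open>Y\<close>.\<close>
        have "R \<omega> = (u T \<omega> - expectation (u T)) + - (Y \<omega> - expectation Y)"
          unfolding Eu by (simp add: uT)
        then show ?thesis using square_add_le[of "u T \<omega> - expectation (u T)" "- (Y \<omega> - expectation Y)"]
          by (simp only: power2_minus)
      qed
      then have "expectation (\<lambda>\<omega>. (R \<omega>)\<^sup>2) \<le> expectation (\<lambda>\<omega>. 2 * (u T \<omega> - expectation (u T))\<^sup>2 + 2 * (Y \<omega> - expectation Y)\<^sup>2)"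
        by (intro integral_mono R(1) Bochner_Integration.integrable_add integrable_mult_right var_int usq u1 Ysq Y1) auto
      also have "\<dots> = 2 * variance (u T) + 2 * variance Y"
        by (subst Bochner_Integration.integral_add) (auto intro!: integrable_mult_right var_int usq u1 Ysq Y1)
      finally have ER: "expectation (\<lambda>\<omega>. (R \<omega>)\<^sup>2) \<le> 2 * variance (u T) + 2 * variance Y" .
      have VY: "variance Y \<le> BD"
        unfolding variance_eq[OF Y1 Ysq] using EY zero_le_power2[of "expectation Y"] by linarith
      show ?thesis using R(3) ER VY by linarith
    qed
    obtain v where v: "((\<lambda>t. variance (u t)) \<longlongrightarrow> v) at_top"
      using var unfolding asymptotically_constant_def by blast
    \<comment> \<open>A time at which the variance is below v + 1 although \<open>main\<close> makes
      it at least v + 1.\<close>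
    have "\<forall>\<^sub>F t in at_top. variance (u t) < v + 1 \<and> max 0 (t0 + (4 * v + 4 + 4 * BD) / (\<sigma>\<^sup>2 * \<kappa>)) \<le> t"
      by (intro eventually_conj order_tendstoD(2)[OF v] eventually_ge_at_top) simp
    then obtain T where T: "variance (u T) < v + 1" "0 \<le> T" "t0 + (4 * v + 4 + 4 * BD) / (\<sigma>\<^sup>2 * \<kappa>) \<le> T"
      using eventually_happens' by (metis (no_types, lifting) max.bounded_iff trivial_limit_at_top_linorder)
    have pos: "\<sigma>\<^sup>2 * \<kappa> > 0" using \<sigma> \<kappa>(1) by simp
    have "4 * v + 4 + 4 * BD \<le> \<sigma>\<^sup>2 * \<kappa> * (T - t0)"
    proof -
      have "(4 * v + 4 + 4 * BD) / (\<sigma>\<^sup>2 * \<kappa>) \<le> T - t0" using T(3) by linarith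
      then show ?thesis unfolding pos_divide_le_eq[OF pos] by (simp only: mult.commute)
    qed
    with main[OF T(2)] T(1) have False by linarith
    then show ?thesis ..
  qed
qed

text \<open>The antiderivative of a linear \<open>f\<close> already solves the Poisson equation, so
  the martingale part is 0 and \<open>u t\<close> is, up to a deterministic drift, a quadratic
  polynomial in \<open>x t\<close> plus terms known at time 0.\<close>

lemma asymptotically_constant_if_linear:
  assumes "linear_policy f"
  shows "asymptotically_constant (\<lambda>t. variance (u t))"
proof -
  obtain a b where f: "\<And>y. f y = a * y + b" using assms unfolding linear_policy_def by blast
  let ?V = "\<lambda>y::real. a / 2 * y\<^sup>2 + b * y"
  define A where "A = (\<lambda>\<omega>. u 0 \<omega> + (- (a / 2) * (x 0 \<omega>)\<^sup>2 + - b * x 0 \<omega>))"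
  \<comment> \<open>The second derivative of the antiderivative is \<open>a\<close>, and \<sigma>^2
    / 2 times it is the generator constant.\<close>
  define c where "c = \<sigma>\<^sup>2 / 2 * a"
  define U where "U = (\<lambda>t \<omega>. A \<omega> + ?V (x t \<omega>))"
  have u_eq: "AE \<omega> in M. u t \<omega> = U t \<omega> - c * t" if t: "0 \<le> t" for t
  proof -
    \<comment> \<open>These sums are identically 0, so their stated limit must be 0.\<close>
    have "AE \<omega> in M. (\<lambda>n. Ito_sum (\<lambda>y. f y - f y) t n \<omega>) \<longlonglongrightarrow> u t \<omega> - u 0 \<omega> - (?V (x t \<omega>) - ?V (x 0 \<omega>)) + c * t"
    proof (rule log_wealth_decomposition[OF t log_wealth])
      show "\<bar>f p - f q\<bar> \<le> \<bar>a\<bar> * \<bar>p - q\<bar>" for p q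
        unfolding f by (simp flip: right_diff_distrib abs_mult)
      show "(?V has_real_derivative f y) (at y)" "(f has_real_derivative a) (at y)" for y
        unfolding f[abs_def] by (auto intro!: derivative_eq_intros)
    qed (auto simp: c_def)
    then show ?thesis
    proof eventually_elim
      case (elim \<omega>)
      then have "u t \<omega> - u 0 \<omega> - (?V (x t \<omega>) - ?V (x 0 \<omega>)) + c * t = 0"
        by (intro LIMSEQ_unique[OF _ tendsto_const]) (simp add: Ito_sum_eq)
      then show ?case by (simp add: U_def A_def)
    qed
  qed
  have x0m [measurable]: "x 0 \<in> borel_measurable M" "u 0 \<in> borel_measurable M" by auto
  have Am: "A \<in> borel_measurable (F 0)"
    unfolding A_def using u0_F x_F[of 0] by (intro borel_measurable_add borel_measurable_times borel_measurable_power) auto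
  have [measurable]: "A \<in> borel_measurable M" using measurable_F[OF Am] .
  have x0sq: "integrable M (\<lambda>\<omega>. (x 0 \<omega>)\<^sup>2)" using integrable_x_square[of 0] by simp
  have x04: "integrable M (\<lambda>\<omega>. ((x 0 \<omega>)\<^sup>2)\<^sup>2)" using x0 by simp
  have Asq: "integrable M (\<lambda>\<omega>. (A \<omega>)\<^sup>2)"
    unfolding A_def by (intro integrable_square_add integrable_square_mult u0 x0sq x04) auto
  have A1: "integrable M A" by (rule square_integrable_imp_integrable[OF _ Asq]) simp
  \<comment> \<open>\<open>U t = P t + Q t * N + a / 2 * N\<^sup>2\<close> with the innovation \<open>N\<close> up to \<open>t\<close>, which is independent of \<open>P t\<close> and \<open>Q t\<close>\<close>
  define q where "q = (\<lambda>t. exp (- \<alpha> * t))"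
  define P where "P = (\<lambda>t \<omega>. A \<omega> + (a / 2 * (q t)\<^sup>2 * (x 0 \<omega>)\<^sup>2 + b * q t * x 0 \<omega>))"
  define Q where "Q = (\<lambda>t \<omega>. a * q t * x 0 \<omega> + b)"
  have PF: "P t \<in> borel_measurable (F 0)" and QF: "Q t \<in> borel_measurable (F 0)" for t
    unfolding P_def Q_def using Am x_F[of 0] by auto
  have Pm [measurable]: "P t \<in> borel_measurable M" and Qm [measurable]: "Q t \<in> borel_measurable M" for t
    using measurable_F[OF PF] measurable_F[OF QF] .
  have Psq: "integrable M (\<lambda>\<omega>. (P t \<omega>)\<^sup>2)" for t
    unfolding P_def by (intro integrable_square_add integrable_square_mult Asq x0sq x04) auto
  have Qsq: "integrable M (\<lambda>\<omega>. (Q t \<omega>)\<^sup>2)" for t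
    unfolding Q_def by (intro integrable_square_add integrable_square_mult x0sq) auto
  have P1: "integrable M (P t)" and Q1: "integrable M (Q t)" for t
    by (rule square_integrable_imp_integrable[OF Pm Psq], rule square_integrable_imp_integrable[OF Qm Qsq])
  have PQ: "integrable M (\<lambda>\<omega>. P t \<omega> * Q t \<omega>)" for t
    by (rule integrable_mult_if_square_integrable[OF Pm Qm Psq Qsq])
  \<comment> \<open>The second moment minus the squared mean of the polynomial, with the Gaussian
    moments 0, v, 0 and 3 v^2 inserted.\<close>
  define W where "W = (\<lambda>t. expectation (\<lambda>\<omega>. (P t \<omega>)\<^sup>2) + (expectation (\<lambda>\<omega>. (Q t \<omega>)\<^sup>2) + a * expectation (P t)) * innovation_variance t
      + a\<^sup>2 / 4 * (3 * (innovation_variance t)\<^sup>2) - (expectation (P t) + a / 2 * innovation_variance t)\<^sup>2)"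
  have varU: "variance (U t) = W t" if t: "0 < t" for t
  proof -
    interpret N: normal_indep M "F 0" "innovation 0 t" "innovation_variance t"
      using normal_indep_innovation[of 0 t] t by simp
    let ?N = "innovation 0 t"
    have Ueq: "U t \<omega> = P t \<omega> + Q t \<omega> * ?N \<omega> ^ 1 + a / 2 * ?N \<omega> ^ 2" for \<omega>
      unfolding U_def P_def Q_def q_def x_eq_innovation[of t] by (simp add: power2_eq_square algebra_simps)
    have Usq_eq: "(U t \<omega>)\<^sup>2 = (P t \<omega>)\<^sup>2 + 2 * (P t \<omega> * Q t \<omega> * ?N \<omega> ^ 1) + ((Q t \<omega>)\<^sup>2 + a * P t \<omega>) * ?N \<omega> ^ 2
        + a * (Q t \<omega> * ?N \<omega> ^ 3) + a\<^sup>2 / 4 * ?N \<omega> ^ 4" for \<omega>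
      unfolding Ueq by (simp add: power2_eq_square power3_eq_cube power4_eq_xxxx algebra_simps)
    have QP: "integrable M (\<lambda>\<omega>. (Q t \<omega>)\<^sup>2 + a * P t \<omega>)" using Qsq P1 by simp
    have QPF: "(\<lambda>\<omega>. (Q t \<omega>)\<^sup>2 + a * P t \<omega>) \<in> borel_measurable (F 0)" using PF QF by auto
    have PQF: "(\<lambda>\<omega>. P t \<omega> * Q t \<omega>) \<in> borel_measurable (F 0)" using PF QF by auto
    note i = N.integrable_mult_power[OF QF Q1, of t 1] N.integrable_mult_power[OF PQF PQ, of 1]
      N.integrable_mult_power[OF QPF QP, of 2] N.integrable_mult_power[OF QF Q1, of t 3] N.integrable_X_power[of 2] N.integrable_X_power[of 4]
    have U1: "integrable M (U t)" unfolding Ueq using i P1[of t] by (intro Bochner_Integration.integrable_add integrable_mult_right)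
    have U2: "integrable M (\<lambda>\<omega>. (U t \<omega>)\<^sup>2)"
      unfolding Usq_eq using i Psq[of t] by (intro Bochner_Integration.integrable_add integrable_mult_right)
    have N1: "expectation (\<lambda>\<omega>. ?N \<omega> ^ 1) = 0" using N.expectation_X by simp
    have EU: "expectation (U t) = expectation (P t) + a / 2 * innovation_variance t"
    proof -
      have "expectation (U t) = expectation (P t) + expectation (\<lambda>\<omega>. Q t \<omega> * ?N \<omega> ^ 1) + a / 2 * expectation (\<lambda>\<omega>. ?N \<omega> ^ 2)"
        unfolding Ueq[abs_def] using i P1[of t]
        by (simp only: Bochner_Integration.integral_add Bochner_Integration.integrable_add integrable_mult_right integral_mult_right_zero)
      then show ?thesis
        unfolding N.expectation_mult_power[OF QF Q1] N1 N.expectation_X_square by simp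
    qed
    have "expectation (\<lambda>\<omega>. (U t \<omega>)\<^sup>2) = expectation (\<lambda>\<omega>. (P t \<omega>)\<^sup>2) + 2 * expectation (\<lambda>\<omega>. P t \<omega> * Q t \<omega> * ?N \<omega> ^ 1)
       + expectation (\<lambda>\<omega>. ((Q t \<omega>)\<^sup>2 + a * P t \<omega>) * ?N \<omega> ^ 2) + a * expectation (\<lambda>\<omega>. Q t \<omega> * ?N \<omega> ^ 3) + a\<^sup>2 / 4 * expectation (\<lambda>\<omega>. ?N \<omega> ^ 4)"
      unfolding Usq_eq using i Psq[of t]
      by (simp only: Bochner_Integration.integral_add Bochner_Integration.integrable_add integrable_mult_right integral_mult_right_zero)
    also have "\<dots> = expectation (\<lambda>\<omega>. (P t \<omega>)\<^sup>2) + (expectation (\<lambda>\<omega>. (Q t \<omega>)\<^sup>2) + a * expectation (P t)) * innovation_variance t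
       + a\<^sup>2 / 4 * (3 * (innovation_variance t)\<^sup>2)"
      unfolding N.expectation_mult_power[OF QF Q1] N.expectation_mult_power[OF PQF PQ] N.expectation_mult_power[OF QPF QP]
        N1 N.expectation_X_square N.expectation_X_cube N.expectation_X_fourth
      using Qsq[of t] P1[of t] by simp
    finally have "variance (U t) = W t + (expectation (P t) + a / 2 * innovation_variance t)\<^sup>2 - (expectation (U t))\<^sup>2"
      unfolding variance_eq[OF U1 U2] W_def by simp
    then show ?thesis unfolding EU[symmetric] by simp
  qed
  have var_u: "variance (u t) = W t" if t: "0 < t" for t
  proof -
    have Um: "U t \<in> borel_measurable M" using t by (simp add: U_def)
    have U1: "integrable M (U t)"
    proof -
      have "integrable M (\<lambda>\<omega>. (x t \<omega>)\<^sup>2)" "integrable M (x t)"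
        using t integrable_x_square[of t] square_integrable_imp_integrable[of "x t"] by auto
      then show ?thesis unfolding U_def using A1 by simp
    qed
    have E: "expectation (u t) = expectation (U t) - c * t"
    proof -
      have "expectation (u t) = expectation (\<lambda>\<omega>. U t \<omega> - c * t)"
        using t Um u_eq[of t] by (intro integral_cong_AE) auto
      then show ?thesis using U1 by (simp add: prob_space)
    qed
    have "variance (u t) = variance (U t)"
      using t Um u_eq[OF less_imp_le[OF t]] unfolding E
      by (intro integral_cong_AE) (auto elim!: eventually_mono)
    then show ?thesis using varU[OF t] by simp
  qed
  have q0: "(q \<longlongrightarrow> 0) at_top"
    unfolding q_def using \<alpha>
    by (intro filterlim_compose[OF exp_at_bot] filterlim_tendsto_neg_mult_at_bot[OF tendsto_const] filterlim_ident) auto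
  have q1: "0 \<le> q t" "q t \<le> 1" if "0 \<le> t" for t using that \<alpha> by (auto simp: q_def)
  have v: "(innovation_variance \<longlongrightarrow> \<sigma>\<^sup>2 * (1 - 0\<^sup>2) / (2 * \<alpha>)) at_top"
  proof -
    have "innovation_variance t = \<sigma>\<^sup>2 * (1 - (q t)\<^sup>2) / (2 * \<alpha>)" for t
      by (simp add: innovation_variance_def q_def power2_eq_square flip: exp_add)
    then have "innovation_variance = (\<lambda>t. \<sigma>\<^sup>2 * (1 - (q t)\<^sup>2) / (2 * \<alpha>))" by auto
    then show ?thesis using \<alpha> by (simp only:) (intro tendsto_intros q0, simp)
  qed
  \<comment> \<open>Because \<open>q\<close> lies between 0 and 1, this dominates \<open>P t\<close>
    uniformly in t \<ge> 0; the fourth moment of \<open>x 0\<close> makes its square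
    integrable.\<close>
  define w where "w = (\<lambda>\<omega>. \<bar>A \<omega>\<bar> + (\<bar>a / 2\<bar> * (x 0 \<omega>)\<^sup>2 + \<bar>b\<bar> * \<bar>x 0 \<omega>\<bar>))"
  have wsq: "integrable M (\<lambda>\<omega>. (w \<omega>)\<^sup>2)"
    unfolding w_def using Asq x0sq x04 by (intro integrable_square_add integrable_square_mult) auto
  have wm [measurable]: "w \<in> borel_measurable M" unfolding w_def by measurable
  have w1: "integrable M w" by (rule square_integrable_imp_integrable[OF wm wsq])
  have Pw: "\<bar>P t \<omega>\<bar> \<le> w \<omega>" if t: "0 \<le> t" for t \<omega>
  proof -
    have "\<bar>a / 2 * (q t)\<^sup>2 * (x 0 \<omega>)\<^sup>2\<bar> \<le> \<bar>a / 2\<bar> * 1 * (x 0 \<omega>)\<^sup>2"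
      unfolding abs_mult using q1[OF t] by (intro mult_mono) (auto simp: power_le_one)
    moreover have "\<bar>b * q t * x 0 \<omega>\<bar> \<le> \<bar>b\<bar> * 1 * \<bar>x 0 \<omega>\<bar>"
      unfolding abs_mult using q1[OF t] by (intro mult_mono) auto
    ultimately show ?thesis unfolding P_def w_def by linarith
  qed
  have w0: "0 \<le> w \<omega>" for \<omega> using Pw[of 0 \<omega>] by linarith
  have Plim: "((\<lambda>t. P t \<omega>) \<longlongrightarrow> A \<omega>) at_top" for \<omega>
  proof -
    have "((\<lambda>t. P t \<omega>) \<longlongrightarrow> A \<omega> + (a / 2 * 0\<^sup>2 * (x 0 \<omega>)\<^sup>2 + b * 0 * x 0 \<omega>)) at_top"
      unfolding P_def by (intro tendsto_intros q0)
    then show ?thesis by simp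
  qed
  have EP: "((\<lambda>t. expectation (P t)) \<longlongrightarrow> expectation A) at_top"
  proof (rule integral_dominated_convergence_at_top[where w = w])
    show "\<forall>\<^sub>F t in at_top. AE \<omega> in M. norm (P t \<omega>) \<le> w \<omega>"
      using eventually_ge_at_top[of "0::real"] by eventually_elim (simp add: Pw)
  qed (use w1 Plim in auto)
  have EP2: "((\<lambda>t. expectation (\<lambda>\<omega>. (P t \<omega>)\<^sup>2)) \<longlongrightarrow> expectation (\<lambda>\<omega>. (A \<omega>)\<^sup>2)) at_top"
  proof (rule integral_dominated_convergence_at_top[where w = "\<lambda>\<omega>. (w \<omega>)\<^sup>2"])
    show "AE \<omega> in M. ((\<lambda>t. (P t \<omega>)\<^sup>2) \<longlongrightarrow> (A \<omega>)\<^sup>2) at_top" by (intro AE_I2 tendsto_intros Plim)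
    show "\<forall>\<^sub>F t in at_top. AE \<omega> in M. norm ((P t \<omega>)\<^sup>2) \<le> (w \<omega>)\<^sup>2"
      using eventually_ge_at_top[of "0::real"]
    proof eventually_elim
      case (elim t)
      have "(P t \<omega>)\<^sup>2 \<le> (w \<omega>)\<^sup>2" for \<omega> using Pw[OF elim, of \<omega>] w0[of \<omega>] by (simp add: abs_le_square_iff[symmetric])
      then show ?case by simp
    qed
  qed (use wsq in auto)
  have EQ2: "((\<lambda>t. expectation (\<lambda>\<omega>. (Q t \<omega>)\<^sup>2)) \<longlongrightarrow> b\<^sup>2) at_top"
  proof -
    have "expectation (\<lambda>\<omega>. (Q t \<omega>)\<^sup>2) = a\<^sup>2 * (q t)\<^sup>2 * expectation (\<lambda>\<omega>. (x 0 \<omega>)\<^sup>2) + 2 * a * q t * b * expectation (x 0) + b\<^sup>2" for t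
    proof -
      have "integrable M (x 0)" by (rule square_integrable_imp_integrable[OF _ x0sq]) simp
      moreover have "(Q t \<omega>)\<^sup>2 = a\<^sup>2 * (q t)\<^sup>2 * (x 0 \<omega>)\<^sup>2 + 2 * a * q t * b * x 0 \<omega> + b\<^sup>2" for \<omega>
        by (simp add: Q_def power2_eq_square algebra_simps)
      ultimately show ?thesis using x0sq by (simp add: prob_space)
    qed
    moreover have "((\<lambda>t. a\<^sup>2 * (q t)\<^sup>2 * expectation (\<lambda>\<omega>. (x 0 \<omega>)\<^sup>2) + 2 * a * q t * b * expectation (x 0) + b\<^sup>2)
        \<longlongrightarrow> a\<^sup>2 * 0\<^sup>2 * expectation (\<lambda>\<omega>. (x 0 \<omega>)\<^sup>2) + 2 * a * 0 * b * expectation (x 0) + b\<^sup>2) at_top"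
      by (intro tendsto_intros q0)
    ultimately show ?thesis by simp
  qed
  obtain l where "(W \<longlongrightarrow> l) at_top"
  proof
    show "(W \<longlongrightarrow> expectation (\<lambda>\<omega>. (A \<omega>)\<^sup>2) + (b\<^sup>2 + a * expectation A) * (\<sigma>\<^sup>2 * (1 - 0\<^sup>2) / (2 * \<alpha>))
      + a\<^sup>2 / 4 * (3 * (\<sigma>\<^sup>2 * (1 - 0\<^sup>2) / (2 * \<alpha>))\<^sup>2) - (expectation A + a / 2 * (\<sigma>\<^sup>2 * (1 - 0\<^sup>2) / (2 * \<alpha>)))\<^sup>2) at_top"
      unfolding W_def by (intro tendsto_intros EP EP2 EQ2 v)
  qed
  \<comment> \<open>The formula needs t > 0, since the innovation is degenerate at time 0.\<close>
  moreover have "\<forall>\<^sub>F t in at_top. W t = variance (u t)"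
    using eventually_gt_at_top[of "0::real"] by eventually_elim (simp add: var_u)
  ultimately show ?thesis
    unfolding asymptotically_constant_def by (blast intro: Lim_transform_eventually)
qed

end

theorem theorem3p1:
  fixes M :: "'a measure" and F :: "real \<Rightarrow> 'a measure"
    and z x u :: "real \<Rightarrow> 'a \<Rightarrow> real"
    and f :: "real \<Rightarrow> real" and \<alpha> \<sigma> K :: real
  assumes "filtered_prob_space M F"
    and "wiener_process M F z"
    and "\<alpha> > 0" and "\<sigma> > 0"
    and "ou_process M F z \<alpha> \<sigma> x" and "integrable M (\<lambda>\<omega>. x 0 \<omega> ^ 4)"
    and "D_policy K f"
    and "log_wealth_process M F z \<alpha> \<sigma> x f u" and "integrable M (\<lambda>\<omega>. (u 0 \<omega>)\<^sup>2)"
  shows "asymptotically_constant (\<lambda>t. prob_space.variance M (u t)) \<longleftrightarrow> linear_policy f"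
proof -
  interpret prob_space M using assms(1) by (simp add: filtered_prob_space_def)
  interpret log_wealth M F z \<alpha> \<sigma> x f u K
    by unfold_locales (use assms in auto)
  show ?thesis
    using linear_if_asymptotically_constant asymptotically_constant_if_linear by blast
qed

end
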